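(* Let $\mathcal W_n$ be $S_n$ or $B_n$, and let $k$ be a commutative ring. Every $\mathrm{FI}_{\mathcal W}\sharp$-module $V$ over $k$ is of the form $$V\cong\bigoplus_{a=0}^{\infty}M_{\mathcal W}(U_a),\qquad U_a \text{ a representation of } \mathcal W_a \text{ over } k\ (\text{possibly } U_a=0).$$ Moreover, the functors $$M_{\mathcal W}(-):\mathrm{FB}_{\mathcal W}\text{-Mod}\longrightarrow \mathrm{FI}_{\mathcal W}\sharp\text{-Mod}\quad\text{and}\quad H_0(-):\mathrm{FI}_{\mathcal W}\sharp\text{-Mod}\longrightarrow\mathrm{FB}_{\mathcal W}\text{-Mod}$$ define an equivalence of categories.
   Context: $B_n$ is the group of signed permutations of $\mathbf n=\{\pm1,\dots,\pm n\}$ (bijections $w$ with $w(-a)=-w(a)$); $S_n\subseteq B_n$ is the subgroup preserving signs. The category $\mathrm{FI}_{BC}$ has objects $\mathbf n$, $n\ge0$ ($\mathbf 0=\varnothing$), and morphisms the injections $f:\mathbf m\to\mathbf n$ with $f(-a)=-f(a)$; $\mathrm{FI}_A$ is the subcategory of sign-preserving morphisms. $\mathrm{FI}_{\mathcal W}$ is $\mathrm{FI}_A$ if $\mathcal W_n=S_n$ and $\mathrm{FI}_{BC}$ if $\mathcal W_n=B_n$. An $\mathrm{FI}_{\mathcal W}$-module over $k$ is a functor $\mathrm{FI}_{\mathcal W}\to k$-Mod. $\mathrm{FI}_{BC}\sharp$: objects $\mathbf n_0=\{0,\pm1,\dots,\pm n\}$, $n\ge0$; morphisms are the maps $f:\mathbf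 m_0\to\mathbf n_0$ with $f(-a)=-f(a)$ for all $a$ and $|f^{-1}(b)|\le1$ for $1\le|b|\le n$. $\mathrm{FI}_A\sharp$ is the subcategory with the same objects and the morphisms preserving signs (positive elements are sent to positive elements or $0$). The injective morphisms are exactly the $\mathrm{FI}_{\mathcal W}$ morphisms (extended by $0\mapsto0$). An $\mathrm{FI}_{\mathcal W}\sharp$-module over $k$ is a functor $\mathrm{FI}_{\mathcal W}\sharp\to k$-Mod; it restricts to an $\mathrm{FI}_{\mathcal W}$-module. $\mathrm{FB}_{\mathcal W}$-Mod: objects are sequences $U=\{U_m\}_{m\ge0}$ with $U_m$ a $k[\mathcal W_m]$-module; morphisms are sequences of equivariant maps. $M_{\mathcal W}(\mathbf a)_n=k[\mathrm{Hom}_{\mathrm{FI}_{\mathcal W}}(\mathbf a,\mathbf n)]$, and for a $k[\mathcal W_a]$-module $U$, $M_{\mathcal W}(U)_n=M_{\mathcal W}(\mathbf a)_n\otimes_{k[\mathcal W_a]}U$; for a sequence, $M_{\mathcal W}(\{U_a\})=\bigoplus_aM_{\mathcal W}(U_a)$. The $\mathrm{FI}_{\mathcal W}\sharp$-structure on $M_{\mathcal W}(\mathbf a)$: $f:\mathbf m_0\to\mathbf n_0$ sends the basis element $e_s$, $s\in\mathrm{Hom}_{\mathrm{FI}_{\mathcal W}}(\mathbf a,\mathbf m)$, to $e_{f\circ s}$ if $0\notin f(s(\mathbf a))$ and to $0$ otherwise; this induces the structure on $M_{\mathcal W}(U)$. $H_0(V)_n$ is the quotient of $V_n$ by the $k$-span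 of the images $f_*(V_m)$ over all $m<n$ and all $\mathrm{FI}_{\mathcal W}$ morphisms $f:\mathbf m\to\mathbf n$. *)

theory Defs
  imports "HOL-Algebra.Module" "HOL-Algebra.AbelCoset"
begin

section \<open>Categories, functors and equivalences\<close>

text \<open>Hom-sets of different pairs of objects need not be disjoint, so identities and composites
  are indexed by objects.  In \<open>cmp C X Y Z g f\<close> the map \<open>f\<close> goes from \<open>X\<close> to \<open>Y\<close> and
  \<open>g\<close> from \<open>Y\<close> to \<open>Z\<close>.\<close>

record ('o, 'm) cat =
  ob :: "'o set"
  mor :: "'o \<Rightarrow> 'o \<Rightarrow> 'm set"
  idm :: "'o \<Rightarrow> 'm"
  cmp :: "'o \<Rightarrow> 'o \<Rightarrow> 'o \<Rightarrow> 'm \<Rightarrow> 'm \<Rightarrow> 'm"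

locale category =
  fixes C :: "('o, 'm) cat"
  assumes idm_closed: "X \<in> ob C \<Longrightarrow> idm C X \<in> mor C X X"
    and cmp_closed: "\<lbrakk>X \<in> ob C; Y \<in> ob C; Z \<in> ob C; f \<in> mor C X Y; g \<in> mor C Y Z\<rbrakk>
      \<Longrightarrow> cmp C X Y Z g f \<in> mor C X Z"
    and cmp_idm_right: "\<lbrakk>X \<in> ob C; Y \<in> ob C; f \<in> mor C X Y\<rbrakk> \<Longrightarrow> cmp C X X Y f (idm C X) = f"
    and cmp_idm_left: "\<lbrakk>X \<in> ob C; Y \<in> ob C; f \<in> mor C X Y\<rbrakk> \<Longrightarrow> cmp C X Y Y (idm C Y) f = f"
    and cmp_assoc: "\<lbrakk>X \<in> ob C; Y \<in> ob C; Z \<in> ob C; T \<in> ob C;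
        f \<in> mor C X Y; g \<in> mor C Y Z; h \<in> mor C Z T\<rbrakk>
      \<Longrightarrow> cmp C X Z T h (cmp C X Y Z g f) = cmp C X Y T (cmp C Y Z T h g) f"

definition is_iso :: "('o, 'm) cat \<Rightarrow> 'o \<Rightarrow> 'o \<Rightarrow> 'm \<Rightarrow> bool" where
  "is_iso C X Y f \<longleftrightarrow> f \<in> mor C X Y \<and>
     (\<exists>g \<in> mor C Y X. cmp C X Y X g f = idm C X \<and> cmp C Y X Y f g = idm C Y)"

record ('o, 'm, 'p, 'n) fctr =
  fobj :: "'o \<Rightarrow> 'p"
  fmor :: "'o \<Rightarrow> 'o \<Rightarrow> 'm \<Rightarrow> 'n"

definition is_functor :: "('o, 'm) cat \<Rightarrow> ('p, 'n) cat \<Rightarrow> ('o, 'm, 'p, 'n) fctr \<Rightarrow> bool" where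
  "is_functor C D F \<longleftrightarrow>
     (\<forall>X \<in> ob C. fobj F X \<in> ob D) \<and>
     (\<forall>X \<in> ob C. \<forall>Y \<in> ob C. \<forall>f \<in> mor C X Y. fmor F X Y f \<in> mor D (fobj F X) (fobj F Y)) \<and>
     (\<forall>X \<in> ob C. fmor F X X (idm C X) = idm D (fobj F X)) \<and>
     (\<forall>X \<in> ob C. \<forall>Y \<in> ob C. \<forall>Z \<in> ob C. \<forall>f \<in> mor C X Y. \<forall>g \<in> mor C Y Z.
        fmor F X Z (cmp C X Y Z g f) =
        cmp D (fobj F X) (fobj F Y) (fobj F Z) (fmor F Y Z g) (fmor F X Y f))"

definition id_fctr :: "('o, 'm, 'o, 'm) fctr" where
  "id_fctr = \<lparr>fobj = (\<lambda>X. X), fmor = (\<lambda>X Y f. f)\<rparr>"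

definition comp_fctr ::
    "('p, 'n, 'q, 'l) fctr \<Rightarrow> ('o, 'm, 'p, 'n) fctr \<Rightarrow> ('o, 'm, 'q, 'l) fctr" where
  "comp_fctr G F = \<lparr>fobj = (\<lambda>X. fobj G (fobj F X)),
     fmor = (\<lambda>X Y f. fmor G (fobj F X) (fobj F Y) (fmor F X Y f))\<rparr>"

definition is_nat_trans :: "('o, 'm) cat \<Rightarrow> ('p, 'n) cat \<Rightarrow> ('o, 'm, 'p, 'n) fctr \<Rightarrow>
    ('o, 'm, 'p, 'n) fctr \<Rightarrow> ('o \<Rightarrow> 'n) \<Rightarrow> bool" where
  "is_nat_trans C D F G \<eta> \<longleftrightarrow>
     (\<forall>X \<in> ob C. \<eta> X \<in> mor D (fobj F X) (fobj G X)) \<and>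
     (\<forall>X \<in> ob C. \<forall>Y \<in> ob C. \<forall>f \<in> mor C X Y.
        cmp D (fobj F X) (fobj F Y) (fobj G Y) (\<eta> Y) (fmor F X Y f) =
        cmp D (fobj F X) (fobj G X) (fobj G Y) (fmor G X Y f) (\<eta> X))"

definition naturally_isomorphic :: "('o, 'm) cat \<Rightarrow> ('p, 'n) cat \<Rightarrow> ('o, 'm, 'p, 'n) fctr \<Rightarrow>
    ('o, 'm, 'p, 'n) fctr \<Rightarrow> bool" where
  "naturally_isomorphic C D F G \<longleftrightarrow>
     (\<exists>\<eta>. is_nat_trans C D F G \<eta> \<and> (\<forall>X \<in> ob C. is_iso D (fobj F X) (fobj G X) (\<eta> X)))"

definition equivalence_of_categories :: "('o, 'm) cat \<Rightarrow> ('p, 'n) cat \<Rightarrow>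
    ('o, 'm, 'p, 'n) fctr \<Rightarrow> ('p, 'n, 'o, 'm) fctr \<Rightarrow> bool" where
  "equivalence_of_categories C D F G \<longleftrightarrow>
     category C \<and> category D \<and> is_functor C D F \<and> is_functor D C G \<and>
     naturally_isomorphic C C (comp_fctr G F) id_fctr \<and>
     naturally_isomorphic D D (comp_fctr F G) id_fctr"

definition functor_cat ::
    "('o, 'm) cat \<Rightarrow> ('p, 'n) cat \<Rightarrow> (('o, 'm, 'p, 'n) fctr, 'o \<Rightarrow> 'n) cat" where
  "functor_cat C D =
     \<lparr>ob = {F. is_functor C D F},
      mor = (\<lambda>F G. {\<eta> \<in> extensional (ob C). is_nat_trans C D F G \<eta>}),
      idm = (\<lambda>F. \<lambda>X\<in>ob C. idm D (fobj F X)),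
      cmp = (\<lambda>F G H \<beta> \<alpha>. \<lambda>X\<in>ob C. cmp D (fobj F X) (fobj G X) (fobj H X) (\<beta> X) (\<alpha> X))\<rparr>"


section \<open>Modules\<close>

definition lin_hom :: "('k, 'r) ring_scheme \<Rightarrow> ('k, 'u, 'x) module_scheme \<Rightarrow>
    ('k, 'v, 'y) module_scheme \<Rightarrow> ('u \<Rightarrow> 'v) set" where
  "lin_hom R M N = {h \<in> carrier M \<rightarrow>\<^sub>E carrier N.
     (\<forall>x \<in> carrier M. \<forall>y \<in> carrier M. h (x \<oplus>\<^bsub>M\<^esub> y) = h x \<oplus>\<^bsub>N\<^esub> h y) \<and>
     (\<forall>c \<in> carrier R. \<forall>x \<in> carrier M. h (c \<odot>\<^bsub>M\<^esub> x) = c \<odot>\<^bsub>N\<^esub> h x)}"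

text \<open>The category of modules whose carriers are subsets of the type \<open>'u\<close>, the universe.\<close>

definition kmod :: "('k, 'r) ring_scheme \<Rightarrow> (('k, 'u) module, 'u \<Rightarrow> 'u) cat" where
  "kmod R = \<lparr>ob = {M. module R M}, mor = lin_hom R, idm = (\<lambda>M. \<lambda>x\<in>carrier M. x),
     cmp = (\<lambda>L M N g f. compose (carrier L) g f)\<rparr>"

definition span :: "('k, 'r) ring_scheme \<Rightarrow> ('k, 'u, 'x) module_scheme \<Rightarrow> 'u set \<Rightarrow> 'u set" where
  "span R M S = \<Inter>{N. submodule N R M \<and> S \<subseteq> N}"

text \<open>The record type of modules extends that of rings; the fields \<open>mult\<close> and \<open>one\<close> play no role.\<close>

definition quot_module :: "('k, 'u, 'x) module_scheme \<Rightarrow> 'u set \<Rightarrow> ('k, 'u set) module" where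
  "quot_module M N = \<lparr>carrier = a_rcosets\<^bsub>M\<^esub> N, mult = (\<lambda>_ _. undefined), one = undefined,
     zero = N, add = (\<lambda>X Y. X <+>\<^bsub>M\<^esub> Y), smult = (\<lambda>c X. \<Union>x\<in>X. N +>\<^bsub>M\<^esub> (c \<odot>\<^bsub>M\<^esub> x))\<rparr>"

text \<open>The map \<open>M/N \<rightarrow> M'/N'\<close> induced by a linear map \<open>h\<close> from \<open>M\<close> to \<open>M'\<close> with
  \<open>h ` N \<subseteq> N'\<close>.\<close>

definition quot_map :: "('k, 'u, 'x) module_scheme \<Rightarrow> 'u set \<Rightarrow> ('k, 'v, 'y) module_scheme \<Rightarrow>
    'v set \<Rightarrow> ('u \<Rightarrow> 'v) \<Rightarrow> 'u set \<Rightarrow> 'v set" where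
  "quot_map M N M' N' h = (\<lambda>X \<in> carrier (quot_module M N). \<Union>x\<in>X. N' +>\<^bsub>M'\<^esub> h x)"

definition free_module :: "('k, 'r) ring_scheme \<Rightarrow> 's set \<Rightarrow> ('k, 's \<Rightarrow> 'k) module" where
  "free_module R S =
     \<lparr>carrier = {c. range c \<subseteq> carrier R \<and> {s. c s \<noteq> \<zero>\<^bsub>R\<^esub>} \<subseteq> S \<and> finite {s. c s \<noteq> \<zero>\<^bsub>R\<^esub>}},
      mult = (\<lambda>_ _. undefined), one = undefined, zero = (\<lambda>s. \<zero>\<^bsub>R\<^esub>),
      add = (\<lambda>c d s. c s \<oplus>\<^bsub>R\<^esub> d s), smult = (\<lambda>r c s. r \<otimes>\<^bsub>R\<^esub> c s)\<rparr>"

definition basis_elt :: "('k, 'r) ring_scheme \<Rightarrow> 's \<Rightarrow> 's \<Rightarrow> 'k" where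
  "basis_elt R s = (\<lambda>t. if t = s then \<one>\<^bsub>R\<^esub> else \<zero>\<^bsub>R\<^esub>)"

text \<open>Linear extension to \<open>free_module R S\<close> of a map \<open>g\<close> from \<open>S\<close> to the module \<open>N\<close>.\<close>

definition lin_ext :: "('k, 'r) ring_scheme \<Rightarrow> 's set \<Rightarrow> ('k, 'v, 'y) module_scheme \<Rightarrow>
    ('s \<Rightarrow> 'v) \<Rightarrow> ('s \<Rightarrow> 'k) \<Rightarrow> 'v" where
  "lin_ext R S N g = (\<lambda>c \<in> carrier (free_module R S).
     (\<Oplus>\<^bsub>N\<^esub>s\<in>{s. c s \<noteq> \<zero>\<^bsub>R\<^esub>}. c s \<odot>\<^bsub>N\<^esub> g s))"

definition direct_sum :: "(nat \<Rightarrow> ('k, 'u) module) \<Rightarrow> ('k, nat \<Rightarrow> 'u) module" where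
  "direct_sum M =
     \<lparr>carrier = {x. (\<forall>i. x i \<in> carrier (M i)) \<and> finite {i. x i \<noteq> \<zero>\<^bsub>M i\<^esub>}},
      mult = (\<lambda>_ _. undefined), one = undefined, zero = (\<lambda>i. \<zero>\<^bsub>M i\<^esub>),
      add = (\<lambda>x y i. x i \<oplus>\<^bsub>M i\<^esub> y i), smult = (\<lambda>c x i. c \<odot>\<^bsub>M i\<^esub> x i)\<rparr>"

definition direct_sum_map ::
    "(nat \<Rightarrow> ('k, 'u) module) \<Rightarrow> (nat \<Rightarrow> 'u \<Rightarrow> 'v) \<Rightarrow> (nat \<Rightarrow> 'u) \<Rightarrow> (nat \<Rightarrow> 'v)" where
  "direct_sum_map M h = (\<lambda>x \<in> carrier (direct_sum M). \<lambda>i. h i (x i))"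


section \<open>Representations and tensor products over the group ring\<close>

text \<open>A \<open>k[G]\<close>-module is a \<open>k\<close>-module with a \<open>k\<close>-linear left action of \<open>G\<close>.\<close>

record ('k, 'u, 'g) rep = "('k, 'u) module" +
  act :: "'g \<Rightarrow> 'u \<Rightarrow> 'u"

definition representation ::
    "('k, 'r) ring_scheme \<Rightarrow> ('g, 'h) monoid_scheme \<Rightarrow> ('k, 'u, 'g) rep \<Rightarrow> bool" where
  "representation R G U \<longleftrightarrow> module R U \<and>
     (\<forall>g \<in> carrier G. act U g \<in> lin_hom R U U) \<and>
     (\<forall>x \<in> carrier U. act U \<one>\<^bsub>G\<^esub> x = x) \<and>
     (\<forall>g \<in> carrier G. \<forall>h \<in> carrier G. \<forall>x \<in> carrier U.
        act U (g \<otimes>\<^bsub>G\<^esub> h) x = act U g (act U h x))"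

definition rep_hom :: "('k, 'r) ring_scheme \<Rightarrow> ('g, 'h) monoid_scheme \<Rightarrow> ('k, 'u, 'g) rep \<Rightarrow>
    ('k, 'v, 'g) rep \<Rightarrow> ('u \<Rightarrow> 'v) set" where
  "rep_hom R G U U' = {h \<in> lin_hom R U U'.
     \<forall>g \<in> carrier G. \<forall>x \<in> carrier U. h (act U g x) = act U' g (h x)}"

text \<open>For a \<open>k\<close>-module \<open>X\<close> with a right action \<open>\<rho>\<close> of \<open>G\<close> (\<open>\<rho> g x\<close> is \<open>x\<cdot>g\<close>) and a
  representation \<open>U\<close>, the tensor product of \<open>X\<close> and \<open>U\<close> over \<open>k[G]\<close> is the free \<open>k\<close>-module on
  pairs \<open>(x, u)\<close>, modulo bilinearity over \<open>k\<close> and the relations identifying \<open>(x\<cdot>g, u)\<close> with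
  \<open>(x, g\<cdot>u)\<close>.\<close>

definition pairs_module :: "('k, 'r) ring_scheme \<Rightarrow> ('k, 'x) module \<Rightarrow> ('k, 'u, 'g) rep \<Rightarrow>
    ('k, 'x \<times> 'u \<Rightarrow> 'k) module" where
  "pairs_module R X U = free_module R (carrier X \<times> carrier U)"

definition tensor_relations :: "('k, 'r) ring_scheme \<Rightarrow> ('g, 'h) monoid_scheme \<Rightarrow>
    ('k, 'x) module \<Rightarrow> ('g \<Rightarrow> 'x \<Rightarrow> 'x) \<Rightarrow> ('k, 'u, 'g) rep \<Rightarrow> ('x \<times> 'u \<Rightarrow> 'k) set" where
  "tensor_relations R G X \<rho> U =
     (let F = pairs_module R X U; e = (\<lambda>x u. basis_elt R (x, u)) in
       {e (x \<oplus>\<^bsub>X\<^esub> x') u \<ominus>\<^bsub>F\<^esub> (e x u \<oplus>\<^bsub>F\<^esub> e x' u) | x x' u.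
          x \<in> carrier X \<and> x' \<in> carrier X \<and> u \<in> carrier U} \<union>
       {e x (u \<oplus>\<^bsub>U\<^esub> u') \<ominus>\<^bsub>F\<^esub> (e x u \<oplus>\<^bsub>F\<^esub> e x u') | x u u'.
          x \<in> carrier X \<and> u \<in> carrier U \<and> u' \<in> carrier U} \<union>
       {e (c \<odot>\<^bsub>X\<^esub> x) u \<ominus>\<^bsub>F\<^esub> (c \<odot>\<^bsub>F\<^esub> e x u) | c x u.
          c \<in> carrier R \<and> x \<in> carrier X \<and> u \<in> carrier U} \<union>
       {e x (c \<odot>\<^bsub>U\<^esub> u) \<ominus>\<^bsub>F\<^esub> (c \<odot>\<^bsub>F\<^esub> e x u) | c x u.
          c \<in> carrier R \<and> x \<in> carrier X \<and> u \<in> carrier U} \<union>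
       {e (\<rho> g x) u \<ominus>\<^bsub>F\<^esub> e x (act U g u) | g x u.
          g \<in> carrier G \<and> x \<in> carrier X \<and> u \<in> carrier U})"

definition tensor_kernel :: "('k, 'r) ring_scheme \<Rightarrow> ('g, 'h) monoid_scheme \<Rightarrow>
    ('k, 'x) module \<Rightarrow> ('g \<Rightarrow> 'x \<Rightarrow> 'x) \<Rightarrow> ('k, 'u, 'g) rep \<Rightarrow> ('x \<times> 'u \<Rightarrow> 'k) set" where
  "tensor_kernel R G X \<rho> U = span R (pairs_module R X U) (tensor_relations R G X \<rho> U)"

definition tensor :: "('k, 'r) ring_scheme \<Rightarrow> ('g, 'h) monoid_scheme \<Rightarrow> ('k, 'x) module \<Rightarrow>
    ('g \<Rightarrow> 'x \<Rightarrow> 'x) \<Rightarrow> ('k, 'u, 'g) rep \<Rightarrow> ('k, ('x \<times> 'u \<Rightarrow> 'k) set) module" where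
  "tensor R G X \<rho> U = quot_module (pairs_module R X U) (tensor_kernel R G X \<rho> U)"

text \<open>The map sending the class of \<open>(x, u)\<close> to the class of \<open>(\<phi> x, \<psi> u)\<close>.\<close>

definition tensor_map :: "('k, 'r) ring_scheme \<Rightarrow> ('g, 'h) monoid_scheme \<Rightarrow>
    ('k, 'x) module \<Rightarrow> ('g \<Rightarrow> 'x \<Rightarrow> 'x) \<Rightarrow> ('k, 'u, 'g) rep \<Rightarrow>
    ('k, 'y) module \<Rightarrow> ('g \<Rightarrow> 'y \<Rightarrow> 'y) \<Rightarrow> ('k, 'v, 'g) rep \<Rightarrow>
    ('x \<Rightarrow> 'y) \<Rightarrow> ('u \<Rightarrow> 'v) \<Rightarrow> ('x \<times> 'u \<Rightarrow> 'k) set \<Rightarrow> ('y \<times> 'v \<Rightarrow> 'k) set" where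
  "tensor_map R G X \<rho> U Y \<sigma> V \<phi> \<psi> =
     quot_map (pairs_module R X U) (tensor_kernel R G X \<rho> U)
              (pairs_module R Y V) (tensor_kernel R G Y \<sigma> V)
       (lin_ext R (carrier X \<times> carrier U) (pairs_module R Y V)
          (\<lambda>(x, u). basis_elt R (\<phi> x, \<psi> u)))"


section \<open>Signed permutations and the categories FI and FI-sharp\<close>

text \<open>\<open>TypeA\<close> stands for the family \<open>S\<^sub>n\<close> and \<open>TypeBC\<close> for the family \<open>B\<^sub>n\<close>.\<close>

datatype weyl_type = TypeA | TypeBC

definition signed :: "nat \<Rightarrow> int set" where
  "signed n = {- int n..int n} - {0}"

definition signed0 :: "nat \<Rightarrow> int set" where
  "signed0 n = {- int n..int n}"

definition weyl_group :: "weyl_type \<Rightarrow> nat \<Rightarrow> (int \<Rightarrow> int) monoid" where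
  "weyl_group W n =
     \<lparr>carrier = {w \<in> extensional (signed n). bij_betw w (signed n) (signed n) \<and>
        (\<forall>a \<in> signed n. w (- a) = - w a) \<and>
        (W = TypeA \<longrightarrow> (\<forall>a \<in> signed n. 0 < a \<longrightarrow> 0 < w a))},
      mult = compose (signed n), one = (\<lambda>a \<in> signed n. a)\<rparr>"

definition fi_hom :: "weyl_type \<Rightarrow> nat \<Rightarrow> nat \<Rightarrow> (int \<Rightarrow> int) set" where
  "fi_hom W m n = {f \<in> signed m \<rightarrow>\<^sub>E signed n. inj_on f (signed m) \<and>
     (\<forall>a \<in> signed m. f (- a) = - f a) \<and>
     (W = TypeA \<longrightarrow> (\<forall>a \<in> signed m. 0 < a \<longrightarrow> 0 < f a))}"

definition fi_cat :: "weyl_type \<Rightarrow> (nat, int \<Rightarrow> int) cat" where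
  "fi_cat W = \<lparr>ob = UNIV, mor = fi_hom W, idm = (\<lambda>n. \<lambda>a \<in> signed n. a),
     cmp = (\<lambda>l m n g f. compose (signed l) g f)\<rparr>"

definition sharp_hom :: "weyl_type \<Rightarrow> nat \<Rightarrow> nat \<Rightarrow> (int \<Rightarrow> int) set" where
  "sharp_hom W m n = {f \<in> signed0 m \<rightarrow>\<^sub>E signed0 n.
     (\<forall>a \<in> signed0 m. f (- a) = - f a) \<and>
     (\<forall>b \<in> signed n. card {a \<in> signed0 m. f a = b} \<le> 1) \<and>
     (W = TypeA \<longrightarrow> (\<forall>a \<in> signed0 m. 0 < a \<longrightarrow> 0 \<le> f a))}"

definition sharp_cat :: "weyl_type \<Rightarrow> (nat, int \<Rightarrow> int) cat" where
  "sharp_cat W = \<lparr>ob = UNIV, mor = sharp_hom W, idm = (\<lambda>n. \<lambda>a \<in> signed0 n. a),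
     cmp = (\<lambda>l m n g f. compose (signed0 l) g f)\<rparr>"

definition extend0 :: "nat \<Rightarrow> (int \<Rightarrow> int) \<Rightarrow> (int \<Rightarrow> int)" where
  "extend0 m f = (\<lambda>a \<in> signed0 m. if a = 0 then 0 else f a)"


section \<open>FI-modules, FI-sharp-modules and FB-modules\<close>

text \<open>Functors from either category to modules have the same type.\<close>

type_synonym ('k, 'u) fi_functor = "(nat, int \<Rightarrow> int, ('k, 'u) module, 'u \<Rightarrow> 'u) fctr"

definition sharp_module ::
    "('k, 'r) ring_scheme \<Rightarrow> weyl_type \<Rightarrow> ('k, 'u) fi_functor \<Rightarrow> bool" where
  "sharp_module R W V \<longleftrightarrow> is_functor (sharp_cat W) (kmod R) V"

definition sharp_Mod :: "('k, 'r) ring_scheme \<Rightarrow> weyl_type \<Rightarrow>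
    (('k, 'u) fi_functor, nat \<Rightarrow> 'u \<Rightarrow> 'u) cat" where
  "sharp_Mod R W = functor_cat (sharp_cat W) (kmod R)"

definition restrict_to_fi :: "('k, 'u) fi_functor \<Rightarrow> ('k, 'u) fi_functor" where
  "restrict_to_fi V = \<lparr>fobj = fobj V, fmor = (\<lambda>m n f. fmor V m n (extend0 m f))\<rparr>"

text \<open>Isomorphism of FI-sharp-modules, not requiring their carriers to lie in the same type.\<close>

definition sharp_isomorphic :: "('k, 'r) ring_scheme \<Rightarrow> weyl_type \<Rightarrow>
    ('k, 'u) fi_functor \<Rightarrow> ('k, 'v) fi_functor \<Rightarrow> bool" where
  "sharp_isomorphic R W V V' \<longleftrightarrow> (\<exists>\<eta>.
     (\<forall>n. \<eta> n \<in> lin_hom R (fobj V n) (fobj V' n) \<and>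
          bij_betw (\<eta> n) (carrier (fobj V n)) (carrier (fobj V' n))) \<and>
     (\<forall>m n. \<forall>f \<in> sharp_hom W m n. \<forall>x \<in> carrier (fobj V m).
          \<eta> n (fmor V m n f x) = fmor V' m n f (\<eta> m x)))"

type_synonym ('k, 'u) fb_module = "nat \<Rightarrow> ('k, 'u, int \<Rightarrow> int) rep"

definition fb_module :: "('k, 'r) ring_scheme \<Rightarrow> weyl_type \<Rightarrow> ('k, 'u) fb_module \<Rightarrow> bool" where
  "fb_module R W U \<longleftrightarrow> (\<forall>m. representation R (weyl_group W m) (U m))"

definition FB_Mod :: "('k, 'r) ring_scheme \<Rightarrow> weyl_type \<Rightarrow>
    (('k, 'u) fb_module, nat \<Rightarrow> 'u \<Rightarrow> 'u) cat" where
  "FB_Mod R W = \<lparr>ob = {U. fb_module R W U},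
     mor = (\<lambda>U U'. {\<phi>. \<forall>m. \<phi> m \<in> rep_hom R (weyl_group W m) (U m) (U' m)}),
     idm = (\<lambda>U m. \<lambda>x \<in> carrier (U m). x),
     cmp = (\<lambda>U U' U'' \<psi> \<phi> m. compose (carrier (U m)) (\<psi> m) (\<phi> m))\<rparr>"


section \<open>The FI-sharp-modules M(U)\<close>

definition M_prin_map :: "('k, 'r) ring_scheme \<Rightarrow> weyl_type \<Rightarrow> nat \<Rightarrow> nat \<Rightarrow> nat \<Rightarrow>
    (int \<Rightarrow> int) \<Rightarrow> ((int \<Rightarrow> int) \<Rightarrow> 'k) \<Rightarrow> ((int \<Rightarrow> int) \<Rightarrow> 'k)" where
  "M_prin_map R W a m n f =
     (let F = free_module R (fi_hom W a n) in
       lin_ext R (fi_hom W a m) F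
         (\<lambda>s. if 0 \<notin> f ` s ` signed a then basis_elt R (compose (signed a) f s) else \<zero>\<^bsub>F\<^esub>))"

definition M_prin :: "('k, 'r) ring_scheme \<Rightarrow> weyl_type \<Rightarrow> nat \<Rightarrow>
    ('k, (int \<Rightarrow> int) \<Rightarrow> 'k) fi_functor" where
  "M_prin R W a = \<lparr>fobj = (\<lambda>n. free_module R (fi_hom W a n)), fmor = M_prin_map R W a\<rparr>"

definition M_right_action :: "('k, 'r) ring_scheme \<Rightarrow> weyl_type \<Rightarrow> nat \<Rightarrow> nat \<Rightarrow>
    (int \<Rightarrow> int) \<Rightarrow> ((int \<Rightarrow> int) \<Rightarrow> 'k) \<Rightarrow> ((int \<Rightarrow> int) \<Rightarrow> 'k)" where
  "M_right_action R W a n w =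
     lin_ext R (fi_hom W a n) (free_module R (fi_hom W a n))
       (\<lambda>s. basis_elt R (compose (signed a) s w))"

type_synonym ('k, 'u) induced = "(((int \<Rightarrow> int) \<Rightarrow> 'k) \<times> 'u \<Rightarrow> 'k) set"

text \<open>The map from \<open>M(U)\<^sub>m\<close> to \<open>M(U')\<^sub>n\<close> induced by maps \<open>\<phi>\<close> from \<open>M(a)\<^sub>m\<close> to \<open>M(a)\<^sub>n\<close> and
  \<open>\<psi>\<close> from \<open>U\<close> to \<open>U'\<close>.\<close>

definition M_rep_map :: "('k, 'r) ring_scheme \<Rightarrow> weyl_type \<Rightarrow> nat \<Rightarrow>
    ('k, 'u, int \<Rightarrow> int) rep \<Rightarrow> ('k, 'v, int \<Rightarrow> int) rep \<Rightarrow> nat \<Rightarrow> nat \<Rightarrow>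
    (((int \<Rightarrow> int) \<Rightarrow> 'k) \<Rightarrow> ((int \<Rightarrow> int) \<Rightarrow> 'k)) \<Rightarrow> ('u \<Rightarrow> 'v) \<Rightarrow>
    ('k, 'u) induced \<Rightarrow> ('k, 'v) induced" where
  "M_rep_map R W a U U' m n \<phi> \<psi> =
     tensor_map R (weyl_group W a)
       (fobj (M_prin R W a) m) (M_right_action R W a m) U
       (fobj (M_prin R W a) n) (M_right_action R W a n) U' \<phi> \<psi>"

definition M_rep :: "('k, 'r) ring_scheme \<Rightarrow> weyl_type \<Rightarrow> nat \<Rightarrow>
    ('k, 'u, int \<Rightarrow> int) rep \<Rightarrow> ('k, ('k, 'u) induced) fi_functor" where
  "M_rep R W a U =
     \<lparr>fobj = (\<lambda>n. tensor R (weyl_group W a) (fobj (M_prin R W a) n) (M_right_action R W a n) U),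
      fmor = (\<lambda>m n f. M_rep_map R W a U U m n (fmor (M_prin R W a) m n f) (\<lambda>u. u))\<rparr>"

definition fi_direct_sum :: "(nat \<Rightarrow> ('k, 'u) fi_functor) \<Rightarrow> ('k, nat \<Rightarrow> 'u) fi_functor" where
  "fi_direct_sum V =
     \<lparr>fobj = (\<lambda>n. direct_sum (\<lambda>a. fobj (V a) n)),
      fmor = (\<lambda>m n f. direct_sum_map (\<lambda>a. fobj (V a) m) (\<lambda>a. fmor (V a) m n f))\<rparr>"

definition M_seq :: "('k, 'r) ring_scheme \<Rightarrow> weyl_type \<Rightarrow> ('k, 'u) fb_module \<Rightarrow>
    ('k, nat \<Rightarrow> ('k, 'u) induced) fi_functor" where
  "M_seq R W U = fi_direct_sum (\<lambda>a. M_rep R W a (U a))"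

definition M_seq_map :: "('k, 'r) ring_scheme \<Rightarrow> weyl_type \<Rightarrow> ('k, 'u) fb_module \<Rightarrow>
    ('k, 'v) fb_module \<Rightarrow> (nat \<Rightarrow> 'u \<Rightarrow> 'v) \<Rightarrow>
    nat \<Rightarrow> (nat \<Rightarrow> ('k, 'u) induced) \<Rightarrow> (nat \<Rightarrow> ('k, 'v) induced)" where
  "M_seq_map R W U U' \<phi> n =
     direct_sum_map (\<lambda>a. fobj (M_rep R W a (U a)) n)
       (\<lambda>a. M_rep_map R W a (U a) (U' a) n n (\<lambda>c. c) (\<phi> a))"


section \<open>The FB-modules H0(V)\<close>

definition H0_kernel ::
    "('k, 'r) ring_scheme \<Rightarrow> weyl_type \<Rightarrow> ('k, 'u) fi_functor \<Rightarrow> nat \<Rightarrow> 'u set" where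
  "H0_kernel R W V n =
     span R (fobj V n) (\<Union>m\<in>{..<n}. \<Union>f\<in>fi_hom W m n. fmor V m n f ` carrier (fobj V m))"

text \<open>Here \<open>V\<close> is an FI-module, i.e. a functor from \<open>fi_cat W\<close> to \<open>kmod R\<close>.\<close>

definition H0 ::
    "('k, 'r) ring_scheme \<Rightarrow> weyl_type \<Rightarrow> ('k, 'u) fi_functor \<Rightarrow> ('k, 'u set) fb_module" where
  "H0 R W V n = module.extend (quot_module (fobj V n) (H0_kernel R W V n))
     (rep.fields (\<lambda>w. quot_map (fobj V n) (H0_kernel R W V n) (fobj V n) (H0_kernel R W V n)
                        (fmor V n n w)))"

definition H0_map :: "('k, 'r) ring_scheme \<Rightarrow> weyl_type \<Rightarrow> ('k, 'u) fi_functor \<Rightarrow>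
    ('k, 'v) fi_functor \<Rightarrow> (nat \<Rightarrow> 'u \<Rightarrow> 'v) \<Rightarrow> nat \<Rightarrow> 'u set \<Rightarrow> 'v set" where
  "H0_map R W V V' \<eta> n =
     quot_map (fobj V n) (H0_kernel R W V n) (fobj V' n) (H0_kernel R W V' n) (\<eta> n)"


section \<open>Relabelling, and the functors M and H0 on a fixed universe\<close>

text \<open>\<open>M_seq\<close> and \<open>H0\<close> produce modules over larger types than the given one.  To obtain
  functors between categories of modules over one universe \<open>'u\<close>, carriers are transported
  to \<open>'u\<close> along a chosen injection.  If \<open>'u\<close> is infinite such an injection exists for all
  carriers that arise: \<open>H0(V)\<^sub>n\<close> is a quotient of \<open>V\<^sub>n\<close>, and \<open>M(U)\<^sub>n\<close> is, up to isomorphism,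
  a quotient of a finite direct sum of copies of modules \<open>U\<^sub>a\<close>, \<open>a \<le> n\<close>.\<close>

definition label :: "'b set \<Rightarrow> 'b \<Rightarrow> 'u" where
  "label A = (SOME f. inj_on f A)"

definition unlabel :: "'b set \<Rightarrow> 'u \<Rightarrow> 'b" where
  "unlabel A = inv_into A (label A)"

definition relabel_map :: "'b set \<Rightarrow> 'c set \<Rightarrow> ('b \<Rightarrow> 'c) \<Rightarrow> 'u \<Rightarrow> 'u" where
  "relabel_map A B h = (\<lambda>y \<in> label A ` A. label B (h (unlabel A y)))"

definition relabel_module :: "('k, 'b, 'x) module_scheme \<Rightarrow> ('k, 'u) module" where
  "relabel_module M = (let A = carrier M in
     \<lparr>carrier = label A ` A, mult = (\<lambda>_ _. undefined), one = undefined,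
      zero = label A \<zero>\<^bsub>M\<^esub>,
      add = (\<lambda>x y. label A (unlabel A x \<oplus>\<^bsub>M\<^esub> unlabel A y)),
      smult = (\<lambda>c x. label A (c \<odot>\<^bsub>M\<^esub> unlabel A x))\<rparr>)"

definition relabel_rep :: "('k, 'b, 'g) rep \<Rightarrow> ('k, 'u, 'g) rep" where
  "relabel_rep U = module.extend (relabel_module U)
     (rep.fields (\<lambda>g. relabel_map (carrier U) (carrier U) (act U g)))"

definition relabel_fi :: "('k, 'b) fi_functor \<Rightarrow> ('k, 'u) fi_functor" where
  "relabel_fi V = \<lparr>fobj = (\<lambda>n. relabel_module (fobj V n)),
     fmor = (\<lambda>m n f. relabel_map (carrier (fobj V m)) (carrier (fobj V n)) (fmor V m n f))\<rparr>"

definition M_functor :: "('k, 'r) ring_scheme \<Rightarrow> weyl_type \<Rightarrow>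
    (('k, 'u) fb_module, nat \<Rightarrow> 'u \<Rightarrow> 'u, ('k, 'u) fi_functor, nat \<Rightarrow> 'u \<Rightarrow> 'u) fctr" where
  "M_functor R W = \<lparr>fobj = (\<lambda>U. relabel_fi (M_seq R W U)),
     fmor = (\<lambda>U U' \<phi> n. relabel_map (carrier (fobj (M_seq R W U) n))
                          (carrier (fobj (M_seq R W U') n)) (M_seq_map R W U U' \<phi> n))\<rparr>"

definition H0_functor :: "('k, 'r) ring_scheme \<Rightarrow> weyl_type \<Rightarrow>
    (('k, 'u) fi_functor, nat \<Rightarrow> 'u \<Rightarrow> 'u, ('k, 'u) fb_module, nat \<Rightarrow> 'u \<Rightarrow> 'u) fctr" where
  "H0_functor R W = \<lparr>fobj = (\<lambda>V n. relabel_rep (H0 R W (restrict_to_fi V) n)),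
     fmor = (\<lambda>V V' \<eta> n. relabel_map (carrier (H0 R W (restrict_to_fi V) n))
                          (carrier (H0 R W (restrict_to_fi V') n))
                          (H0_map R W (restrict_to_fi V) (restrict_to_fi V') \<eta> n))\<rparr>"

end

theory Submission
  imports Defs
begin

text \<open>For \<open>1 \<le> i \<le> n\<close> let \<open>e\<^sub>i\<close> be the endomorphism of \<open>n\<^sub>0\<close> that sends \<open>\<plusminus>i\<close> to \<open>0\<close> and fixes the rest.  On
  an FI-sharp-module \<open>V\<close> these are commuting idempotents of \<open>V\<^sub>n\<close>, and everything follows from
  the projector \<open>p = (1 - e\<^sub>1) \<cdots> (1 - e\<^sub>n)\<close>.  Its image is the space of \<^emph>\<open>primitive\<close> elements,
  those killed by all \<open>e\<^sub>i\<close>.  Two combinatorial facts drive the proof.  A morphism of FI-sharp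
  either is injective or factors through some \<open>e\<^sub>i\<close> on its source, so primitive elements are killed
  by all non-injective morphisms.  An injection from a smaller object misses some \<open>\<plusminus>i\<close>, so \<open>p\<close> kills
  whatever is induced from below; and \<open>e\<^sub>i\<close> factors through \<open>(n-1)\<^sub>0\<close>, so \<open>v - p v\<close> is always
  induced from below.  Hence the kernel of \<open>p\<close> is exactly the submodule divided out in \<open>H\<^sub>0\<close>, and
  \<open>H\<^sub>0(V)\<^sub>n\<close> is identified with the primitive part of \<open>V\<^sub>n\<close> (lemma \<open>bij_H0_to_prim\<close>).

  The same facts give a detection principle (lemma \<open>bij_betw_if_bij_on_prim\<close>): a morphism of
  FI-sharp-modules that is bijective on primitive elements is an isomorphism.  Injectivity and
  surjectivity both go by induction on \<open>n\<close>, since modulo primitive elements everything in degree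
  \<open>n\<close> comes from degree \<open>n - 1\<close>.

  The module \<open>M(U)\<close> enters only through its generators, the classes of \<open>e\<^sub>s \<otimes> u\<close>, and their
  universal property (lemmas \<open>gen_induct\<close> and \<open>gen_lift\<close>).  The primitive elements of \<open>M(U)\<^sub>n\<close> are the
  \<open>e\<^sub>i\<^sub>d \<otimes> u\<close> with \<open>u \<in> U\<^sub>n\<close> (lemma \<open>bij_gen_prim\<close>).  So an equivariant bijection from
  \<open>U\<^sub>n\<close> to the primitive part of \<open>V\<^sub>n\<close>, for all \<open>n\<close>, extends to an isomorphism from \<open>M(U)\<close> to
  \<open>V\<close>.  Taking for \<open>U\<close> the primitive parts themselves gives the first half of the theorem.
  Taking \<open>U = H\<^sub>0(V)\<close> gives the natural isomorphism from \<open>M(H\<^sub>0(V))\<close> to \<open>V\<close>; applying the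
  identification of \<open>H\<^sub>0\<close> with primitive elements to \<open>V = M(U)\<close> gives the one from
  \<open>H\<^sub>0(M(U))\<close> to \<open>U\<close>.

  To stay inside one universe, \<open>M(U)\<^sub>n\<close> has to inject into it.  The elements
  \<open>p (f\<^sub>* y)\<close>, for the finitely many \<open>f\<close> from \<open>n\<^sub>0\<close> to an \<open>m\<^sub>0\<close> with \<open>m \<le> n\<close>, determine
  \<open>y \<in> M(U)\<^sub>n\<close> and correspond to elements of \<open>U\<^sub>m\<close>; finite tuples over an infinite type inject into
  that type.\<close>

section \<open>Linear maps\<close>

text \<open>Membership in \<open>lin_hom\<close> also asks for extensionality.  Arguments about linearity are
  carried out for this weaker notion, which is closed under plain composition.\<close>

definition linear_map :: "('k, 'r) ring_scheme \<Rightarrow> ('k, 'u, 'x) module_scheme \<Rightarrow>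
    ('k, 'v, 'y) module_scheme \<Rightarrow> ('u \<Rightarrow> 'v) \<Rightarrow> bool" where
  "linear_map R M N h \<longleftrightarrow> (\<forall>x\<in>carrier M. h x \<in> carrier N) \<and>
     (\<forall>x\<in>carrier M. \<forall>y\<in>carrier M. h (x \<oplus>\<^bsub>M\<^esub> y) = h x \<oplus>\<^bsub>N\<^esub> h y) \<and>
     (\<forall>c\<in>carrier R. \<forall>x\<in>carrier M. h (c \<odot>\<^bsub>M\<^esub> x) = c \<odot>\<^bsub>N\<^esub> h x)"

lemma linear_mapI [intro?]:
  assumes "\<And>x. x \<in> carrier M \<Longrightarrow> h x \<in> carrier N"
    and "\<And>x y. x \<in> carrier M \<Longrightarrow> y \<in> carrier M \<Longrightarrow> h (x \<oplus>\<^bsub>M\<^esub> y) = h x \<oplus>\<^bsub>N\<^esub> h y"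
    and "\<And>c x. c \<in> carrier R \<Longrightarrow> x \<in> carrier M \<Longrightarrow> h (c \<odot>\<^bsub>M\<^esub> x) = c \<odot>\<^bsub>N\<^esub> h x"
  shows "linear_map R M N h"
  using assms by (simp add: linear_map_def)

lemma (in abelian_group) diff_eq_zero_iff:
  assumes "x \<in> carrier G" "y \<in> carrier G"
  shows "x \<ominus> y = \<zero> \<longleftrightarrow> x = y"
  using assms by (metis a_minus_def add.inv_closed minus_equality r_neg)

lemma (in abelian_group) diff_zero: "x \<in> carrier G \<Longrightarrow> x \<ominus> \<zero> = x"
  using minus_equality[of \<zero> \<zero>] by (simp add: a_minus_def)

lemma linear_mapD:
  assumes "linear_map R M N h"
  shows "x \<in> carrier M \<Longrightarrow> h x \<in> carrier N"
    and "x \<in> carrier M \<Longrightarrow> y \<in> carrier M \<Longrightarrow> h (x \<oplus>\<^bsub>M\<^esub> y) = h x \<oplus>\<^bsub>N\<^esub> h y"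
    and "c \<in> carrier R \<Longrightarrow> x \<in> carrier M \<Longrightarrow> h (c \<odot>\<^bsub>M\<^esub> x) = c \<odot>\<^bsub>N\<^esub> h x"
  using assms by (simp_all add: linear_map_def)

lemma linear_map_cong:
  assumes "linear_map R M N h" "\<And>x. x \<in> carrier M \<Longrightarrow> h' x = h x" "module R M"
  shows "linear_map R M N h'"
proof -
  interpret M: module R M by fact
  show ?thesis using assms(1,2) by (simp add: linear_map_def)
qed

lemma lin_hom_iff: "h \<in> lin_hom R M N \<longleftrightarrow> linear_map R M N h \<and> h \<in> extensional (carrier M)"
  by (auto simp: lin_hom_def linear_map_def PiE_def)

lemma linear_map_restrict:
  assumes "module R M" "linear_map R M N h"
  shows "restrict h (carrier M) \<in> lin_hom R M N"
  using linear_map_cong[OF assms(2) _ assms(1), of "restrict h (carrier M)"]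
  by (simp add: lin_hom_iff)

lemma linear_map_zero:
  assumes "linear_map R M N h" "module R M" "module R N"
  shows "h \<zero>\<^bsub>M\<^esub> = \<zero>\<^bsub>N\<^esub>"
proof -
  interpret M: module R M by fact
  interpret N: module R N by fact
  have "h (\<zero>\<^bsub>R\<^esub> \<odot>\<^bsub>M\<^esub> \<zero>\<^bsub>M\<^esub>) = \<zero>\<^bsub>R\<^esub> \<odot>\<^bsub>N\<^esub> h \<zero>\<^bsub>M\<^esub>"
    by (rule linear_mapD(3)[OF assms(1)]) simp_all
  then show ?thesis using linear_mapD(1)[OF assms(1), of "\<zero>\<^bsub>M\<^esub>"] by simp
qed

lemma linear_map_minus:
  assumes "linear_map R M N h" "module R M" "module R N" "x \<in> carrier M"
  shows "h (\<ominus>\<^bsub>M\<^esub> x) = \<ominus>\<^bsub>N\<^esub> h x"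
proof -
  interpret M: module R M by fact
  interpret N: module R N by fact
  have "h (\<ominus>\<^bsub>M\<^esub> x) \<oplus>\<^bsub>N\<^esub> h x = h (\<ominus>\<^bsub>M\<^esub> x \<oplus>\<^bsub>M\<^esub> x)"
    using assms(1,4) by (simp add: linear_map_def)
  also have "\<dots> = \<zero>\<^bsub>N\<^esub>" using assms by (simp add: M.l_neg linear_map_zero)
  finally show ?thesis
    using assms(4) linear_mapD(1)[OF assms(1)] by (metis N.minus_equality M.a_inv_closed)
qed

lemma linear_map_diff:
  assumes "linear_map R M N h" "module R M" "module R N" "x \<in> carrier M" "y \<in> carrier M"
  shows "h (x \<ominus>\<^bsub>M\<^esub> y) = h x \<ominus>\<^bsub>N\<^esub> h y"
proof -
  interpret M: module R M by fact
  interpret N: module R N by fact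
  show ?thesis
    using assms(4,5) linear_map_minus[OF assms(1-3)]
    by (simp add: a_minus_def linear_mapD[OF assms(1)])
qed

lemma linear_map_comp:
  "linear_map R L M f \<Longrightarrow> linear_map R M N g \<Longrightarrow> linear_map R L N (\<lambda>x. g (f x))"
  by (simp add: linear_map_def)

lemma linear_map_id: "linear_map R M M (\<lambda>x. x)"
  by (simp add: linear_map_def)

lemma lin_hom_compose:
  assumes "module R L" "f \<in> lin_hom R L M" "g \<in> lin_hom R M N"
  shows "compose (carrier L) g f \<in> lin_hom R L N"
  unfolding compose_def
  using linear_map_restrict[OF assms(1) linear_map_comp, of M f N g] assms(2,3)
  by (simp add: lin_hom_iff)

lemma linear_map_inv_into:
  assumes "module R M" "module R N" "linear_map R M N h" "bij_betw h (carrier M) (carrier N)"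
  shows "linear_map R N M (inv_into (carrier M) h)"
proof -
  interpret M: module R M by fact
  interpret N: module R N by fact
  let ?g = "inv_into (carrier M) h"
  have inj: "inj_on h (carrier M)" and im: "h ` carrier M = carrier N"
    using assms(4) by (auto simp: bij_betw_def)
  have g: "?g y \<in> carrier M" "h (?g y) = y" if "y \<in> carrier N" for y
    using that im by (auto intro: inv_into_into f_inv_into_f)
  have eq: "?g y = x" if "x \<in> carrier M" "h x = y" for x y
    using that inj by auto
  show ?thesis
  proof
    fix x y assume "x \<in> carrier N" "y \<in> carrier N"
    then show "?g (x \<oplus>\<^bsub>N\<^esub> y) = ?g x \<oplus>\<^bsub>M\<^esub> ?g y"
      by (intro eq) (simp_all add: g linear_mapD[OF assms(3)])
  next
    fix c x assume "c \<in> carrier R" "x \<in> carrier N"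
    then show "?g (c \<odot>\<^bsub>N\<^esub> x) = c \<odot>\<^bsub>M\<^esub> ?g x"
      by (intro eq) (simp_all add: g linear_mapD[OF assms(3)])
  qed (fact g)
qed

text \<open>The module axioms are equations, so they pass along any surjection that respects the operations.
  Quotient modules, relabelled modules and modules with an added action all arise in this way.\<close>

lemma module_surj_image:
  fixes M :: "('k, 'u, 'x) module_scheme" and Q :: "('k, 'v, 'y) module_scheme"
  assumes "module R M" and im: "h ` carrier M = carrier Q"
    and add: "\<And>x y. x \<in> carrier M \<Longrightarrow> y \<in> carrier M \<Longrightarrow> h (x \<oplus>\<^bsub>M\<^esub> y) = h x \<oplus>\<^bsub>Q\<^esub> h y"
    and smult: "\<And>c x. c \<in> carrier R \<Longrightarrow> x \<in> carrier M \<Longrightarrow> h (c \<odot>\<^bsub>M\<^esub> x) = c \<odot>\<^bsub>Q\<^esub> h x"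
    and zero: "h \<zero>\<^bsub>M\<^esub> = \<zero>\<^bsub>Q\<^esub>"
  shows "module R Q"
proof -
  interpret M: module R M by fact
  have E: "\<exists>x\<in>carrier M. y = h x" if "y \<in> carrier Q" for y using that im by auto
  have I: "h x \<in> carrier Q" if "x \<in> carrier M" for x using that im by auto
  note hs = add[symmetric] smult[symmetric] zero[symmetric]
  have "abelian_group Q"
  proof (rule abelian_groupI)
    fix x assume "x \<in> carrier Q"
    then obtain x' where "x' \<in> carrier M" "x = h x'" using E by blast
    then show "\<exists>y\<in>carrier Q. y \<oplus>\<^bsub>Q\<^esub> x = \<zero>\<^bsub>Q\<^esub>"
      by (intro bexI[of _ "h (\<ominus>\<^bsub>M\<^esub> x')"]) (simp_all add: hs I M.l_neg)
  qed (auto dest!: E simp: hs I M.a_ac)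
  then show ?thesis
    by (intro moduleI) (auto dest!: E simp: hs I M.R.is_cring M.smult_l_distr M.smult_r_distr M.smult_assoc1)
qed

lemma factor_through_surjection:
  assumes "module R M" "linear_map R M Q \<pi>" "\<pi> ` carrier M = carrier Q" "linear_map R M L h"
    and ker: "\<And>x y. x \<in> carrier M \<Longrightarrow> y \<in> carrier M \<Longrightarrow> \<pi> x = \<pi> y \<Longrightarrow> h x = h y"
  shows "\<exists>h'. linear_map R Q L h' \<and> (\<forall>x\<in>carrier M. h' (\<pi> x) = h x)"
proof -
  interpret M: module R M by fact
  define h' where "h' = (\<lambda>y. h (inv_into (carrier M) \<pi> y))"
  have *: "h' (\<pi> x) = h x" if "x \<in> carrier M" for x
    unfolding h'_def using that by (intro ker) (auto intro: inv_into_into f_inv_into_f)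
  have E: "\<exists>x\<in>carrier M. y = \<pi> x" if "y \<in> carrier Q" for y using that assms(3) by auto
  have "linear_map R Q L h'"
  proof
    fix x assume "x \<in> carrier Q"
    then obtain x' where x: "x' \<in> carrier M" "x = \<pi> x'" using E by blast
    then show "h' x \<in> carrier L" using assms(4) by (simp add: * linear_map_def)
    fix c assume "c \<in> carrier R"
    then show "h' (c \<odot>\<^bsub>Q\<^esub> x) = c \<odot>\<^bsub>L\<^esub> h' x"
      using x linear_mapD(3)[OF assms(2), symmetric] by (simp add: * linear_mapD[OF assms(4)])
  next
    fix x y assume "x \<in> carrier Q" "y \<in> carrier Q"
    then obtain x' y' where "x' \<in> carrier M" "x = \<pi> x'" "y' \<in> carrier M" "y = \<pi> y'"
      using E by meson
    then show "h' (x \<oplus>\<^bsub>Q\<^esub> y) = h' x \<oplus>\<^bsub>L\<^esub> h' y"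
      using linear_mapD(2)[OF assms(2), symmetric] by (simp add: * linear_mapD[OF assms(4)])
  qed
  with * show ?thesis by blast
qed

section \<open>Submodules and quotients\<close>

lemma submodule_kernel:
  assumes "module R M" "module R N" "linear_map R M N h"
  shows "submodule {x \<in> carrier M. h x = \<zero>\<^bsub>N\<^esub>} R M"
proof -
  interpret M: module R M by fact
  interpret N: module R N by fact
  show ?thesis
    by (rule M.submoduleI)
      (auto simp: linear_mapD[OF assms(3)] linear_map_zero[OF assms(3,1,2)]
        linear_map_minus[OF assms(3,1,2)])
qed

lemma span_least: "submodule N R M \<Longrightarrow> S \<subseteq> N \<Longrightarrow> span R M S \<subseteq> N"
  by (auto simp: span_def)

lemma span_superset: "S \<subseteq> span R M S"
  by (auto simp: span_def)

lemma span_submodule: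
  assumes "module R M" "S \<subseteq> carrier M"
  shows "submodule (span R M S) R M"
proof -
  interpret M: module R M by fact
  note E = M.submoduleE
  have c: "span R M S \<subseteq> carrier M" by (rule span_least[OF M.carrier_is_submodule assms(2)])
  have z: "\<zero>\<^bsub>M\<^esub> \<in> N" if "submodule N R M" for N
    using subgroup.one_closed[OF submodule.axioms(1)[OF that]] by simp
  show ?thesis
    by (rule M.submoduleI[OF c]) (auto simp: span_def intro: z E(3-5))
qed

lemma linear_map_span:
  assumes "module R M" "module R N" "linear_map R M N h" "S \<subseteq> carrier M"
    "\<And>x. x \<in> S \<Longrightarrow> h x = \<zero>\<^bsub>N\<^esub>" "x \<in> span R M S"
  shows "h x = \<zero>\<^bsub>N\<^esub>"
  using span_least[OF submodule_kernel[OF assms(1-3)], of S] assms(4-6) by auto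

locale quotient = module R M for R :: "('k, 'r) ring_scheme" and M :: "('k, 'u, 'x) module_scheme" +
  fixes N :: "'u set"
  assumes sub: "submodule N R M"
begin

lemma abelian_subgroup: "abelian_subgroup N M"
  by (rule abelian_subgroupI3)
    (use sub M.abelian_group_axioms in \<open>simp_all add: additive_subgroup_def submodule_def abelian_group_def\<close>)

sublocale S: abelian_subgroup N M by (rule abelian_subgroup)

abbreviation cls :: "'u \<Rightarrow> 'u set" where "cls x \<equiv> N +>\<^bsub>M\<^esub> x"

lemma carrier_quot: "carrier (quot_module M N) = cls ` carrier M"
  by (auto simp: quot_module_def A_RCOSETS_def' )

lemma cls_eq_iff:
  assumes "x \<in> carrier M" "y \<in> carrier M"
  shows "cls x = cls y \<longleftrightarrow> x \<ominus>\<^bsub>M\<^esub> y \<in> N"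
proof -
  have "x \<ominus>\<^bsub>M\<^esub> y \<in> N \<longleftrightarrow> x \<in> cls y"
    using S.a_rcos_module[of y x] assms by (simp add: a_minus_def)
  also have "\<dots> \<longleftrightarrow> cls x = cls y"
    using S.a_repr_independence'[of x y] S.a_rcos_self[of x] assms by (intro iffI) simp_all
  finally show ?thesis by simp
qed

text \<open>Operations on cosets are defined as unions over all representatives; such a union collapses to
  its value at one representative as soon as all summands agree.\<close>

lemma cls_const_UN:
  assumes "x \<in> carrier M" and c: "\<And>y. y \<in> carrier M \<Longrightarrow> y \<ominus>\<^bsub>M\<^esub> x \<in> N \<Longrightarrow> F y = F x"
  shows "(\<Union>y\<in>cls x. F y) = F x"
proof -
  have "F y = F x" if "y \<in> cls x" for y
    using that assms S.a_rcos_module[of x y] S.a_elemrcos_carrier[of x y]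
    by (intro c) (simp_all add: a_minus_def)
  then show ?thesis using S.a_rcos_self[of x] assms(1) by blast
qed

lemma quot_add:
  "x \<in> carrier M \<Longrightarrow> y \<in> carrier M \<Longrightarrow> cls x \<oplus>\<^bsub>quot_module M N\<^esub> cls y = cls (x \<oplus>\<^bsub>M\<^esub> y)"
  by (simp add: quot_module_def S.a_rcos_sum)

lemma quot_smult:
  assumes "c \<in> carrier R" "x \<in> carrier M"
  shows "c \<odot>\<^bsub>quot_module M N\<^esub> cls x = cls (c \<odot>\<^bsub>M\<^esub> x)"
proof -
  have "(\<Union>y\<in>cls x. cls (c \<odot>\<^bsub>M\<^esub> y)) = cls (c \<odot>\<^bsub>M\<^esub> x)"
  proof (rule cls_const_UN)
    fix y assume y: "y \<in> carrier M" "y \<ominus>\<^bsub>M\<^esub> x \<in> N"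
    have "c \<odot>\<^bsub>M\<^esub> y \<ominus>\<^bsub>M\<^esub> c \<odot>\<^bsub>M\<^esub> x = c \<odot>\<^bsub>M\<^esub> (y \<ominus>\<^bsub>M\<^esub> x)"
      using y assms by (simp add: a_minus_def smult_r_distr smult_r_minus)
    then show "cls (c \<odot>\<^bsub>M\<^esub> y) = cls (c \<odot>\<^bsub>M\<^esub> x)"
      using y assms submoduleE(4)[OF sub] by (simp add: cls_eq_iff)
  qed fact
  then show ?thesis by (simp add: quot_module_def)
qed

lemma cls_zero: "cls \<zero>\<^bsub>M\<^esub> = \<zero>\<^bsub>quot_module M N\<^esub>"
  using S.a_subset by (simp add: quot_module_def M.a_coset_add_zero)

lemma module_quot: "module R (quot_module M N)"
  by (rule module_surj_image[OF module_axioms, of cls])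
    (simp_all add: carrier_quot quot_add quot_smult cls_zero)

lemma linear_map_cls: "linear_map R M (quot_module M N) cls"
  by rule (simp_all add: carrier_quot quot_add quot_smult)

lemma cls_eq_zero_iff: "x \<in> carrier M \<Longrightarrow> cls x = \<zero>\<^bsub>quot_module M N\<^esub> \<longleftrightarrow> x \<in> N"
  using cls_eq_iff[of x "\<zero>\<^bsub>M\<^esub>"] by (simp add: cls_zero M.diff_zero)

text \<open>The universal property of the quotient.\<close>

lemma quot_lift:
  assumes "module R L" "linear_map R M L h" "\<And>x. x \<in> N \<Longrightarrow> h x = \<zero>\<^bsub>L\<^esub>"
  shows "\<exists>h'. linear_map R (quot_module M N) L h' \<and> (\<forall>x\<in>carrier M. h' (cls x) = h x)"
proof (rule factor_through_surjection[OF module_axioms linear_map_cls _ assms(2)])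
  interpret L: module R L by fact
  fix x y assume xy: "x \<in> carrier M" "y \<in> carrier M" "cls x = cls y"
  then have "h x \<ominus>\<^bsub>L\<^esub> h y = \<zero>\<^bsub>L\<^esub>"
    using assms(3)[of "x \<ominus>\<^bsub>M\<^esub> y"] linear_map_diff[OF assms(2) module_axioms assms(1), of x y]
    by (simp add: cls_eq_iff)
  then show "h x = h y" using xy linear_mapD(1)[OF assms(2)] by (metis L.diff_eq_zero_iff)
qed (simp add: carrier_quot)

end

lemma
  assumes "quotient R M N" "quotient R M' N'" "linear_map R M M' h"
    and "\<And>x. x \<in> N \<Longrightarrow> h x \<in> N'"
  shows quot_map_cls: "x \<in> carrier M \<Longrightarrow> quot_map M N M' N' h (N +>\<^bsub>M\<^esub> x) = N' +>\<^bsub>M'\<^esub> h x"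
    and quot_map_lin_hom: "quot_map M N M' N' h \<in> lin_hom R (quot_module M N) (quot_module M' N')"
proof -
  interpret A: quotient R M N by fact
  interpret B: quotient R M' N' by fact
  show *: "quot_map M N M' N' h (N +>\<^bsub>M\<^esub> x) = N' +>\<^bsub>M'\<^esub> h x" if "x \<in> carrier M" for x
  proof -
    have "(\<Union>y\<in>N +>\<^bsub>M\<^esub> x. N' +>\<^bsub>M'\<^esub> h y) = N' +>\<^bsub>M'\<^esub> h x"
    proof (rule A.cls_const_UN[OF that])
      fix y assume "y \<in> carrier M" "y \<ominus>\<^bsub>M\<^esub> x \<in> N"
      then show "N' +>\<^bsub>M'\<^esub> h y = N' +>\<^bsub>M'\<^esub> h x"
        using that assms(4)[of "y \<ominus>\<^bsub>M\<^esub> x"]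
        by (simp add: B.cls_eq_iff linear_mapD[OF assms(3)]
            linear_map_diff[OF assms(3) A.module_axioms B.module_axioms])
    qed
    then show ?thesis using that by (simp add: quot_map_def A.carrier_quot)
  qed
  have "linear_map R (quot_module M N) (quot_module M' N') (quot_map M N M' N' h)"
    by rule (auto simp: A.carrier_quot A.quot_add A.quot_smult * linear_mapD[OF assms(3)]
        B.carrier_quot B.quot_add B.quot_smult)
  then show "quot_map M N M' N' h \<in> lin_hom R (quot_module M N) (quot_module M' N')"
    by (simp add: lin_hom_iff quot_map_def)
qed

section \<open>Free modules\<close>

lemma free_module_sel [simp]:
  "zero (free_module R S) = (\<lambda>s. \<zero>\<^bsub>R\<^esub>)"
  "add (free_module R S) = (\<lambda>c d s. c s \<oplus>\<^bsub>R\<^esub> d s)"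
  "smult (free_module R S) = (\<lambda>r c s. r \<otimes>\<^bsub>R\<^esub> c s)"
  by (simp_all add: free_module_def)

lemma free_module_carrier:
  "c \<in> carrier (free_module R S) \<longleftrightarrow> (\<forall>s. c s \<in> carrier R) \<and> (\<forall>s. c s \<noteq> \<zero>\<^bsub>R\<^esub> \<longrightarrow> s \<in> S) \<and>
     finite {s. c s \<noteq> \<zero>\<^bsub>R\<^esub>}"
  by (auto simp: free_module_def)

context cring
begin

lemma module_free_module: "module R (free_module R S)"
proof (rule moduleI)
  show "abelian_group (free_module R S)"
  proof (rule abelian_groupI)
    fix x y assume "x \<in> carrier (free_module R S)" "y \<in> carrier (free_module R S)"
    moreover have "{s. x s \<oplus> y s \<noteq> \<zero>} \<subseteq> {s. x s \<noteq> \<zero>} \<union> {s. y s \<noteq> \<zero>}" by auto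
    ultimately show "x \<oplus>\<^bsub>free_module R S\<^esub> y \<in> carrier (free_module R S)"
      by (auto simp: free_module_carrier intro: finite_subset)
  next
    fix x assume x: "x \<in> carrier (free_module R S)"
    show "\<exists>y\<in>carrier (free_module R S). y \<oplus>\<^bsub>free_module R S\<^esub> x = \<zero>\<^bsub>free_module R S\<^esub>"
      by (rule bexI[of _ "\<lambda>s. \<ominus> x s"])
        (use x in \<open>auto simp: free_module_carrier l_neg intro: rev_finite_subset\<close>)
  qed (auto simp: free_module_carrier a_ac fun_eq_iff)
next
  fix a x assume "a \<in> carrier R" "x \<in> carrier (free_module R S)"
  moreover from this have "{s. a \<otimes> x s \<noteq> \<zero>} \<subseteq> {s. x s \<noteq> \<zero>}" by auto
  ultimately show "a \<odot>\<^bsub>free_module R S\<^esub> x \<in> carrier (free_module R S)"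
    by (auto simp: free_module_carrier intro: finite_subset)
qed (auto simp: is_cring free_module_carrier l_distr r_distr m_assoc fun_eq_iff)

lemma basis_elt_closed: "s \<in> S \<Longrightarrow> basis_elt R s \<in> carrier (free_module R S)"
  by (auto simp: free_module_carrier basis_elt_def)

text \<open>Linear extensions are defined by sums over supports.  Additivity needs the sums for two
  elements and for their sum to range over a common index set.\<close>

lemma lin_ext_superset:
  assumes "module R N" "\<And>s. s \<in> S \<Longrightarrow> g s \<in> carrier N" "c \<in> carrier (free_module R S)"
    "finite A" "{s. c s \<noteq> \<zero>} \<subseteq> A" "A \<subseteq> S"
  shows "lin_ext R S N g c = (\<Oplus>\<^bsub>N\<^esub>s\<in>A. c s \<odot>\<^bsub>N\<^esub> g s)"
proof -
  interpret N: module R N by fact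
  have "(\<Oplus>\<^bsub>N\<^esub>s\<in>{s. c s \<noteq> \<zero>}. c s \<odot>\<^bsub>N\<^esub> g s) = (\<Oplus>\<^bsub>N\<^esub>s\<in>A. c s \<odot>\<^bsub>N\<^esub> g s)"
    by (rule N.add.finprod_mono_neutral_cong_left)
      (use assms in \<open>auto simp: free_module_carrier\<close>)
  then show ?thesis using assms by (simp add: lin_ext_def)
qed

lemma lin_ext_lin_hom:
  assumes "module R N" "\<And>s. s \<in> S \<Longrightarrow> g s \<in> carrier N"
  shows "lin_ext R S N g \<in> lin_hom R (free_module R S) N"
proof -
  interpret N: module R N by fact
  interpret F: module R "free_module R S" by (rule module_free_module)
  have sup: "lin_ext R S N g c = (\<Oplus>\<^bsub>N\<^esub>s\<in>A. c s \<odot>\<^bsub>N\<^esub> g s)"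
    if "c \<in> carrier (free_module R S)" "finite A" "{s. c s \<noteq> \<zero>} \<subseteq> A" "A \<subseteq> S" for c A
    using lin_ext_superset[OF assms that] .
  have g: "(\<lambda>s. c s \<odot>\<^bsub>N\<^esub> g s) \<in> A \<rightarrow> carrier N"
    if "c \<in> carrier (free_module R S)" "A \<subseteq> S" for c A
    using that assms(2) by (auto simp: free_module_carrier)
  have "linear_map R (free_module R S) N (lin_ext R S N g)"
  proof
    fix c assume c: "c \<in> carrier (free_module R S)"
    let ?A = "{s. c s \<noteq> \<zero>}"
    have A: "finite ?A" "?A \<subseteq> S" using c by (auto simp: free_module_carrier)
    show "lin_ext R S N g c \<in> carrier N"
      using sup[OF c A(1) order_refl A(2)] N.finsum_closed[OF g[OF c A(2)]] by simp
    fix r assume r: "r \<in> carrier R"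
    have "lin_ext R S N g (r \<odot>\<^bsub>free_module R S\<^esub> c)
        = (\<Oplus>\<^bsub>N\<^esub>s\<in>?A. (r \<odot>\<^bsub>free_module R S\<^esub> c) s \<odot>\<^bsub>N\<^esub> g s)"
      by (rule sup[OF F.smult_closed[OF r c] A(1) _ A(2)]) (use r in auto)
    also have "\<dots> = (\<Oplus>\<^bsub>N\<^esub>s\<in>?A. r \<odot>\<^bsub>N\<^esub> (c s \<odot>\<^bsub>N\<^esub> g s))"
      using A r c assms(2) by (intro N.finsum_cong') (auto simp: N.smult_assoc1 free_module_carrier)
    also have "\<dots> = r \<odot>\<^bsub>N\<^esub> lin_ext R S N g c"
      using sup[OF c A(1) order_refl A(2)] N.finsum_smult_ldistr[OF A(1) r g[OF c A(2)]] by simp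
    finally show "lin_ext R S N g (r \<odot>\<^bsub>free_module R S\<^esub> c) = r \<odot>\<^bsub>N\<^esub> lin_ext R S N g c" .
  next
    fix c d assume c: "c \<in> carrier (free_module R S)" and d: "d \<in> carrier (free_module R S)"
    let ?A = "{s. c s \<noteq> \<zero>} \<union> {s. d s \<noteq> \<zero>}"
    have A: "finite ?A" "?A \<subseteq> S" using c d by (auto simp: free_module_carrier)
    have "lin_ext R S N g (c \<oplus>\<^bsub>free_module R S\<^esub> d)
        = (\<Oplus>\<^bsub>N\<^esub>s\<in>?A. (c \<oplus>\<^bsub>free_module R S\<^esub> d) s \<odot>\<^bsub>N\<^esub> g s)"
      by (rule sup[OF F.a_closed[OF c d] A(1) _ A(2)]) auto
    also have "\<dots> = (\<Oplus>\<^bsub>N\<^esub>s\<in>?A. c s \<odot>\<^bsub>N\<^esub> g s \<oplus>\<^bsub>N\<^esub> d s \<odot>\<^bsub>N\<^esub> g s)"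
      using A c d assms(2) by (intro N.finsum_cong') (auto simp: N.smult_l_distr free_module_carrier)
    also have "\<dots> = lin_ext R S N g c \<oplus>\<^bsub>N\<^esub> lin_ext R S N g d"
      using N.finsum_addf[OF g[OF c A(2)] g[OF d A(2)]] sup[OF c A(1) Un_upper1 A(2)] sup[OF d A(1) Un_upper2 A(2)]
      by simp
    finally show "lin_ext R S N g (c \<oplus>\<^bsub>free_module R S\<^esub> d)
        = lin_ext R S N g c \<oplus>\<^bsub>N\<^esub> lin_ext R S N g d" .
  qed
  then show ?thesis by (simp add: lin_hom_iff lin_ext_def)
qed

lemma lin_ext_basis_elt:
  assumes "module R N" "\<And>s. s \<in> S \<Longrightarrow> g s \<in> carrier N" "s \<in> S"
  shows "lin_ext R S N g (basis_elt R s) = g s"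
proof -
  interpret N: module R N by fact
  have "lin_ext R S N g (basis_elt R s) = (\<Oplus>\<^bsub>N\<^esub>t\<in>{s}. basis_elt R s t \<odot>\<^bsub>N\<^esub> g t)"
    using assms by (intro lin_ext_superset basis_elt_closed) (auto simp: basis_elt_def)
  then show ?thesis using assms by (simp add: basis_elt_def)
qed

lemma free_module_induct [consumes 1, case_names zero add basis]:
  assumes c: "c \<in> carrier (free_module R S)"
    and zero: "P \<zero>\<^bsub>free_module R S\<^esub>"
    and add: "\<And>c d. c \<in> carrier (free_module R S) \<Longrightarrow> d \<in> carrier (free_module R S) \<Longrightarrow>
      P c \<Longrightarrow> P d \<Longrightarrow> P (c \<oplus>\<^bsub>free_module R S\<^esub> d)"
    and basis: "\<And>r s. r \<in> carrier R \<Longrightarrow> s \<in> S \<Longrightarrow> P (r \<odot>\<^bsub>free_module R S\<^esub> basis_elt R s)"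
  shows "P c"
proof -
  interpret F: module R "free_module R S" by (rule module_free_module)
  have "P c" if "finite A" "{s. c s \<noteq> \<zero>} \<subseteq> A" "c \<in> carrier (free_module R S)" for A c
    using that
  proof (induction A arbitrary: c)
    case empty
    then have "c = \<zero>\<^bsub>free_module R S\<^esub>" by (auto simp: fun_eq_iff)
    with zero show ?case by simp
  next
    case (insert s A)
    show ?case
    proof (cases "c s = \<zero>")
      case True
      then show ?thesis using insert by (intro insert.IH) auto
    next
      case False
      \<comment> \<open>The element \<open>c\<close> is \<open>?d\<close>, whose support is smaller, plus the multiple \<open>?b\<close> of a basis element.\<close>
      let ?b = "c s \<odot>\<^bsub>free_module R S\<^esub> basis_elt R s" and ?d = "c(s := \<zero>)"
      have s: "s \<in> S" "c s \<in> carrier R" using False insert.prems by (auto simp: free_module_carrier)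
      have d: "?d \<in> carrier (free_module R S)"
        using insert.prems by (auto simp: free_module_carrier intro: rev_finite_subset)
      have "c = ?d \<oplus>\<^bsub>free_module R S\<^esub> ?b"
        using insert.prems s by (auto simp: fun_eq_iff basis_elt_def free_module_carrier)
      moreover have "P ?d" using insert.prems by (intro insert.IH d) auto
      ultimately show ?thesis
        using add[of ?d ?b] basis[OF s(2,1)] d F.smult_closed[OF s(2) basis_elt_closed[OF s(1)]]
        by metis
    qed
  qed
  from this[of "{s. c s \<noteq> \<zero>}" c] c show ?thesis by (simp add: free_module_carrier)
qed

lemma linear_map_free_eqI:
  assumes "module R N" "linear_map R (free_module R S) N h" "linear_map R (free_module R S) N h'"
    "\<And>s. s \<in> S \<Longrightarrow> h (basis_elt R s) = h' (basis_elt R s)" "c \<in> carrier (free_module R S)"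
  shows "h c = h' c"
  using assms(5)
proof (induction rule: free_module_induct)
  case zero
  show ?case using linear_map_zero[OF assms(2)] linear_map_zero[OF assms(3)] assms(1)
    by (metis module_free_module)
next
  case (add c d)
  then show ?case by (simp add: linear_mapD[OF assms(2)] linear_mapD[OF assms(3)] del: free_module_sel)
next
  case (basis r s)
  then show ?case
    by (simp add: linear_mapD[OF assms(2)] linear_mapD[OF assms(3)] basis_elt_closed assms(4) del: free_module_sel)
qed

end

section \<open>Tensor products over a group ring\<close>

text \<open>The maps that the tensor product over the group ring represents: bilinear, and unable to
  distinguish the right action on the first factor from the left action on the second.\<close>

definition balanced_map :: "('k, 'r) ring_scheme \<Rightarrow> ('g, 'h) monoid_scheme \<Rightarrow>
    ('k, 'x) module \<Rightarrow> ('g \<Rightarrow> 'x \<Rightarrow> 'x) \<Rightarrow> ('k, 'u, 'g) rep \<Rightarrow> ('k, 'v, 'y) module_scheme \<Rightarrow>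
    ('x \<Rightarrow> 'u \<Rightarrow> 'v) \<Rightarrow> bool" where
  "balanced_map R G X \<rho> U N \<phi> \<longleftrightarrow> (\<forall>u\<in>carrier U. linear_map R X N (\<lambda>x. \<phi> x u)) \<and>
     (\<forall>x\<in>carrier X. linear_map R U N (\<phi> x)) \<and>
     (\<forall>g\<in>carrier G. \<forall>x\<in>carrier X. \<forall>u\<in>carrier U. \<phi> (\<rho> g x) u = \<phi> x (act U g u))"

locale tensor_product =
  fixes R :: "('k, 'r) ring_scheme" and G :: "('g, 'h) monoid_scheme" and X :: "('k, 'x) module"
    and \<rho> :: "'g \<Rightarrow> 'x \<Rightarrow> 'x" and U :: "('k, 'u, 'g) rep"
  assumes mX: "module R X" and repU: "representation R G U"
    and \<rho>_closed: "\<And>g x. g \<in> carrier G \<Longrightarrow> x \<in> carrier X \<Longrightarrow> \<rho> g x \<in> carrier X"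
begin

abbreviation "PM \<equiv> pairs_module R X U"
abbreviation "K \<equiv> tensor_kernel R G X \<rho> U"
abbreviation "T \<equiv> tensor R G X \<rho> U"

lemma mU: "module R U" using repU by (simp add: representation_def)

lemma act_closed: "g \<in> carrier G \<Longrightarrow> u \<in> carrier U \<Longrightarrow> act U g u \<in> carrier U"
  using repU by (auto simp: representation_def lin_hom_iff linear_map_def)

sublocale X: module R X by (rule mX)
sublocale U: module R U by (rule mU)

lemma mP: "module R PM"
  unfolding pairs_module_def by (rule X.R.module_free_module)

sublocale P: module R PM by (rule mP)

lemma e_closed: "x \<in> carrier X \<Longrightarrow> u \<in> carrier U \<Longrightarrow> basis_elt R (x, u) \<in> carrier PM"
  unfolding pairs_module_def by (rule X.R.basis_elt_closed) auto

lemma relations_closed: "tensor_relations R G X \<rho> U \<subseteq> carrier PM"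
  unfolding tensor_relations_def Let_def
  by (auto simp: e_closed \<rho>_closed act_closed)

sublocale Q: quotient R PM K
  by (rule quotient.intro[OF mP quotient_axioms.intro])
    (simp add: tensor_kernel_def span_submodule[OF mP relations_closed])

definition tau :: "'x \<Rightarrow> 'u \<Rightarrow> ('x \<times> 'u \<Rightarrow> 'k) set" where
  "tau x u = Q.cls (basis_elt R (x, u))"

lemma module_tensor: "module R T"
  unfolding tensor_def by (rule Q.module_quot)

sublocale T: module R T by (rule module_tensor)

lemma linear_cls: "linear_map R PM T Q.cls"
  unfolding tensor_def by (rule Q.linear_map_cls)

lemma tau_closed: "x \<in> carrier X \<Longrightarrow> u \<in> carrier U \<Longrightarrow> tau x u \<in> carrier T"
  unfolding tau_def using linear_mapD(1)[OF linear_cls] e_closed by blast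

lemma cls_relation:
  assumes "a \<ominus>\<^bsub>PM\<^esub> b \<in> tensor_relations R G X \<rho> U" "a \<in> carrier PM" "b \<in> carrier PM"
  shows "Q.cls a = Q.cls b"
  using assms span_superset[of "tensor_relations R G X \<rho> U" R PM]
  by (subst Q.cls_eq_iff) (auto simp: tensor_kernel_def)

lemma tau_balanced: "balanced_map R G X \<rho> U T tau"
proof -
  note L = linear_mapD(2,3)[OF linear_cls, symmetric]
  note [simp] = e_closed act_closed \<rho>_closed
  have 1: "tau (x \<oplus>\<^bsub>X\<^esub> x') u = tau x u \<oplus>\<^bsub>T\<^esub> tau x' u"
    if "x \<in> carrier X" "x' \<in> carrier X" "u \<in> carrier U" for x x' u
  proof -
    have "basis_elt R (x \<oplus>\<^bsub>X\<^esub> x', u) \<ominus>\<^bsub>PM\<^esub> (basis_elt R (x, u) \<oplus>\<^bsub>PM\<^esub> basis_elt R (x', u))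
        \<in> tensor_relations R G X \<rho> U"
      unfolding tensor_relations_def Let_def by (rule UnI1, rule UnI1, rule UnI1, rule UnI1, intro CollectI exI conjI, rule refl) (rule that)+
    from cls_relation[OF this] that show ?thesis by (simp add: tau_def L)
  qed
  have 2: "tau x (u \<oplus>\<^bsub>U\<^esub> u') = tau x u \<oplus>\<^bsub>T\<^esub> tau x u'"
    if "x \<in> carrier X" "u \<in> carrier U" "u' \<in> carrier U" for x u u'
  proof -
    have "basis_elt R (x, u \<oplus>\<^bsub>U\<^esub> u') \<ominus>\<^bsub>PM\<^esub> (basis_elt R (x, u) \<oplus>\<^bsub>PM\<^esub> basis_elt R (x, u'))
        \<in> tensor_relations R G X \<rho> U"
      unfolding tensor_relations_def Let_def
      by (rule UnI1, rule UnI1, rule UnI1, rule UnI2, intro CollectI exI conjI, rule refl) (rule that)+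
    from cls_relation[OF this] that show ?thesis by (simp add: tau_def L)
  qed
  have 3: "tau (c \<odot>\<^bsub>X\<^esub> x) u = c \<odot>\<^bsub>T\<^esub> tau x u"
    if "c \<in> carrier R" "x \<in> carrier X" "u \<in> carrier U" for c x u
  proof -
    have "basis_elt R (c \<odot>\<^bsub>X\<^esub> x, u) \<ominus>\<^bsub>PM\<^esub> (c \<odot>\<^bsub>PM\<^esub> basis_elt R (x, u))
        \<in> tensor_relations R G X \<rho> U"
      unfolding tensor_relations_def Let_def
      by (rule UnI1, rule UnI1, rule UnI2, intro CollectI exI conjI, rule refl) (rule that)+
    from cls_relation[OF this] that show ?thesis by (simp add: tau_def L)
  qed
  have 4: "tau x (c \<odot>\<^bsub>U\<^esub> u) = c \<odot>\<^bsub>T\<^esub> tau x u"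
    if "c \<in> carrier R" "x \<in> carrier X" "u \<in> carrier U" for c x u
  proof -
    have "basis_elt R (x, c \<odot>\<^bsub>U\<^esub> u) \<ominus>\<^bsub>PM\<^esub> (c \<odot>\<^bsub>PM\<^esub> basis_elt R (x, u))
        \<in> tensor_relations R G X \<rho> U"
      unfolding tensor_relations_def Let_def
      by (rule UnI1, rule UnI2, intro CollectI exI conjI, rule refl) (rule that)+
    from cls_relation[OF this] that show ?thesis by (simp add: tau_def L)
  qed
  have 5: "tau (\<rho> g x) u = tau x (act U g u)"
    if "g \<in> carrier G" "x \<in> carrier X" "u \<in> carrier U" for g x u
  proof -
    have "basis_elt R (\<rho> g x, u) \<ominus>\<^bsub>PM\<^esub> basis_elt R (x, act U g u) \<in> tensor_relations R G X \<rho> U"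
      unfolding tensor_relations_def Let_def by (rule UnI2, intro CollectI exI conjI, rule refl) (rule that)+
    from cls_relation[OF this] that show ?thesis by (simp add: tau_def)
  qed
  show ?thesis
    by (simp add: balanced_map_def linear_map_def 1 2 3 4 5 tau_closed)
qed

text \<open>Each defining relation of the tensor product states one of the laws of a balanced map, so the
  linear extension of a balanced map vanishes on all of them.\<close>

lemma kernel_killed:
  assumes "module R N" "balanced_map R G X \<rho> U N \<phi>" "linear_map R PM N k"
    "\<And>x u. x \<in> carrier X \<Longrightarrow> u \<in> carrier U \<Longrightarrow> k (basis_elt R (x, u)) = \<phi> x u" "z \<in> K"
  shows "k z = \<zero>\<^bsub>N\<^esub>"
proof (rule linear_map_span[OF mP assms(1,3) relations_closed])
  show "z \<in> span R PM (tensor_relations R G X \<rho> U)"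
    using assms(5) by (simp add: tensor_kernel_def)
next
  interpret N: module R N by fact
  fix r assume "r \<in> tensor_relations R G X \<rho> U"
  then show "k r = \<zero>\<^bsub>N\<^esub>"
    using assms(2) unfolding tensor_relations_def Let_def
    by (auto simp: linear_map_diff[OF assms(3) mP assms(1)] linear_mapD[OF assms(3)] e_closed
        act_closed \<rho>_closed assms(4) balanced_map_def linear_map_def N.diff_eq_zero_iff)
qed

lemma tensor_lift:
  assumes "module R N" "balanced_map R G X \<rho> U N \<phi>"
  shows "\<exists>h. linear_map R T N h \<and> (\<forall>x\<in>carrier X. \<forall>u\<in>carrier U. h (tau x u) = \<phi> x u)"
proof -
  let ?k = "lin_ext R (carrier X \<times> carrier U) N (\<lambda>(x, u). \<phi> x u)"
  have g: "(\<lambda>(x, u). \<phi> x u) s \<in> carrier N" if "s \<in> carrier X \<times> carrier U" for s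
    using that assms(2) by (auto simp: balanced_map_def linear_map_def)
  have k: "linear_map R PM N ?k"
    using X.R.lin_ext_lin_hom[OF assms(1), of "carrier X \<times> carrier U", OF g]
    by (simp add: lin_hom_iff pairs_module_def)
  have kb: "?k (basis_elt R (x, u)) = \<phi> x u" if "x \<in> carrier X" "u \<in> carrier U" for x u
    using X.R.lin_ext_basis_elt[OF assms(1), of "carrier X \<times> carrier U", OF g] that by simp
  obtain h where "linear_map R (quot_module PM K) N h" "\<forall>z\<in>carrier PM. h (Q.cls z) = ?k z"
    using Q.quot_lift[OF assms(1) k kernel_killed[OF assms k kb]] by auto
  then show ?thesis by (auto simp: tensor_def tau_def e_closed kb)
qed

text \<open>Scalars can be absorbed into the first factor, so pure tensors generate additively.\<close>

lemma tensor_induct [consumes 1, case_names zero add tau]: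
  assumes "z \<in> carrier T"
    and zero: "P \<zero>\<^bsub>T\<^esub>"
    and add: "\<And>y z. y \<in> carrier T \<Longrightarrow> z \<in> carrier T \<Longrightarrow> P y \<Longrightarrow> P z \<Longrightarrow> P (y \<oplus>\<^bsub>T\<^esub> z)"
    and tau: "\<And>x u. x \<in> carrier X \<Longrightarrow> u \<in> carrier U \<Longrightarrow> P (tau x u)"
  shows "P z"
proof -
  have "P (Q.cls c)" if "c \<in> carrier PM" for c
    using that unfolding pairs_module_def
  proof (induction rule: X.R.free_module_induct)
    case zero
    then show ?case
      using assms(2) linear_map_zero[OF linear_cls mP module_tensor] by (simp add: pairs_module_def)
  next
    case (add c d)
    then show ?case
      using assms(3)[of "Q.cls c" "Q.cls d"] linear_mapD(1,2)[OF linear_cls]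
      by (simp add: pairs_module_def)
  next
    case (basis r s)
    obtain x u where s: "s = (x, u)" "x \<in> carrier X" "u \<in> carrier U" using basis by auto
    have "Q.cls (r \<odot>\<^bsub>PM\<^esub> basis_elt R s) = r \<odot>\<^bsub>T\<^esub> tau x u"
      using s basis by (simp add: tau_def linear_mapD(3)[OF linear_cls] e_closed)
    also have "\<dots> = tau (r \<odot>\<^bsub>X\<^esub> x) u"
      using tau_balanced s basis by (simp add: balanced_map_def linear_map_def)
    finally show ?case using assms(4)[of "r \<odot>\<^bsub>X\<^esub> x" u] s basis by (simp add: pairs_module_def)
  qed
  moreover obtain c where "c \<in> carrier PM" "z = Q.cls c"
    using assms(1) by (auto simp: tensor_def Q.carrier_quot)
  ultimately show ?thesis by simp
qed

end

lemma
  assumes "tensor_product R G X \<rho> U" "tensor_product R G Y \<sigma> V"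
    and \<phi>: "linear_map R X Y \<phi>" and \<psi>: "linear_map R U V \<psi>"
    and \<phi>_equiv: "\<And>g x. g \<in> carrier G \<Longrightarrow> x \<in> carrier X \<Longrightarrow> \<phi> (\<rho> g x) = \<sigma> g (\<phi> x)"
    and \<psi>_equiv: "\<And>g u. g \<in> carrier G \<Longrightarrow> u \<in> carrier U \<Longrightarrow> \<psi> (act U g u) = act V g (\<psi> u)"
  shows tensor_map_tau: "x \<in> carrier X \<Longrightarrow> u \<in> carrier U \<Longrightarrow>
      tensor_map R G X \<rho> U Y \<sigma> V \<phi> \<psi> (tensor_product.tau R G X \<rho> U x u)
        = tensor_product.tau R G Y \<sigma> V (\<phi> x) (\<psi> u)"
    and tensor_map_lin_hom: "tensor_map R G X \<rho> U Y \<sigma> V \<phi> \<psi>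
        \<in> lin_hom R (tensor R G X \<rho> U) (tensor R G Y \<sigma> V)"
proof -
  interpret A: tensor_product R G X \<rho> U by fact
  interpret B: tensor_product R G Y \<sigma> V by fact
  let ?g = "\<lambda>(x, u). basis_elt R (\<phi> x, \<psi> u)"
  let ?k = "lin_ext R (carrier X \<times> carrier U) B.PM ?g"
  note [simp] = linear_mapD(1)[OF \<phi>] linear_mapD(1)[OF \<psi>]
  have g: "?g s \<in> carrier B.PM" if "s \<in> carrier X \<times> carrier U" for s
    using that by (auto intro: B.e_closed)
  have k: "linear_map R A.PM B.PM ?k"
    using A.X.R.lin_ext_lin_hom[OF B.mP, of "carrier X \<times> carrier U", OF g]
    by (simp add: lin_hom_iff pairs_module_def)
  have kb: "?k (basis_elt R (x, u)) = basis_elt R (\<phi> x, \<psi> u)"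
    if "x \<in> carrier X" "u \<in> carrier U" for x u
    using A.X.R.lin_ext_basis_elt[OF B.mP, of "carrier X \<times> carrier U", OF g] that by simp
  have "balanced_map R G X \<rho> U B.T (\<lambda>x u. B.tau (\<phi> x) (\<psi> u))"
    using B.tau_balanced
    by (simp add: balanced_map_def linear_map_def linear_mapD[OF \<phi>] linear_mapD[OF \<psi>]
        \<phi>_equiv \<psi>_equiv)
  then have K: "?k z \<in> B.K" if "z \<in> A.K" for z
  proof -
    assume b: "balanced_map R G X \<rho> U B.T (\<lambda>x u. B.tau (\<phi> x) (\<psi> u))"
    have z: "z \<in> carrier A.PM" using that A.Q.S.a_subset by auto
    have "B.Q.cls (?k z) = \<zero>\<^bsub>B.T\<^esub>"
      by (rule A.kernel_killed[OF B.module_tensor b linear_map_comp[OF k B.linear_cls] _ that])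
        (simp add: kb B.tau_def)
    then show ?thesis
      using B.Q.cls_eq_zero_iff[OF linear_mapD(1)[OF k z]] by (simp add: tensor_def)
  qed
  note * = A.Q.quotient_axioms B.Q.quotient_axioms k K
  show "tensor_map R G X \<rho> U Y \<sigma> V \<phi> \<psi> (A.tau x u) = B.tau (\<phi> x) (\<psi> u)"
    if "x \<in> carrier X" "u \<in> carrier U"
    unfolding tensor_map_def A.tau_def B.tau_def
    using quot_map_cls[OF *] that by (simp add: A.e_closed kb)
  show "tensor_map R G X \<rho> U Y \<sigma> V \<phi> \<psi> \<in> lin_hom R A.T B.T"
    unfolding tensor_map_def tensor_def by (rule quot_map_lin_hom[OF *])
qed

section \<open>Direct sums\<close>

definition summand_inj :: "(nat \<Rightarrow> ('k, 'u) module) \<Rightarrow> nat \<Rightarrow> 'u \<Rightarrow> nat \<Rightarrow> 'u" where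
  "summand_inj M a y = (\<lambda>i. if i = a then y else \<zero>\<^bsub>M i\<^esub>)"

lemma direct_sum_sel [simp]:
  "zero (direct_sum M) = (\<lambda>i. \<zero>\<^bsub>M i\<^esub>)"
  "add (direct_sum M) = (\<lambda>x y i. x i \<oplus>\<^bsub>M i\<^esub> y i)"
  "smult (direct_sum M) = (\<lambda>c x i. c \<odot>\<^bsub>M i\<^esub> x i)"
  by (simp_all add: direct_sum_def)

lemma direct_sum_carrier:
  "x \<in> carrier (direct_sum M) \<longleftrightarrow> (\<forall>i. x i \<in> carrier (M i)) \<and> finite {i. x i \<noteq> \<zero>\<^bsub>M i\<^esub>}"
  by (simp add: direct_sum_def)

locale module_family =
  fixes R :: "('k, 'r) ring_scheme" and M :: "nat \<Rightarrow> ('k, 'u) module"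
  assumes mM: "\<And>i. module R (M i)"
begin

sublocale M: module R "M i" for i by (rule mM)

lemma module_direct_sum: "module R (direct_sum M)"
proof (rule moduleI)
  show "cring R" by (rule M.R.is_cring)
  show "abelian_group (direct_sum M)"
  proof (rule abelian_groupI)
    fix x y assume "x \<in> carrier (direct_sum M)" "y \<in> carrier (direct_sum M)"
    moreover have "{i. x i \<oplus>\<^bsub>M i\<^esub> y i \<noteq> \<zero>\<^bsub>M i\<^esub>} \<subseteq> {i. x i \<noteq> \<zero>\<^bsub>M i\<^esub>} \<union> {i. y i \<noteq> \<zero>\<^bsub>M i\<^esub>}"
      by auto
    ultimately show "x \<oplus>\<^bsub>direct_sum M\<^esub> y \<in> carrier (direct_sum M)"
      by (auto simp: direct_sum_carrier intro: finite_subset)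
  next
    fix x assume x: "x \<in> carrier (direct_sum M)"
    show "\<exists>y\<in>carrier (direct_sum M). y \<oplus>\<^bsub>direct_sum M\<^esub> x = \<zero>\<^bsub>direct_sum M\<^esub>"
      by (rule bexI[of _ "\<lambda>i. \<ominus>\<^bsub>M i\<^esub> x i"])
        (use x in \<open>auto simp: direct_sum_carrier M.M.l_neg intro: rev_finite_subset\<close>)
  qed (auto simp: direct_sum_carrier M.M.a_ac fun_eq_iff)
next
  fix a x assume "a \<in> carrier R" "x \<in> carrier (direct_sum M)"
  moreover from this have "{i. a \<odot>\<^bsub>M i\<^esub> x i \<noteq> \<zero>\<^bsub>M i\<^esub>} \<subseteq> {i. x i \<noteq> \<zero>\<^bsub>M i\<^esub>}" by auto
  ultimately show "a \<odot>\<^bsub>direct_sum M\<^esub> x \<in> carrier (direct_sum M)"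
    by (auto simp: direct_sum_carrier intro: finite_subset)
qed (auto simp: direct_sum_carrier M.smult_l_distr M.smult_r_distr M.smult_assoc1 fun_eq_iff)

sublocale D: module R "direct_sum M" by (rule module_direct_sum)

lemma linear_summand_inj: "linear_map R (M a) (direct_sum M) (summand_inj M a)"
  by rule (auto simp: direct_sum_carrier summand_inj_def fun_eq_iff)

lemma direct_sum_induct [consumes 1, case_names zero add inj]:
  assumes "x \<in> carrier (direct_sum M)"
    and zero: "P \<zero>\<^bsub>direct_sum M\<^esub>"
    and add: "\<And>x y. x \<in> carrier (direct_sum M) \<Longrightarrow> y \<in> carrier (direct_sum M) \<Longrightarrow> P x \<Longrightarrow> P y \<Longrightarrow>
      P (x \<oplus>\<^bsub>direct_sum M\<^esub> y)"
    and inj: "\<And>a y. y \<in> carrier (M a) \<Longrightarrow> P (summand_inj M a y)"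
  shows "P x"
proof -
  have "P x" if "finite A" "{i. x i \<noteq> \<zero>\<^bsub>M i\<^esub>} \<subseteq> A" "x \<in> carrier (direct_sum M)" for A x
    using that
  proof (induction A arbitrary: x)
    case empty
    then have "x = \<zero>\<^bsub>direct_sum M\<^esub>" by (auto simp: fun_eq_iff)
    with zero show ?case by simp
  next
    case (insert a A)
    let ?d = "x(a := \<zero>\<^bsub>M a\<^esub>)"
    have xa: "x a \<in> carrier (M a)" using insert.prems by (auto simp: direct_sum_carrier)
    have d: "?d \<in> carrier (direct_sum M)"
      using insert.prems by (auto simp: direct_sum_carrier intro: rev_finite_subset)
    have "x = ?d \<oplus>\<^bsub>direct_sum M\<^esub> summand_inj M a (x a)"
      using insert.prems by (auto simp: fun_eq_iff summand_inj_def direct_sum_carrier)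
    moreover have "P ?d" using insert.prems by (intro insert.IH d) auto
    ultimately show ?case
      using add[OF d linear_mapD(1)[OF linear_summand_inj xa]] inj[OF xa] by metis
  qed
  from this[of "{i. x i \<noteq> \<zero>\<^bsub>M i\<^esub>}" x] assms(1) show ?thesis by (simp add: direct_sum_carrier)
qed

lemma direct_sum_lift:
  assumes "module R N" and h: "\<And>a. linear_map R (M a) N (h a)"
  shows "\<exists>k. linear_map R (direct_sum M) N k \<and>
    (\<forall>a. \<forall>y\<in>carrier (M a). k (summand_inj M a y) = h a y)"
proof -
  interpret N: module R N by fact
  define k where "k x = (\<Oplus>\<^bsub>N\<^esub>a\<in>{i. x i \<noteq> \<zero>\<^bsub>M i\<^esub>}. h a (x a))" for x
  have h0: "h a \<zero>\<^bsub>M a\<^esub> = \<zero>\<^bsub>N\<^esub>" for a by (rule linear_map_zero[OF h mM assms(1)])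
  have sup: "k x = (\<Oplus>\<^bsub>N\<^esub>a\<in>A. h a (x a))"
    if "x \<in> carrier (direct_sum M)" "finite A" "{i. x i \<noteq> \<zero>\<^bsub>M i\<^esub>} \<subseteq> A" for x A
    unfolding k_def
    by (rule N.add.finprod_mono_neutral_cong_left)
      (use that in \<open>auto simp: h0 direct_sum_carrier linear_mapD[OF h]\<close>)
  have c: "(\<lambda>a. h a (x a)) \<in> A \<rightarrow> carrier N" if "x \<in> carrier (direct_sum M)" for x A
    using that by (auto simp: direct_sum_carrier linear_mapD[OF h])
  have "linear_map R (direct_sum M) N k"
  proof
    fix x assume x: "x \<in> carrier (direct_sum M)"
    let ?A = "{i. x i \<noteq> \<zero>\<^bsub>M i\<^esub>}"
    have A: "finite ?A" using x by (simp add: direct_sum_carrier)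
    show "k x \<in> carrier N" unfolding k_def by (rule N.finsum_closed[OF c[OF x]])
    fix r assume r: "r \<in> carrier R"
    have "k (r \<odot>\<^bsub>direct_sum M\<^esub> x) = (\<Oplus>\<^bsub>N\<^esub>a\<in>?A. h a ((r \<odot>\<^bsub>direct_sum M\<^esub> x) a))"
      by (rule sup[OF D.smult_closed[OF r x] A]) (use r in auto)
    also have "\<dots> = (\<Oplus>\<^bsub>N\<^esub>a\<in>?A. r \<odot>\<^bsub>N\<^esub> h a (x a))"
      using r x by (intro N.finsum_cong') (auto simp: linear_mapD[OF h] direct_sum_carrier)
    also have "\<dots> = r \<odot>\<^bsub>N\<^esub> k x"
      using N.finsum_smult_ldistr[OF A r c[OF x]] by (simp add: k_def)
    finally show "k (r \<odot>\<^bsub>direct_sum M\<^esub> x) = r \<odot>\<^bsub>N\<^esub> k x" .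
  next
    fix x y assume x: "x \<in> carrier (direct_sum M)" and y: "y \<in> carrier (direct_sum M)"
    let ?A = "{i. x i \<noteq> \<zero>\<^bsub>M i\<^esub>} \<union> {i. y i \<noteq> \<zero>\<^bsub>M i\<^esub>}"
    have A: "finite ?A" using x y by (simp add: direct_sum_carrier)
    have "k (x \<oplus>\<^bsub>direct_sum M\<^esub> y) = (\<Oplus>\<^bsub>N\<^esub>a\<in>?A. h a ((x \<oplus>\<^bsub>direct_sum M\<^esub> y) a))"
      by (rule sup[OF D.a_closed[OF x y] A]) auto
    also have "\<dots> = (\<Oplus>\<^bsub>N\<^esub>a\<in>?A. h a (x a) \<oplus>\<^bsub>N\<^esub> h a (y a))"
      using x y by (intro N.finsum_cong') (auto simp: linear_mapD[OF h] direct_sum_carrier)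
    also have "\<dots> = k x \<oplus>\<^bsub>N\<^esub> k y"
      using N.finsum_addf[OF c[OF x] c[OF y]] sup[OF x A] sup[OF y A] by simp
    finally show "k (x \<oplus>\<^bsub>direct_sum M\<^esub> y) = k x \<oplus>\<^bsub>N\<^esub> k y" .
  qed
  moreover have "k (summand_inj M a y) = h a y" if "y \<in> carrier (M a)" for a y
  proof -
    have "k (summand_inj M a y) = (\<Oplus>\<^bsub>N\<^esub>i\<in>{a}. h i (summand_inj M a y i))"
      by (rule sup) (use linear_mapD(1)[OF linear_summand_inj that] in \<open>auto simp: summand_inj_def\<close>)
    then show ?thesis using that by (simp add: summand_inj_def linear_mapD[OF h])
  qed
  ultimately show ?thesis by blast
qed

end

lemma direct_sum_map_summand_inj:
  assumes "module_family R M" "module_family R N" "\<And>a. linear_map R (M a) (N a) (h a)"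
    "y \<in> carrier (M a)"
  shows "direct_sum_map M h (summand_inj M a y) = summand_inj N a (h a y)"
proof -
  interpret M: module_family R M by fact
  interpret N: module_family R N by fact
  have "h i \<zero>\<^bsub>M i\<^esub> = \<zero>\<^bsub>N i\<^esub>" for i by (rule linear_map_zero[OF assms(3) M.mM N.mM])
  then show ?thesis
    using linear_mapD(1)[OF M.linear_summand_inj assms(4)]
    by (auto simp: direct_sum_map_def summand_inj_def fun_eq_iff)
qed

lemma direct_sum_map_lin_hom:
  assumes "module_family R M" "module_family R N" and h: "\<And>a. linear_map R (M a) (N a) (h a)"
  shows "direct_sum_map M h \<in> lin_hom R (direct_sum M) (direct_sum N)"
proof -
  interpret M: module_family R M by fact
  interpret N: module_family R N by fact
  have h0: "h i \<zero>\<^bsub>M i\<^esub> = \<zero>\<^bsub>N i\<^esub>" for i by (rule linear_map_zero[OF assms(3) M.mM N.mM])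
  have "linear_map R (direct_sum M) (direct_sum N) (\<lambda>x i. h i (x i))"
  proof
    fix x assume x: "x \<in> carrier (direct_sum M)"
    have "{i. h i (x i) \<noteq> \<zero>\<^bsub>N i\<^esub>} \<subseteq> {i. x i \<noteq> \<zero>\<^bsub>M i\<^esub>}" using h0 by auto
    with x show "(\<lambda>i. h i (x i)) \<in> carrier (direct_sum N)"
      by (auto simp: direct_sum_carrier linear_mapD[OF h] intro: finite_subset)
  qed (auto simp: direct_sum_carrier linear_mapD[OF h])
  then show ?thesis
    unfolding direct_sum_map_def by (rule linear_map_restrict[OF M.module_direct_sum])
qed

section \<open>Combinatorics of FI-sharp\<close>

lemma mem_signed:
  "a \<in> signed n \<longleftrightarrow> a \<noteq> 0 \<and> \<bar>a\<bar> \<le> int n" "a \<in> signed0 n \<longleftrightarrow> \<bar>a\<bar> \<le> int n"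
  by (auto simp: signed_def signed0_def)

lemma finite_signed [simp]: "finite (signed n)" "finite (signed0 n)"
  by (simp_all add: signed_def signed0_def)

lemma card_signed: "card (signed n) = 2 * n"
proof -
  have "card (signed n) = card {- int n..int n} - 1"
    unfolding signed_def by (subst card_Diff_singleton) auto
  then show ?thesis by simp
qed

text \<open>The bound on the cardinality of fibres says that distinct elements with equal image go to \<open>0\<close>.\<close>

lemma sharp_hom_iff: "f \<in> sharp_hom W m n \<longleftrightarrow> f \<in> extensional (signed0 m) \<and>
   (\<forall>a. \<bar>a\<bar> \<le> int m \<longrightarrow> \<bar>f a\<bar> \<le> int n \<and> f (- a) = - f a) \<and>
   (\<forall>a b. \<bar>a\<bar> \<le> int m \<longrightarrow> \<bar>b\<bar> \<le> int m \<longrightarrow> f a = f b \<longrightarrow> f a \<noteq> 0 \<longrightarrow> a = b) \<and>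
   (W = TypeA \<longrightarrow> (\<forall>a. \<bar>a\<bar> \<le> int m \<longrightarrow> 0 < a \<longrightarrow> 0 \<le> f a))"
proof -
  have fin: "finite {a. \<bar>a\<bar> \<le> int m \<and> f a = b}" for b
    by (rule finite_subset[OF _ finite_signed(2)[of m]]) (auto simp: mem_signed)
  have c: "(\<forall>b. b \<noteq> 0 \<and> \<bar>b\<bar> \<le> int n \<longrightarrow> card {a. \<bar>a\<bar> \<le> int m \<and> f a = b} \<le> 1) \<longleftrightarrow>
      (\<forall>a b. \<bar>a\<bar> \<le> int m \<longrightarrow> \<bar>b\<bar> \<le> int m \<longrightarrow> f a = f b \<longrightarrow> f a \<noteq> 0 \<longrightarrow> a = b)"
    if "\<forall>a. \<bar>a\<bar> \<le> int m \<longrightarrow> \<bar>f a\<bar> \<le> int n"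
    unfolding One_nat_def card_le_Suc0_iff_eq[OF fin] Ball_def mem_Collect_eq using that by metis
  show ?thesis
  proof (cases "\<forall>a. \<bar>a\<bar> \<le> int m \<longrightarrow> \<bar>f a\<bar> \<le> int n")
    case True
    show ?thesis
      unfolding sharp_hom_def PiE_def mem_Collect_eq Int_iff Pi_iff Ball_def mem_signed c[OF True]
        imp_conjR all_conj_distrib by (simp only: conj_ac)
  next
    case False
    then show ?thesis
      unfolding sharp_hom_def PiE_def mem_Collect_eq Int_iff Pi_iff Ball_def mem_signed
        imp_conjR all_conj_distrib by (simp only: HOL.simp_thms)
  qed
qed

lemma sharp_hom_zero: "f \<in> sharp_hom W m n \<Longrightarrow> f 0 = 0"
  unfolding sharp_hom_iff by (metis abs_zero add.inverse_neutral equal_neg_zero of_nat_0_le_iff)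

lemma fi_hom_iff: "f \<in> fi_hom W m n \<longleftrightarrow> f \<in> extensional (signed m) \<and>
   (\<forall>a. a \<noteq> 0 \<longrightarrow> \<bar>a\<bar> \<le> int m \<longrightarrow> f a \<noteq> 0 \<and> \<bar>f a\<bar> \<le> int n \<and> f (- a) = - f a) \<and>
   inj_on f (signed m) \<and>
   (W = TypeA \<longrightarrow> (\<forall>a. \<bar>a\<bar> \<le> int m \<longrightarrow> 0 < a \<longrightarrow> 0 < f a))"
  unfolding fi_hom_def PiE_def mem_Collect_eq Int_iff Pi_iff Ball_def mem_signed
    imp_conjL imp_conjR all_conj_distrib
  by (auto simp only:)

lemma weyl_group_carrier: "carrier (weyl_group W n) = fi_hom W n n"
proof -
  have *: "bij_betw w (signed n) (signed n) \<longleftrightarrow> w \<in> signed n \<rightarrow> signed n \<and> inj_on w (signed n)" for w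
    unfolding bij_betw_def using endo_inj_surj[OF finite_signed(1), of w n] by blast
  show ?thesis
    unfolding weyl_group_def fi_hom_def PiE_def partial_object.simps * by blast
qed

lemma weyl_group_sel [simp]:
  "monoid.mult (weyl_group W n) = compose (signed n)"
  "one (weyl_group W n) = (\<lambda>a\<in>signed n. a)"
  by (simp_all add: weyl_group_def)

lemma fi_hom_le:
  assumes "f \<in> fi_hom W m n" shows "m \<le> n"
  using card_inj_on_le[of f "signed m" "signed n"] assms unfolding fi_hom_def
  by (auto simp: card_signed)

lemma sharp_homI:
  assumes "f \<in> extensional (signed0 m)" "\<And>a. \<bar>a\<bar> \<le> int m \<Longrightarrow> \<bar>f a\<bar> \<le> int n"
    "\<And>a. \<bar>a\<bar> \<le> int m \<Longrightarrow> f (- a) = - f a"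
    "\<And>a b. \<bar>a\<bar> \<le> int m \<Longrightarrow> \<bar>b\<bar> \<le> int m \<Longrightarrow> f a = f b \<Longrightarrow> f a \<noteq> 0 \<Longrightarrow> a = b"
    "\<And>a. W = TypeA \<Longrightarrow> \<bar>a\<bar> \<le> int m \<Longrightarrow> 0 < a \<Longrightarrow> 0 \<le> f a"
  shows "f \<in> sharp_hom W m n"
  unfolding sharp_hom_iff using assms by blast

lemma sharp_homD:
  assumes "f \<in> sharp_hom W m n"
  shows "f \<in> extensional (signed0 m)" "\<bar>a\<bar> \<le> int m \<Longrightarrow> \<bar>f a\<bar> \<le> int n"
    "\<bar>a\<bar> \<le> int m \<Longrightarrow> f (- a) = - f a"
    "\<bar>a\<bar> \<le> int m \<Longrightarrow> \<bar>b\<bar> \<le> int m \<Longrightarrow> f a = f b \<Longrightarrow> f a \<noteq> 0 \<Longrightarrow> a = b"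
    "W = TypeA \<Longrightarrow> \<bar>a\<bar> \<le> int m \<Longrightarrow> 0 < a \<Longrightarrow> 0 \<le> f a"
    "f 0 = 0"
  using assms sharp_hom_zero[OF assms] unfolding sharp_hom_iff by blast+

lemma fi_homI:
  assumes "f \<in> extensional (signed m)"
    "\<And>a. a \<noteq> 0 \<Longrightarrow> \<bar>a\<bar> \<le> int m \<Longrightarrow> f a \<noteq> 0"
    "\<And>a. a \<noteq> 0 \<Longrightarrow> \<bar>a\<bar> \<le> int m \<Longrightarrow> \<bar>f a\<bar> \<le> int n"
    "\<And>a. a \<noteq> 0 \<Longrightarrow> \<bar>a\<bar> \<le> int m \<Longrightarrow> f (- a) = - f a"
    "\<And>a b. a \<noteq> 0 \<Longrightarrow> b \<noteq> 0 \<Longrightarrow> \<bar>a\<bar> \<le> int m \<Longrightarrow> \<bar>b\<bar> \<le> int m \<Longrightarrow> f a = f b \<Longrightarrow> a = b"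
    "\<And>a. W = TypeA \<Longrightarrow> \<bar>a\<bar> \<le> int m \<Longrightarrow> 0 < a \<Longrightarrow> 0 < f a"
  shows "f \<in> fi_hom W m n"
  unfolding fi_hom_iff inj_on_def Ball_def mem_signed using assms by blast

lemma fi_homD:
  assumes "f \<in> fi_hom W m n"
  shows "f \<in> extensional (signed m)" "a \<noteq> 0 \<Longrightarrow> \<bar>a\<bar> \<le> int m \<Longrightarrow> f a \<noteq> 0"
    "a \<noteq> 0 \<Longrightarrow> \<bar>a\<bar> \<le> int m \<Longrightarrow> \<bar>f a\<bar> \<le> int n"
    "a \<noteq> 0 \<Longrightarrow> \<bar>a\<bar> \<le> int m \<Longrightarrow> f (- a) = - f a"
    "a \<noteq> 0 \<Longrightarrow> b \<noteq> 0 \<Longrightarrow> \<bar>a\<bar> \<le> int m \<Longrightarrow> \<bar>b\<bar> \<le> int m \<Longrightarrow> f a = f b \<Longrightarrow> a = b"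
    "W = TypeA \<Longrightarrow> \<bar>a\<bar> \<le> int m \<Longrightarrow> 0 < a \<Longrightarrow> 0 < f a"
    "inj_on f (signed m)" "f ` signed m \<subseteq> signed n"
proof -
  note f = assms[unfolded fi_hom_iff]
  show "f \<in> extensional (signed m)" "inj_on f (signed m)" using f by blast+
  then show "a \<noteq> 0 \<Longrightarrow> b \<noteq> 0 \<Longrightarrow> \<bar>a\<bar> \<le> int m \<Longrightarrow> \<bar>b\<bar> \<le> int m \<Longrightarrow> f a = f b \<Longrightarrow> a = b"
    unfolding inj_on_def Ball_def mem_signed by blast
  show "a \<noteq> 0 \<Longrightarrow> \<bar>a\<bar> \<le> int m \<Longrightarrow> f a \<noteq> 0" "a \<noteq> 0 \<Longrightarrow> \<bar>a\<bar> \<le> int m \<Longrightarrow> \<bar>f a\<bar> \<le> int n"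
    "a \<noteq> 0 \<Longrightarrow> \<bar>a\<bar> \<le> int m \<Longrightarrow> f (- a) = - f a"
    "W = TypeA \<Longrightarrow> \<bar>a\<bar> \<le> int m \<Longrightarrow> 0 < a \<Longrightarrow> 0 < f a" using f by blast+
  show "f ` signed m \<subseteq> signed n" using assms by (auto simp: fi_hom_def)
qed

lemma fi_hom_compose:
  assumes f: "f \<in> fi_hom W l m" and g: "g \<in> fi_hom W m n"
  shows "compose (signed l) g f \<in> fi_hom W l n"
proof (rule fi_homI)
  note [simp] = compose_def mem_signed fi_homD(2,3,4)[OF f] fi_homD(2,3,4)[OF g]
  fix a :: int assume a: "\<bar>a\<bar> \<le> int l"
  show "compose (signed l) g f a \<noteq> 0" "\<bar>compose (signed l) g f a\<bar> \<le> int n"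
    "compose (signed l) g f (- a) = - compose (signed l) g f a" if "a \<noteq> 0"
    using a that by simp_all
  show "a = b" if "a \<noteq> 0" "b \<noteq> 0" "\<bar>b\<bar> \<le> int l"
    "compose (signed l) g f a = compose (signed l) g f b" for b
    using fi_homD(5)[OF f, of a b] fi_homD(5)[OF g, of "f a" "f b"] that a by simp
  show "0 < compose (signed l) g f a" if "W = TypeA" "0 < a"
    using fi_homD(6)[OF f that(1) a that(2)] fi_homD(6)[OF g that(1), of "f a"]
      fi_homD(3)[OF f, of a] that a by simp
qed (simp add: compose_def)

lemma fi_hom_id: "(\<lambda>a\<in>signed n. a) \<in> fi_hom W n n"
  by (rule fi_homI) (simp_all add: mem_signed)

lemma sharp_hom_compose:
  assumes f: "f \<in> sharp_hom W l m" and g: "g \<in> sharp_hom W m n"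
  shows "compose (signed0 l) g f \<in> sharp_hom W l n"
proof (rule sharp_homI)
  note F = sharp_homD(2,3)[OF f] and G = sharp_homD(2,3,6)[OF g]
  note [simp] = compose_def mem_signed F G
  fix a :: int assume a: "\<bar>a\<bar> \<le> int l"
  show "\<bar>compose (signed0 l) g f a\<bar> \<le> int n" using a by simp
  show "compose (signed0 l) g f (- a) = - compose (signed0 l) g f a" using a by simp
  show "a = b" if "\<bar>b\<bar> \<le> int l" "compose (signed0 l) g f a = compose (signed0 l) g f b"
    "compose (signed0 l) g f a \<noteq> 0" for b
  proof -
    have "f a = f b" using sharp_homD(4)[OF g, of "f a" "f b"] that a by simp
    moreover have "f a \<noteq> 0" using that(3) a by auto
    ultimately show ?thesis using sharp_homD(4)[OF f a that(1)] by simp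
  qed
  show "0 \<le> compose (signed0 l) g f a" if "W = TypeA" "0 < a"
    using sharp_homD(5)[OF f that(1) a that(2)] sharp_homD(5)[OF g that(1), of "f a"]
      sharp_homD(2)[OF f a] a
    by (cases "f a = 0") auto
qed (simp add: compose_def)

lemma sharp_hom_id: "(\<lambda>a\<in>signed0 n. a) \<in> sharp_hom W n n"
  by (rule sharp_homI) (simp_all add: mem_signed)

lemma finite_sharp_hom: "finite (sharp_hom W m n)"
  unfolding sharp_hom_def
  by (rule finite_subset[of _ "signed0 m \<rightarrow>\<^sub>E signed0 n"]) (auto intro: finite_PiE)

lemma extend0_sharp:
  assumes f: "f \<in> fi_hom W m n" shows "extend0 m f \<in> sharp_hom W m n"
proof (rule sharp_homI)
  note [simp] = extend0_def mem_signed fi_homD(2,3,4)[OF f]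
  fix a b :: int assume a: "\<bar>a\<bar> \<le> int m"
  show "\<bar>extend0 m f a\<bar> \<le> int n" "extend0 m f (- a) = - extend0 m f a"
    using a by auto
  show "0 \<le> extend0 m f a" if "W = TypeA" "0 < a"
    using fi_homD(6)[OF f that(1) a that(2)] a by simp
  show "a = b" if "\<bar>b\<bar> \<le> int m" "extend0 m f a = extend0 m f b" "extend0 m f a \<noteq> 0"
    using fi_homD(5)[OF f, of a b] a that by (auto split: if_splits)
qed (simp add: extend0_def)

lemma extend0_compose:
  assumes "f \<in> fi_hom W l m"
  shows "extend0 l (compose (signed l) g f) = compose (signed0 l) (extend0 m g) (extend0 l f)"
  using fi_homD(2,3)[OF assms] by (auto simp: extend0_def compose_def fun_eq_iff mem_signed)

lemma extend0_id: "extend0 n (\<lambda>a\<in>signed n. a) = (\<lambda>a\<in>signed0 n. a)"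
  by (auto simp: extend0_def fun_eq_iff mem_signed)

definition kill :: "nat \<Rightarrow> nat \<Rightarrow> int \<Rightarrow> int" where
  "kill n i = (\<lambda>a\<in>signed0 n. if \<bar>a\<bar> = int i then 0 else a)"

lemma kill_sharp: "kill n i \<in> sharp_hom W n n"
  by (rule sharp_homI) (auto simp: kill_def mem_signed split: if_splits)

lemma kill_kill: "compose (signed0 n) (kill n i) (kill n i) = kill n i"
  by (auto simp: mem_signed kill_def compose_def fun_eq_iff)

lemma kill_commute:
  "compose (signed0 n) (kill n i) (kill n j) = compose (signed0 n) (kill n j) (kill n i)"
  by (auto simp: mem_signed kill_def compose_def fun_eq_iff)

text \<open>The order-preserving inclusion of \<open>n\<close> into \<open>n + 1\<close> that avoids \<open>\<plusminus>i\<close>, followed by its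
  left inverse \<open>unskip\<close> in FI-sharp, which sends \<open>\<plusminus>i\<close> to \<open>0\<close>.\<close>

definition skip :: "nat \<Rightarrow> nat \<Rightarrow> int \<Rightarrow> int" where
  "skip n i = (\<lambda>a\<in>signed n. if \<bar>a\<bar> < int i then a else a + sgn a)"

definition unskip :: "nat \<Rightarrow> nat \<Rightarrow> int \<Rightarrow> int" where
  "unskip n i = (\<lambda>a\<in>signed0 (Suc n). if \<bar>a\<bar> < int i then a else if \<bar>a\<bar> = int i then 0 else a - sgn a)"

lemma skip_fi: "skip n i \<in> fi_hom W n (Suc n)"
  by (rule fi_homI) (auto simp: skip_def mem_signed sgn_if split: if_splits)

lemma unskip_sharp: "i \<in> {1..Suc n} \<Longrightarrow> unskip n i \<in> sharp_hom W (Suc n) n"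
  by (rule sharp_homI) (auto simp: unskip_def mem_signed sgn_if split: if_splits)

text \<open>This factorization is what makes inductions on \<open>n\<close> possible: the image of \<open>kill (Suc n) i\<close>
  in any FI-sharp-module is induced from degree \<open>n\<close>.\<close>

lemma kill_factor:
  "i \<in> {1..Suc n} \<Longrightarrow> kill (Suc n) i = compose (signed0 (Suc n)) (extend0 n (skip n i)) (unskip n i)"
  by (auto simp: mem_signed kill_def compose_def extend0_def skip_def unskip_def fun_eq_iff sgn_if)

text \<open>A map of FI-sharp is injective unless it sends some \<open>a \<noteq> 0\<close> to \<open>0\<close>; then it sends \<open>-a\<close> to
  \<open>0\<close> as well and is unchanged by killing \<open>\<plusminus>a\<close> beforehand.\<close>

lemma sharp_hom_cases:
  assumes f: "f \<in> sharp_hom W m n"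
  obtains (kill) i where "i \<in> {1..m}" "compose (signed0 m) f (kill m i) = f"
  | (inj) g where "g \<in> fi_hom W m n" "f = extend0 m g" "0 \<notin> f ` signed m"
proof (cases "\<exists>a. \<bar>a\<bar> \<le> int m \<and> a \<noteq> 0 \<and> f a = 0")
  case True
  then obtain a where a: "\<bar>a\<bar> \<le> int m" "a \<noteq> 0" "f a = 0" by blast
  have na: "f (- a) = 0" using a sharp_homD(3)[OF f a(1)] by simp
  have "f b = 0" if "\<bar>b\<bar> = \<bar>a\<bar>" for b
  proof -
    have "b = a \<or> b = - a" using that by linarith
    then show ?thesis using a(3) na by blast
  qed
  then have "compose (signed0 m) f (kill m (nat \<bar>a\<bar>)) = f"
    using sharp_homD(6)[OF f] extensional_arb[OF sharp_homD(1)[OF f]]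
    by (auto simp: kill_def compose_def fun_eq_iff)
  then show ?thesis using a by (intro kill[of "nat \<bar>a\<bar>"]) auto
next
  case False
  let ?g = "restrict f (signed m)"
  have nz: "f a \<noteq> 0" if "\<bar>a\<bar> \<le> int m" "a \<noteq> 0" for a using False that by blast
  have "?g \<in> fi_hom W m n"
  proof (rule fi_homI)
    fix a b :: int
    show "a = b" if "a \<noteq> 0" "b \<noteq> 0" "\<bar>a\<bar> \<le> int m" "\<bar>b\<bar> \<le> int m" "?g a = ?g b"
      using sharp_homD(4)[OF f that(3,4)] nz[OF that(3,1)] that by (simp add: mem_signed)
    show "0 < ?g a" if "W = TypeA" "\<bar>a\<bar> \<le> int m" "0 < a"
      using sharp_homD(5)[OF f that] nz[OF that(2)] that by (simp add: mem_signed)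
  qed (use nz sharp_homD(2,3)[OF f] in \<open>simp_all add: mem_signed\<close>)
  moreover have "f = extend0 m ?g"
    using sharp_homD(6)[OF f] extensional_arb[OF sharp_homD(1)[OF f]]
    by (auto simp: extend0_def fun_eq_iff mem_signed)
  ultimately show ?thesis using nz by (intro inj[of ?g]) (auto simp: mem_signed)
qed

text \<open>By counting, the image misses some element, and by symmetry it misses its negative too.\<close>

lemma fi_hom_not_surj:
  assumes g: "g \<in> fi_hom W m n" and "m < n"
  shows "\<exists>i\<in>{1..n}. compose (signed0 m) (kill n i) (extend0 m g) = extend0 m g"
proof -
  have "card (g ` signed m) = card (signed m)" using fi_homD(7)[OF g] by (rule card_image)
  then have "g ` signed m \<noteq> signed n" using \<open>m < n\<close> by (metis card_signed mult_cancel1 less_irrefl zero_neq_numeral)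
  then obtain b where b: "b \<in> signed n" "b \<notin> g ` signed m" using fi_homD(8)[OF g] by blast
  have ne: "\<bar>g a\<bar> \<noteq> \<bar>b\<bar>" if a: "a \<noteq> 0" "\<bar>a\<bar> \<le> int m" for a
  proof
    assume "\<bar>g a\<bar> = \<bar>b\<bar>"
    then have "b = g a \<or> b = - g a" by linarith
    then have "b = g a \<or> b = g (- a)" using fi_homD(4)[OF g a] by metis
    moreover have "a \<in> signed m" "- a \<in> signed m" using a by (simp_all add: mem_signed)
    ultimately show False using b(2) by blast
  qed
  show ?thesis
  proof (rule bexI[of _ "nat \<bar>b\<bar>"])
    show "compose (signed0 m) (kill n (nat \<bar>b\<bar>)) (extend0 m g) = extend0 m g"
      using ne b fi_homD(2,3)[OF g]
      by (auto simp: kill_def compose_def extend0_def fun_eq_iff mem_signed)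
  qed (use b in \<open>auto simp: mem_signed\<close>)
qed

section \<open>FI-sharp-modules and their primitive elements\<close>

lemma kmod_sel [simp]:
  "ob (kmod R) = {M. module R M}" "mor (kmod R) = lin_hom R"
  "idm (kmod R) = (\<lambda>M. \<lambda>x\<in>carrier M. x)"
  "cmp (kmod R) = (\<lambda>L M N g f. compose (carrier L) g f)"
  by (simp_all add: kmod_def)

lemma sharp_cat_sel [simp]:
  "ob (sharp_cat W) = UNIV" "mor (sharp_cat W) = sharp_hom W"
  "idm (sharp_cat W) = (\<lambda>n. \<lambda>a\<in>signed0 n. a)"
  "cmp (sharp_cat W) = (\<lambda>l m n g f. compose (signed0 l) g f)"
  by (simp_all add: sharp_cat_def)

locale sharp_mod =
  fixes R :: "('k, 'r) ring_scheme" and W :: weyl_type and V :: "('k, 'u) fi_functor"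
  assumes sharp: "sharp_module R W V"
begin

abbreviation "C n \<equiv> carrier (fobj V n)"

lemma mV: "module R (fobj V n)"
  using sharp by (simp add: sharp_module_def is_functor_def)

sublocale V: module R "fobj V n" for n by (rule mV)

lemma fmor_lin_hom: "f \<in> sharp_hom W m n \<Longrightarrow> fmor V m n f \<in> lin_hom R (fobj V m) (fobj V n)"
  using sharp by (simp add: sharp_module_def is_functor_def)

lemma fmor_linear: "f \<in> sharp_hom W m n \<Longrightarrow> linear_map R (fobj V m) (fobj V n) (fmor V m n f)"
  using fmor_lin_hom by (simp add: lin_hom_iff)

lemma fmor_closed: "f \<in> sharp_hom W m n \<Longrightarrow> x \<in> C m \<Longrightarrow> fmor V m n f x \<in> C n"
  using linear_mapD(1)[OF fmor_linear] .

lemma fmor_id: "x \<in> C n \<Longrightarrow> fmor V n n (\<lambda>a\<in>signed0 n. a) x = x"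
  using sharp by (simp add: sharp_module_def is_functor_def)

lemma fmor_compose:
  assumes "f \<in> sharp_hom W l m" "g \<in> sharp_hom W m n" "x \<in> C l"
  shows "fmor V m n g (fmor V l m f x) = fmor V l n (compose (signed0 l) g f) x"
proof -
  have "fmor V l n (compose (signed0 l) g f) = compose (C l) (fmor V m n g) (fmor V l m f)"
    using sharp assms by (simp add: sharp_module_def is_functor_def)
  then show ?thesis using assms by (simp add: compose_eq)
qed

lemma fmor_zero: "f \<in> sharp_hom W m n \<Longrightarrow> fmor V m n f \<zero>\<^bsub>fobj V m\<^esub> = \<zero>\<^bsub>fobj V n\<^esub>"
  by (rule linear_map_zero[OF fmor_linear mV mV])

text \<open>The idempotents \<open>e n i\<close> of the introduction, the primitive elements, and the partial products
  \<open>q n i = (1 - e\<^sub>i) \<cdots> (1 - e\<^sub>1)\<close> of the projector \<open>p n\<close>.\<close>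

definition e :: "nat \<Rightarrow> nat \<Rightarrow> 'u \<Rightarrow> 'u" where
  "e n i = fmor V n n (kill n i)"

definition prim :: "nat \<Rightarrow> 'u set" where
  "prim n = {v \<in> C n. \<forall>i\<in>{1..n}. e n i v = \<zero>\<^bsub>fobj V n\<^esub>}"

primrec q :: "nat \<Rightarrow> nat \<Rightarrow> 'u \<Rightarrow> 'u" where
  "q n 0 v = v"
| "q n (Suc i) v = q n i v \<ominus>\<^bsub>fobj V n\<^esub> e n (Suc i) (q n i v)"

abbreviation "p n \<equiv> q n n"

lemma e_linear: "linear_map R (fobj V n) (fobj V n) (e n i)"
  unfolding e_def by (rule fmor_linear[OF kill_sharp])

lemma e_closed [simp]: "v \<in> C n \<Longrightarrow> e n i v \<in> C n"
  using linear_mapD(1)[OF e_linear] .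

lemma e_zero [simp]: "e n i \<zero>\<^bsub>fobj V n\<^esub> = \<zero>\<^bsub>fobj V n\<^esub>"
  by (rule linear_map_zero[OF e_linear mV mV])

lemma e_diff: "v \<in> C n \<Longrightarrow> w \<in> C n \<Longrightarrow> e n i (v \<ominus>\<^bsub>fobj V n\<^esub> w) = e n i v \<ominus>\<^bsub>fobj V n\<^esub> e n i w"
  by (rule linear_map_diff[OF e_linear mV mV])

lemma e_e: "v \<in> C n \<Longrightarrow> e n i (e n i v) = e n i v"
  unfolding e_def by (simp add: fmor_compose kill_sharp kill_kill)

lemma e_commute: "v \<in> C n \<Longrightarrow> e n i (e n j v) = e n j (e n i v)"
  unfolding e_def by (simp add: fmor_compose kill_sharp kill_commute[of n i j])

lemma q_linear: "linear_map R (fobj V n) (fobj V n) (q n i)"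
proof (induction i)
  case (Suc i)
  note D = linear_mapD[OF Suc] linear_mapD[OF e_linear]
  show ?case
  proof
    fix x y assume "x \<in> C n" "y \<in> C n"
    then show "q n (Suc i) (x \<oplus>\<^bsub>fobj V n\<^esub> y) = q n (Suc i) x \<oplus>\<^bsub>fobj V n\<^esub> q n (Suc i) y"
      by (simp add: D a_minus_def V.M.minus_add V.M.a_ac)
  next
    fix c x assume "c \<in> carrier R" "x \<in> C n"
    then show "q n (Suc i) (c \<odot>\<^bsub>fobj V n\<^esub> x) = c \<odot>\<^bsub>fobj V n\<^esub> q n (Suc i) x"
      by (simp add: D a_minus_def V.smult_r_distr V.smult_r_minus)
  qed (simp add: D)
qed (simp add: linear_map_id)

lemma q_closed [simp]: "v \<in> C n \<Longrightarrow> q n i v \<in> C n"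
  using linear_mapD(1)[OF q_linear] .

lemma e_q_commute: "v \<in> C n \<Longrightarrow> e n j (q n i v) = q n i (e n j v)"
proof (induction i)
  case (Suc i)
  then show ?case by (simp add: e_diff) (metis e_commute q_closed)
qed simp

text \<open>The idempotents commute and \<open>e\<^sub>j (1 - e\<^sub>j) = 0\<close>.\<close>

lemma e_q_zero:
  assumes "v \<in> C n" "1 \<le> j" "j \<le> i" shows "e n j (q n i v) = \<zero>\<^bsub>fobj V n\<^esub>"
  using assms(3)
proof (induction i)
  case (Suc i)
  have *: "\<zero>\<^bsub>fobj V n\<^esub> \<ominus>\<^bsub>fobj V n\<^esub> \<zero>\<^bsub>fobj V n\<^esub> = \<zero>\<^bsub>fobj V n\<^esub>"
    by (simp add: V.M.diff_eq_zero_iff)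
  show ?case
  proof (cases "j = Suc i")
    case True
    then show ?thesis using assms by (simp add: e_diff e_e V.M.diff_eq_zero_iff)
  next
    case False
    then have "e n j (q n i v) = \<zero>\<^bsub>fobj V n\<^esub>" using Suc by simp
    then show ?thesis using assms e_commute[of "q n i v" n j "Suc i"] by (simp add: e_diff *)
  qed
qed (use assms(2) in simp)

lemma prim_closed: "v \<in> prim n \<Longrightarrow> v \<in> C n" by (simp add: prim_def)

lemma p_in_prim: "v \<in> C n \<Longrightarrow> p n v \<in> prim n"
  by (auto simp: prim_def e_q_zero)

lemma p_prim: "v \<in> prim n \<Longrightarrow> p n v = v"
proof -
  assume v: "v \<in> prim n"
  have "q n i v = v" if "i \<le> n" for i
    using that
  proof (induction i)
    case (Suc i)
    then have "q n i v = v" "e n (Suc i) v = \<zero>\<^bsub>fobj V n\<^esub>" using v by (auto simp: prim_def)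
    then show ?case using v by (simp add: V.M.diff_zero prim_closed)
  qed simp
  then show ?thesis by simp
qed

text \<open>The injection misses some \<open>\<plusminus>i\<close>, so its image is fixed by \<open>e n i\<close>, and \<open>p n\<close> contains the
  factor \<open>1 - e n i\<close>.\<close>

lemma p_induced_zero:
  assumes "g \<in> fi_hom W m n" "m < n" "x \<in> C m"
  shows "p n (fmor V m n (extend0 m g) x) = \<zero>\<^bsub>fobj V n\<^esub>"
proof -
  obtain i where i: "i \<in> {1..n}" "compose (signed0 m) (kill n i) (extend0 m g) = extend0 m g"
    using fi_hom_not_surj[OF assms(1,2)] by blast
  let ?y = "fmor V m n (extend0 m g) x"
  have y: "?y \<in> C n" by (rule fmor_closed[OF extend0_sharp[OF assms(1)] assms(3)])
  have "?y = e n i ?y"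
    unfolding e_def using fmor_compose[OF extend0_sharp[OF assms(1)] kill_sharp assms(3)] i(2) by metis
  then show ?thesis using e_q_zero[OF y, of i n] e_q_commute[OF y, of i n] i(1) by simp
qed

lemma prim_killed:
  assumes "u \<in> prim m" "f \<in> sharp_hom W m n" "i \<in> {1..m}" "compose (signed0 m) f (kill m i) = f"
  shows "fmor V m n f u = \<zero>\<^bsub>fobj V n\<^esub>"
proof -
  have "fmor V m n f u = fmor V m n f (e m i u)"
    unfolding e_def using assms by (simp add: fmor_compose kill_sharp prim_closed)
  also have "\<dots> = \<zero>\<^bsub>fobj V n\<^esub>" using assms by (simp add: prim_def fmor_zero)
  finally show ?thesis .
qed

lemma e_factor:
  assumes "i \<in> {1..n}" "v \<in> C n"
  obtains m where "n = Suc m"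
    "e n i v = fmor V m n (extend0 m (skip m i)) (fmor V n m (unskip m i) v)"
proof -
  obtain m where m: "n = Suc m" using assms(1) by (cases n) auto
  then have "e n i v = fmor V m n (extend0 m (skip m i)) (fmor V n m (unskip m i) v)"
    unfolding e_def using assms
    by (subst fmor_compose) (auto intro!: unskip_sharp extend0_sharp skip_fi simp: kill_factor)
  then show thesis using m that by blast
qed

text \<open>Expanding the product \<open>p n\<close> one factor at a time changes \<open>v\<close> by an element in the image of some
  \<open>e n i\<close> at each step.\<close>

lemma decompose:
  assumes "submodule N R (fobj V n)" "v \<in> C n" "\<And>i y. i \<in> {1..n} \<Longrightarrow> y \<in> C n \<Longrightarrow> e n i y \<in> N"
  shows "v \<ominus>\<^bsub>fobj V n\<^esub> p n v \<in> N"
proof -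
  note N = V.submoduleE[OF assms(1)]
  have "v \<ominus>\<^bsub>fobj V n\<^esub> q n i v \<in> N" if "i \<le> n" for i
    using that
  proof (induction i)
    case 0
    have "v \<ominus>\<^bsub>fobj V n\<^esub> v = \<zero>\<^bsub>fobj V n\<^esub>" using assms by (simp add: V.M.diff_eq_zero_iff)
    then show ?case using subgroup.one_closed[OF submodule.axioms(1)[OF assms(1)]] by simp
  next
    case (Suc i)
    have "v \<ominus>\<^bsub>fobj V n\<^esub> q n (Suc i) v = (v \<ominus>\<^bsub>fobj V n\<^esub> q n i v) \<oplus>\<^bsub>fobj V n\<^esub> e n (Suc i) (q n i v)"
      using assms(2) by (simp add: a_minus_def V.M.minus_add V.M.a_ac V.M.minus_minus)
    moreover have "e n (Suc i) (q n i v) \<in> N" using Suc assms by simp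
    ultimately show ?case using Suc N(5) by simp
  qed
  then show ?thesis by simp
qed

text \<open>Induction on \<open>n\<close>: the hypothesis passes to the elements \<open>(unskip m i)\<^sub>* v\<close> in degree
  \<open>n - 1\<close>, which therefore vanish.  Hence every \<open>e n i v\<close> vanishes, so \<open>v\<close> is primitive and equals
  its own projection \<open>p n v = 0\<close>.\<close>

lemma zero_if_projections_zero:
  assumes "v \<in> C n" "\<And>m f. m \<le> n \<Longrightarrow> f \<in> sharp_hom W n m \<Longrightarrow> p m (fmor V n m f v) = \<zero>\<^bsub>fobj V m\<^esub>"
  shows "v = \<zero>\<^bsub>fobj V n\<^esub>"
  using assms
proof (induction n arbitrary: v rule: less_induct)
  case (less n)
  have "v \<in> prim n"
    unfolding prim_def
  proof (intro CollectI conjI ballI)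
    fix i assume i: "i \<in> {1..n}"
    from e_factor[OF i less.prems(1)] obtain m where m: "n = Suc m"
      "e n i v = fmor V m n (extend0 m (skip m i)) (fmor V n m (unskip m i) v)" .
    have us: "unskip m i \<in> sharp_hom W n m" using i m by (auto intro: unskip_sharp)
    have "fmor V n m (unskip m i) v = \<zero>\<^bsub>fobj V m\<^esub>"
    proof (rule less.IH)
      fix l f assume "l \<le> m" "f \<in> sharp_hom W m l"
      then show "p l (fmor V m l f (fmor V n m (unskip m i) v)) = \<zero>\<^bsub>fobj V l\<^esub>"
        using less.prems us sharp_hom_compose[OF us] m(1)
        by (subst fmor_compose[OF us]) auto
    qed (use m us less.prems in \<open>auto intro: fmor_closed\<close>)
    then show "e n i v = \<zero>\<^bsub>fobj V n\<^esub>"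
      using m extend0_sharp[OF skip_fi] by (simp add: fmor_zero)
  qed (fact less.prems)
  then have "p n v = v" by (rule p_prim)
  moreover have "p n (fmor V n n (\<lambda>a\<in>signed0 n. a) v) = \<zero>\<^bsub>fobj V n\<^esub>"
    by (rule less.prems(2)[OF order_refl sharp_hom_id])
  ultimately show ?case using less.prems by (simp add: fmor_id)
qed

text \<open>After a bijection \<open>w\<close>, killing \<open>\<plusminus>i\<close> is still a non-injective map.\<close>

lemma fmor_prim:
  assumes "u \<in> prim n" "w \<in> fi_hom W n n"
  shows "fmor V n n (extend0 n w) u \<in> prim n"
proof -
  have w: "extend0 n w \<in> sharp_hom W n n" by (rule extend0_sharp[OF assms(2)])
  have "e n i (fmor V n n (extend0 n w) u) = \<zero>\<^bsub>fobj V n\<^esub>" if "i \<in> {1..n}" for i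
  proof -
    let ?f = "compose (signed0 n) (kill n i) (extend0 n w)"
    have f: "?f \<in> sharp_hom W n n" by (rule sharp_hom_compose[OF w kill_sharp])
    have eq: "e n i (fmor V n n (extend0 n w) u) = fmor V n n ?f u"
      unfolding e_def by (rule fmor_compose[OF w kill_sharp prim_closed[OF assms(1)]])
    from f show ?thesis
    proof (cases rule: sharp_hom_cases)
      case (kill j)
      then show ?thesis using prim_killed[OF assms(1) f] eq by simp
    next
      case (inj g)
      have "w ` signed n = signed n"
        using assms(2) endo_inj_surj[of "signed n" w] by (auto simp: fi_hom_def)
      moreover have "int i \<in> signed n" using that by (auto simp: mem_signed)
      ultimately obtain a where "a \<in> signed n" "w a = int i" by (metis imageE)
      then have "?f a = 0" using that by (auto simp: mem_signed compose_def extend0_def kill_def)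
      then show ?thesis using inj(3) \<open>a \<in> signed n\<close> by force
    qed
  qed
  then show ?thesis using fmor_closed[OF w prim_closed[OF assms(1)]] by (simp add: prim_def)
qed

end

definition sharp_morphism :: "('k, 'r) ring_scheme \<Rightarrow> weyl_type \<Rightarrow> ('k, 'u) fi_functor \<Rightarrow>
    ('k, 'v) fi_functor \<Rightarrow> (nat \<Rightarrow> 'u \<Rightarrow> 'v) \<Rightarrow> bool" where
  "sharp_morphism R W V V' \<eta> \<longleftrightarrow> (\<forall>n. linear_map R (fobj V n) (fobj V' n) (\<eta> n)) \<and>
     (\<forall>m n. \<forall>f \<in> sharp_hom W m n. \<forall>x \<in> carrier (fobj V m).
        \<eta> n (fmor V m n f x) = fmor V' m n f (\<eta> m x))"

text \<open>Morphisms of FI-sharp-modules between possibly different universes, which is how \<open>M(U)\<close> and \<open>V\<close>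
  are compared before any relabelling.\<close>

locale sharp_mor = A: sharp_mod R W V + B: sharp_mod R W V'
  for R :: "('k, 'r) ring_scheme" and W :: weyl_type and V :: "('k, 'u) fi_functor"
    and V' :: "('k, 'v) fi_functor" +
  fixes \<eta> :: "nat \<Rightarrow> 'u \<Rightarrow> 'v"
  assumes mor: "sharp_morphism R W V V' \<eta>"
begin

lemma linear: "linear_map R (fobj V n) (fobj V' n) (\<eta> n)"
  using mor by (simp add: sharp_morphism_def)

lemma natural: "f \<in> sharp_hom W m n \<Longrightarrow> x \<in> A.C m \<Longrightarrow> \<eta> n (fmor V m n f x) = fmor V' m n f (\<eta> m x)"
  using mor by (simp add: sharp_morphism_def)

lemma closed: "x \<in> A.C n \<Longrightarrow> \<eta> n x \<in> B.C n"
  by (rule linear_mapD(1)[OF linear])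

lemma zero: "\<eta> n \<zero>\<^bsub>fobj V n\<^esub> = \<zero>\<^bsub>fobj V' n\<^esub>"
  by (rule linear_map_zero[OF linear A.mV B.mV])

lemma mor_e: "x \<in> A.C n \<Longrightarrow> \<eta> n (A.e n i x) = B.e n i (\<eta> n x)"
  unfolding A.e_def B.e_def by (rule natural[OF kill_sharp])

lemma mor_q: "x \<in> A.C n \<Longrightarrow> \<eta> n (A.q n i x) = B.q n i (\<eta> n x)"
  by (induction i) (simp_all add: linear_map_diff[OF linear A.mV B.mV] mor_e)

text \<open>If \<open>\<eta> x = 0\<close>, then \<open>\<eta>\<close> also kills all elements \<open>p (f\<^sub>* x)\<close>; these are primitive, hence zero.\<close>

lemma kernel_trivial:
  assumes "\<And>n u. u \<in> A.prim n \<Longrightarrow> \<eta> n u = \<zero>\<^bsub>fobj V' n\<^esub> \<Longrightarrow> u = \<zero>\<^bsub>fobj V n\<^esub>"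
    and "x \<in> A.C n" "\<eta> n x = \<zero>\<^bsub>fobj V' n\<^esub>"
  shows "x = \<zero>\<^bsub>fobj V n\<^esub>"
proof (rule A.zero_if_projections_zero[OF assms(2)])
  fix m f assume f: "f \<in> sharp_hom W n m"
  have y: "fmor V n m f x \<in> A.C m" by (rule A.fmor_closed[OF f assms(2)])
  show "A.p m (fmor V n m f x) = \<zero>\<^bsub>fobj V m\<^esub>"
    by (rule assms(1)[OF A.p_in_prim[OF y]])
      (simp add: mor_q y natural[OF f] assms(2,3) B.fmor_zero[OF f] linear_map_zero[OF B.q_linear B.mV B.mV])
qed

text \<open>By induction, all elements induced from lower degrees are in the image, and so are the primitive
  ones; together they generate.\<close>

lemma surjective:
  assumes "\<And>n. B.prim n \<subseteq> \<eta> n ` A.C n"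
  shows "B.C n \<subseteq> \<eta> n ` A.C n"
proof (induction n rule: less_induct)
  case (less n)
  have sub: "submodule (\<eta> n ` A.C n) R (fobj V' n)"
  proof (rule B.V.submoduleI)
    fix y y' assume "y \<in> \<eta> n ` A.C n" "y' \<in> \<eta> n ` A.C n"
    then obtain x x' where x: "x \<in> A.C n" "x' \<in> A.C n" "y = \<eta> n x" "y' = \<eta> n x'" by blast
    show "\<ominus>\<^bsub>fobj V' n\<^esub> y \<in> \<eta> n ` A.C n"
      by (rule image_eqI[of _ _ "\<ominus>\<^bsub>fobj V n\<^esub> x"])
        (simp_all add: x linear_map_minus[OF linear A.mV B.mV])
    show "y \<oplus>\<^bsub>fobj V' n\<^esub> y' \<in> \<eta> n ` A.C n"
      by (rule image_eqI[of _ _ "x \<oplus>\<^bsub>fobj V n\<^esub> x'"]) (simp_all add: x linear_mapD[OF linear])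
    fix c assume "c \<in> carrier R"
    then show "c \<odot>\<^bsub>fobj V' n\<^esub> y \<in> \<eta> n ` A.C n"
      by (intro image_eqI[of _ _ "c \<odot>\<^bsub>fobj V n\<^esub> x"]) (simp_all add: x linear_mapD[OF linear])
  qed (use closed zero[of n] A.V.M.zero_closed[of n] in \<open>auto simp: image_iff intro: sym\<close>)
  show ?case
  proof
    fix v assume v: "v \<in> B.C n"
    have "v \<ominus>\<^bsub>fobj V' n\<^esub> B.p n v \<in> \<eta> n ` A.C n"
    proof (rule B.decompose[OF sub v])
      fix i y assume i: "i \<in> {1..n}" and y: "y \<in> B.C n"
      from B.e_factor[OF i y] obtain m where m: "n = Suc m"
        "B.e n i y = fmor V' m n (extend0 m (skip m i)) (fmor V' n m (unskip m i) y)" .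
      have "fmor V' n m (unskip m i) y \<in> B.C m"
        using i m y by (auto intro!: B.fmor_closed[OF unskip_sharp])
      then obtain x where x: "x \<in> A.C m" "fmor V' n m (unskip m i) y = \<eta> m x"
        using less[of m] m by auto
      have s: "extend0 m (skip m i) \<in> sharp_hom W m n" using m by (auto intro: extend0_sharp skip_fi)
      show "B.e n i y \<in> \<eta> n ` A.C n"
        using x(2) m(2) natural[OF s x(1)] A.fmor_closed[OF s x(1)] by (metis image_eqI)
    qed
    moreover have "B.p n v \<in> \<eta> n ` A.C n" using assms B.p_in_prim[OF v] by auto
    moreover have "v = (v \<ominus>\<^bsub>fobj V' n\<^esub> B.p n v) \<oplus>\<^bsub>fobj V' n\<^esub> B.p n v"
      using v by (simp add: a_minus_def B.V.M.a_ac B.V.M.r_neg)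
    ultimately show "v \<in> \<eta> n ` A.C n"
      using B.V.submoduleE(5)[OF sub] by metis
  qed
qed

text \<open>The detection principle: isomorphisms are recognised on primitive elements.\<close>

lemma bij_betw_if_bij_on_prim:
  assumes "\<And>n. bij_betw (\<eta> n) (A.prim n) (B.prim n)"
  shows "bij_betw (\<eta> n) (A.C n) (B.C n)"
proof -
  have z: "\<zero>\<^bsub>fobj V n\<^esub> \<in> A.prim n" for n by (simp add: A.prim_def)
  have inj: "x = \<zero>\<^bsub>fobj V n\<^esub>" if "x \<in> A.C n" "\<eta> n x = \<zero>\<^bsub>fobj V' n\<^esub>" for x n
  proof (rule kernel_trivial[OF _ that])
    fix n u assume "u \<in> A.prim n" "\<eta> n u = \<zero>\<^bsub>fobj V' n\<^esub>"
    then show "u = \<zero>\<^bsub>fobj V n\<^esub>"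
      using assms[of n] z[of n] zero[of n] by (auto simp: bij_betw_def inj_on_def)
  qed
  have "inj_on (\<eta> n) (A.C n)"
  proof (rule inj_onI)
    fix x y assume xy: "x \<in> A.C n" "y \<in> A.C n" "\<eta> n x = \<eta> n y"
    then have "\<eta> n (x \<ominus>\<^bsub>fobj V n\<^esub> y) = \<zero>\<^bsub>fobj V' n\<^esub>"
      by (simp add: linear_map_diff[OF linear A.mV B.mV] B.V.M.diff_eq_zero_iff closed)
    then show "x = y" using xy inj[of "x \<ominus>\<^bsub>fobj V n\<^esub> y" n] by (simp add: A.V.M.diff_eq_zero_iff)
  qed
  moreover have "B.prim n \<subseteq> \<eta> n ` A.C n" for n
    using assms[of n] A.prim_closed by (force simp: bij_betw_def)
  then have "B.C n \<subseteq> \<eta> n ` A.C n" by (rule surjective)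
  ultimately show ?thesis using closed by (auto simp: bij_betw_def)
qed

end

section \<open>Generators of the induced modules\<close>

lemma linear_map_add:
  assumes "module R M" "module R N" "linear_map R M N h" "linear_map R M N h'"
  shows "linear_map R M N (\<lambda>x. h x \<oplus>\<^bsub>N\<^esub> h' x)"
proof -
  interpret N: module R N by fact
  show ?thesis
    by rule (simp_all add: linear_mapD[OF assms(3)] linear_mapD[OF assms(4)] N.M.a_ac N.smult_r_distr)
qed

lemma linear_map_smult:
  assumes "module R M" "module R N" "linear_map R M N h" "c \<in> carrier R"
  shows "linear_map R M N (\<lambda>x. c \<odot>\<^bsub>N\<^esub> h x)"
proof -
  interpret N: module R N by fact
  show ?thesis
    by rule (simp_all add: linear_mapD[OF assms(3)] N.smult_r_distr assms(4)
        N.smult_assoc1[symmetric] N.R.m_comm)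
qed

lemma linear_map_const_zero:
  assumes "module R M" "module R N"
  shows "linear_map R M N (\<lambda>x. \<zero>\<^bsub>N\<^esub>)"
proof -
  interpret N: module R N by fact
  show ?thesis by rule simp_all
qed

lemma lin_hom_eqI:
  "f \<in> lin_hom R M N \<Longrightarrow> g \<in> lin_hom R M N \<Longrightarrow> (\<And>x. x \<in> carrier M \<Longrightarrow> f x = g x) \<Longrightarrow> f = g"
  by (rule extensionalityI[of f "carrier M" g]) (auto simp: lin_hom_iff)

text \<open>This is the case in which a morphism of FI-sharp acts on a basis element \<open>e\<^sub>s\<close> of \<open>M(a)\<close> without
  killing it.\<close>

lemma sharp_fi_compose:
  assumes f: "f \<in> sharp_hom W m n" and s: "s \<in> fi_hom W a m" and nz: "0 \<notin> f ` s ` signed a"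
  shows "compose (signed a) f s \<in> fi_hom W a n"
proof (rule fi_homI)
  note [simp] = compose_def mem_signed fi_homD(2,3,4)[OF s] sharp_homD(2,3)[OF f]
  fix x y :: int
  show nz': "compose (signed a) f s x \<noteq> 0" if "x \<noteq> 0" "\<bar>x\<bar> \<le> int a" for x
  proof -
    have "f (s x) \<in> f ` s ` signed a" using that by (auto simp: mem_signed)
    then show ?thesis using nz that by auto
  qed
  show "x = y" if "x \<noteq> 0" "y \<noteq> 0" "\<bar>x\<bar> \<le> int a" "\<bar>y\<bar> \<le> int a"
    "compose (signed a) f s x = compose (signed a) f s y"
    using fi_homD(5)[OF s, of x y] sharp_homD(4)[OF f, of "s x" "s y"] nz'[of x] that by simp
  show "0 < compose (signed a) f s x" if "W = TypeA" "\<bar>x\<bar> \<le> int a" "0 < x"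
    using fi_homD(6)[OF s that] sharp_homD(5)[OF f that(1), of "s x"] fi_homD(3)[OF s, of x]
      nz'[of x] that by simp
qed (simp_all add: compose_def mem_signed fi_homD(2,3,4)[OF s] sharp_homD(2,3)[OF f])

locale fb_mod =
  fixes R :: "('k, 'r) ring_scheme" and W :: weyl_type and U :: "('k, 'u) fb_module"
  assumes cr: "cring R" and fb: "fb_module R W U"
begin

sublocale K: cring R by (rule cr)

abbreviation "H a n \<equiv> fi_hom W a n"
abbreviation "X a n \<equiv> free_module R (fi_hom W a n)"
abbreviation "\<rho> a n \<equiv> M_right_action R W a n"

lemma repU: "representation R (weyl_group W a) (U a)"
  using fb by (simp add: fb_module_def)

lemma mU: "module R (U a)"
  using repU[of a] by (simp add: representation_def)

lemma act_linear: "w \<in> H a a \<Longrightarrow> linear_map R (U a) (U a) (act (U a) w)"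
  using repU[of a] by (simp add: representation_def weyl_group_carrier lin_hom_iff)

lemma act_id: "u \<in> carrier (U a) \<Longrightarrow> act (U a) (\<lambda>x\<in>signed a. x) u = u"
  using repU[of a] by (simp add: representation_def)

lemma act_compose: "v \<in> H a a \<Longrightarrow> w \<in> H a a \<Longrightarrow> u \<in> carrier (U a) \<Longrightarrow>
    act (U a) (compose (signed a) v w) u = act (U a) v (act (U a) w u)"
  using repU[of a] by (simp add: representation_def weyl_group_carrier)

lemma mX: "module R (X a n)" by (rule K.module_free_module)

lemma action_basis:
  assumes "w \<in> H a a" "s \<in> H a n"
  shows "\<rho> a n w (basis_elt R s) = basis_elt R (compose (signed a) s w)"
  unfolding M_right_action_def
  by (rule K.lin_ext_basis_elt[OF mX _ assms(2)])
    (use assms in \<open>auto intro!: K.basis_elt_closed fi_hom_compose\<close>)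

lemma action_linear: "w \<in> H a a \<Longrightarrow> linear_map R (X a n) (X a n) (\<rho> a n w)"
  using K.lin_ext_lin_hom[OF mX[of a n], of "H a n" "\<lambda>s. basis_elt R (compose (signed a) s w)"]
  unfolding M_right_action_def lin_hom_iff by (auto intro!: K.basis_elt_closed fi_hom_compose)

sublocale TP: tensor_product R "weyl_group W a" "X a n" "\<rho> a n" "U a" for a n
  by (rule tensor_product.intro[OF mX repU])
    (auto simp: weyl_group_carrier intro: linear_mapD(1)[OF action_linear])

lemma TP_axioms: "tensor_product R (weyl_group W a) (X a n) (\<rho> a n) (U a)"
  by (rule TP.tensor_product_axioms)

abbreviation "T n a \<equiv> fobj (M_rep R W a (U a)) n"

lemma T_eq: "T n a = tensor R (weyl_group W a) (X a n) (\<rho> a n) (U a)"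
  by (simp add: M_rep_def M_prin_def)

lemma T_family: "module_family R (T n)"
  by (rule module_family.intro) (simp add: T_eq TP.module_tensor)

sublocale TF: module_family R "T n" for n by (rule T_family)

abbreviation "M n \<equiv> fobj (M_seq R W U) n"

lemma M_eq: "M n = direct_sum (T n)"
  by (simp add: M_seq_def fi_direct_sum_def)

lemma module_M: "module R (M n)"
  unfolding M_eq by (rule TF.module_direct_sum)

text \<open>The generator of \<open>M(U)\<^sub>n\<close> given by the class of \<open>e\<^sub>s \<otimes> u\<close>, with \<open>s\<close> an injection from
  \<open>a\<close> to \<open>n\<close> and \<open>u \<in> U\<^sub>a\<close>.  From here on, \<open>M(U)\<close> is handled only through these elements.\<close>

definition gen :: "nat \<Rightarrow> nat \<Rightarrow> (int \<Rightarrow> int) \<Rightarrow> 'u \<Rightarrow> nat \<Rightarrow> ('k, 'u) induced" where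
  "gen n a s u = summand_inj (T n) a (TP.tau a n (basis_elt R s) u)"

lemma gen_linear: "s \<in> H a n \<Longrightarrow> linear_map R (U a) (M n) (gen n a s)"
proof -
  assume s: "s \<in> H a n"
  have "linear_map R (U a) (T n a) (TP.tau a n (basis_elt R s))"
    unfolding T_eq using TP.tau_balanced[of a n] K.basis_elt_closed[OF s]
    by (simp add: balanced_map_def)
  from linear_map_comp[OF this TF.linear_summand_inj] show ?thesis
    by (simp add: M_eq gen_def[abs_def])
qed

lemma gen_closed: "s \<in> H a n \<Longrightarrow> u \<in> carrier (U a) \<Longrightarrow> gen n a s u \<in> carrier (M n)"
  using linear_mapD(1)[OF gen_linear] .

lemma gen_balanced:
  assumes "s \<in> H a n" "w \<in> H a a" "u \<in> carrier (U a)"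
  shows "gen n a (compose (signed a) s w) u = gen n a s (act (U a) w u)"
proof -
  have "TP.tau a n (\<rho> a n w (basis_elt R s)) u = TP.tau a n (basis_elt R s) (act (U a) w u)"
    using TP.tau_balanced[of a n] K.basis_elt_closed[OF assms(1)] assms
    unfolding balanced_map_def weyl_group_carrier by blast
  then show ?thesis by (simp add: gen_def action_basis[OF assms(2,1)])
qed

text \<open>The direct sum, the tensor products and the free modules are generated additively in turn; a
  coefficient of a basis element of \<open>M(a)\<^sub>n\<close> can be moved to the factor in \<open>U\<^sub>a\<close>.\<close>

lemma gen_induct [consumes 1, case_names zero add gen]:
  assumes x: "x \<in> carrier (M n)"
    and zero: "P \<zero>\<^bsub>M n\<^esub>"
    and add: "\<And>x y. x \<in> carrier (M n) \<Longrightarrow> y \<in> carrier (M n) \<Longrightarrow> P x \<Longrightarrow> P y \<Longrightarrow> P (x \<oplus>\<^bsub>M n\<^esub> y)"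
    and gen: "\<And>a s u. s \<in> H a n \<Longrightarrow> u \<in> carrier (U a) \<Longrightarrow> P (gen n a s u)"
  shows "P x"
  using x unfolding M_eq
proof (induction rule: TF.direct_sum_induct)
  case zero
  then show ?case using assms(2) by (simp add: M_eq)
next
  case (add x y)
  then show ?case using assms(3)[of x y] by (simp add: M_eq)
next
  case (inj a y)
  have I: "linear_map R (T n a) (M n) (summand_inj (T n) a)"
    unfolding M_eq by (rule TF.linear_summand_inj)
  note I0 = linear_map_zero[OF I TF.mM module_M]
  note I' = linear_mapD[OF I]
  from inj have "y \<in> carrier (TP.T a n)" unfolding T_eq .
  then show ?case
  proof (induction rule: TP.tensor_induct)
    case zero
    show ?case using I0 assms(2) by (simp add: T_eq[symmetric])
  next
    case (add y z)
    then show ?case using I'(1,2)[of y] I'(1)[of z] assms(3) by (simp add: T_eq[symmetric])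
  next
    case (tau c u)
    note B = TP.tau_balanced[of a n, unfolded balanced_map_def]
    have L: "linear_map R (X a n) (T n a) (\<lambda>c. TP.tau a n c u)" using B tau(2) by (simp add: T_eq)
    note L0 = linear_map_zero[OF L mX TF.mM] and L' = linear_mapD[OF L]
    from tau(1) show ?case
    proof (induction rule: K.free_module_induct)
      case zero
      show ?case using L0 I0 assms(2) by simp
    next
      case (add c d)
      then show ?case using assms(3) by (simp add: L' I' del: free_module_sel)
    next
      case (basis r s)
      then have "TP.tau a n (r \<odot>\<^bsub>X a n\<^esub> basis_elt R s) u = TP.tau a n (basis_elt R s) (r \<odot>\<^bsub>U a\<^esub> u)"
        using B tau(2) K.basis_elt_closed[of s "H a n"] by (simp add: linear_map_def)
      then show ?case using gen[of s a "r \<odot>\<^bsub>U a\<^esub> u"] basis tau(2) by (simp add: gen_def)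
    qed
  qed
qed

lemma gen_eqI:
  assumes "module R N" "linear_map R (M n) N h" "linear_map R (M n) N h'"
    "\<And>a s u. s \<in> H a n \<Longrightarrow> u \<in> carrier (U a) \<Longrightarrow> h (gen n a s u) = h' (gen n a s u)"
    "x \<in> carrier (M n)"
  shows "h x = h' x"
  using assms(5)
proof (induction rule: gen_induct)
  case zero
  show ?case
    by (simp add: linear_map_zero[OF assms(2) module_M assms(1)] linear_map_zero[OF assms(3) module_M assms(1)])
next
  case (add x y)
  then show ?case by (simp add: linear_mapD[OF assms(2)] linear_mapD[OF assms(3)])
qed (fact assms(4))

text \<open>The universal property of \<open>M(U)\<^sub>n\<close> as a \<open>k\<close>-module.\<close>

lemma gen_lift:
  fixes N :: "('k, 'v, 'y) module_scheme"
  assumes N: "module R N"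
    and lin: "\<And>a s. s \<in> H a n \<Longrightarrow> linear_map R (U a) N (\<phi> a s)"
    and bal: "\<And>a s w u. s \<in> H a n \<Longrightarrow> w \<in> H a a \<Longrightarrow> u \<in> carrier (U a) \<Longrightarrow>
      \<phi> a (compose (signed a) s w) u = \<phi> a s (act (U a) w u)"
  shows "\<exists>h. linear_map R (M n) N h \<and> (\<forall>a. \<forall>s\<in>H a n. \<forall>u\<in>carrier (U a). h (gen n a s u) = \<phi> a s u)"
proof -
  interpret N: module R N by fact
  \<comment> \<open>For fixed \<open>u\<close>, extend linearly in the first factor; the laws of a balanced map in \<open>u\<close> then hold because they hold for basis elements.\<close>
  define \<psi> where "\<psi> a c u = lin_ext R (H a n) N (\<lambda>s. \<phi> a s u) c" for a c u
  have \<phi>c: "\<phi> a s u \<in> carrier N" if "s \<in> H a n" "u \<in> carrier (U a)" for a s u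
    using linear_mapD(1)[OF lin[OF that(1)] that(2)] .
  have \<psi>lin: "linear_map R (X a n) N (\<lambda>c. \<psi> a c u)" if "u \<in> carrier (U a)" for a u
    unfolding \<psi>_def using K.lin_ext_lin_hom[OF N, of "H a n" "\<lambda>s. \<phi> a s u"] \<phi>c that
    by (simp add: lin_hom_iff)
  have \<psi>b: "\<psi> a (basis_elt R s) u = \<phi> a s u" if "s \<in> H a n" "u \<in> carrier (U a)" for a s u
    unfolding \<psi>_def using K.lin_ext_basis_elt[OF N, of "H a n" "\<lambda>s. \<phi> a s u"] \<phi>c that by simp
  note [simp] = linear_mapD[OF act_linear] linear_mapD[OF lin]
  have bm: "balanced_map R (weyl_group W a) (X a n) (\<rho> a n) (U a) N (\<psi> a)" for a
    unfolding balanced_map_def weyl_group_carrier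
  proof (intro conjI ballI)
    fix c assume c: "c \<in> carrier (X a n)"
    show "linear_map R (U a) N (\<psi> a c)"
    proof
      fix u assume u: "u \<in> carrier (U a)"
      show "\<psi> a c u \<in> carrier N" using linear_mapD(1)[OF \<psi>lin[OF u] c] .
      fix v assume v: "v \<in> carrier (U a)"
      show "\<psi> a c (u \<oplus>\<^bsub>U a\<^esub> v) = \<psi> a c u \<oplus>\<^bsub>N\<^esub> \<psi> a c v"
        by (rule K.linear_map_free_eqI[OF N \<psi>lin linear_map_add[OF mX N \<psi>lin \<psi>lin] _ c])
          (simp_all add: u v \<psi>b)
    next
      fix r u assume r: "r \<in> carrier R" "u \<in> carrier (U a)"
      show "\<psi> a c (r \<odot>\<^bsub>U a\<^esub> u) = r \<odot>\<^bsub>N\<^esub> \<psi> a c u"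
        by (rule K.linear_map_free_eqI[OF N \<psi>lin linear_map_smult[OF mX N \<psi>lin] _ c])
          (simp_all add: r \<psi>b)
    qed
    fix w u assume w: "w \<in> H a a" and u: "u \<in> carrier (U a)"
    show "\<psi> a (\<rho> a n w c) u = \<psi> a c (act (U a) w u)"
      by (rule K.linear_map_free_eqI[OF N linear_map_comp[OF action_linear \<psi>lin] \<psi>lin _ c])
        (simp_all add: w u action_basis \<psi>b bal fi_hom_compose[OF w])
  qed (fact \<psi>lin)
  have "\<exists>h. linear_map R (T n a) N h \<and> (\<forall>s\<in>H a n. \<forall>u\<in>carrier (U a).
      h (TP.tau a n (basis_elt R s) u) = \<phi> a s u)" for a
  proof -
    from TP.tensor_lift[OF N bm] obtain h where "linear_map R (T n a) N h"
      "\<forall>x\<in>carrier (X a n). \<forall>u\<in>carrier (U a). h (TP.tau a n x u) = \<psi> a x u"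
      unfolding T_eq by blast
    then show ?thesis using K.basis_elt_closed[of _ "H a n"] by (auto simp: \<psi>b)
  qed
  then obtain h where h: "\<And>a. linear_map R (T n a) N (h a)"
    "\<And>a s u. s \<in> H a n \<Longrightarrow> u \<in> carrier (U a) \<Longrightarrow> h a (TP.tau a n (basis_elt R s) u) = \<phi> a s u"
    by metis
  from TF.direct_sum_lift[OF N h(1)] obtain k where k: "linear_map R (M n) N k"
    "\<And>a y. y \<in> carrier (T n a) \<Longrightarrow> k (summand_inj (T n) a y) = h a y"
    unfolding M_eq by blast
  have "k (gen n a s u) = \<phi> a s u" if "s \<in> H a n" "u \<in> carrier (U a)" for a s u
  proof -
    have "TP.tau a n (basis_elt R s) u \<in> carrier (T n a)"
      unfolding T_eq using that by (intro TP.tau_closed K.basis_elt_closed)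
    then show ?thesis using that by (simp add: gen_def k(2) h(2))
  qed
  with k(1) show ?thesis by blast
qed

lemma
  assumes f: "f \<in> sharp_hom W m n"
  shows M_prin_map_linear: "linear_map R (X a m) (X a n) (M_prin_map R W a m n f)"
    and M_prin_map_basis: "s \<in> H a m \<Longrightarrow> M_prin_map R W a m n f (basis_elt R s) =
      (if 0 \<notin> f ` s ` signed a then basis_elt R (compose (signed a) f s) else \<zero>\<^bsub>X a n\<^esub>)"
proof -
  have c: "(if 0 \<notin> f ` s ` signed a then basis_elt R (compose (signed a) f s) else \<zero>\<^bsub>X a n\<^esub>)
      \<in> carrier (X a n)" if "s \<in> H a m" for s
    using sharp_fi_compose[OF f that] by (simp add: K.basis_elt_closed) (simp add: free_module_carrier)
  show "linear_map R (X a m) (X a n) (M_prin_map R W a m n f)"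
    unfolding M_prin_map_def Let_def by (rule conjunct1[OF iffD1[OF lin_hom_iff K.lin_ext_lin_hom[OF mX c]]])
  show "M_prin_map R W a m n f (basis_elt R s) =
      (if 0 \<notin> f ` s ` signed a then basis_elt R (compose (signed a) f s) else \<zero>\<^bsub>X a n\<^esub>)"
    if "s \<in> H a m"
    unfolding M_prin_map_def Let_def by (rule K.lin_ext_basis_elt[OF mX, OF c that])
qed

text \<open>Precomposing \<open>s\<close> with a bijection \<open>w\<close> does not change its image, so the condition that decides
  whether \<open>e\<^sub>s\<close> is killed is unaffected.\<close>

lemma M_prin_map_equivariant:
  assumes f: "f \<in> sharp_hom W m n" and w: "w \<in> H a a" and c: "c \<in> carrier (X a m)"
  shows "M_prin_map R W a m n f (\<rho> a m w c) = \<rho> a n w (M_prin_map R W a m n f c)"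
proof (rule K.linear_map_free_eqI[OF mX _ _ _ c])
  note M = M_prin_map_linear[OF f]
  show "linear_map R (X a m) (X a n) (\<lambda>c. M_prin_map R W a m n f (\<rho> a m w c))"
    "linear_map R (X a m) (X a n) (\<lambda>c. \<rho> a n w (M_prin_map R W a m n f c))"
    by (rule linear_map_comp[OF action_linear[OF w] M] linear_map_comp[OF M action_linear[OF w]])+
  fix s assume s: "s \<in> H a m"
  have sw: "compose (signed a) s w \<in> H a m" by (rule fi_hom_compose[OF w s])
  have im: "compose (signed a) s w ` signed a = s ` signed a"
  proof -
    have "w ` signed a = signed a"
      by (rule endo_inj_surj[OF finite_signed(1)]) (use fi_homD(7,8)[OF w] in auto)
    moreover have "compose (signed a) s w ` signed a = s ` w ` signed a" by (force simp: compose_def)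
    ultimately show ?thesis by simp
  qed
  have "compose (signed a) f (compose (signed a) s w) = compose (signed a) (compose (signed a) f s) w"
    using fi_homD(8)[OF w] by (auto simp: compose_def fun_eq_iff)
  then show "M_prin_map R W a m n f (\<rho> a m w (basis_elt R s)) =
      \<rho> a n w (M_prin_map R W a m n f (basis_elt R s))"
    using sharp_fi_compose[OF f s] linear_map_zero[OF action_linear[OF w] mX mX]
    by (simp add: action_basis[OF w] M_prin_map_basis[OF f] s sw im del: free_module_sel)
qed

lemma tau_zero: "u \<in> carrier (U a) \<Longrightarrow> TP.tau a n \<zero>\<^bsub>X a n\<^esub> u = \<zero>\<^bsub>T n a\<^esub>"
proof -
  assume "u \<in> carrier (U a)"
  then have "linear_map R (X a n) (T n a) (\<lambda>c. TP.tau a n c u)"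
    using TP.tau_balanced[of a n, unfolded balanced_map_def] by (simp add: T_eq)
  then show ?thesis by (rule linear_map_zero[OF _ mX TF.mM])
qed

lemma
  assumes f: "f \<in> sharp_hom W m n"
  shows M_fmor_lin_hom: "fmor (M_seq R W U) m n f \<in> lin_hom R (M m) (M n)"
    and M_fmor_gen: "s \<in> H a m \<Longrightarrow> u \<in> carrier (U a) \<Longrightarrow> fmor (M_seq R W U) m n f (gen m a s u) =
      (if 0 \<notin> f ` s ` signed a then gen n a (compose (signed a) f s) u else \<zero>\<^bsub>M n\<^esub>)"
proof -
  have eq: "fmor (M_seq R W U) m n f = direct_sum_map (T m) (\<lambda>a. fmor (M_rep R W a (U a)) m n f)"
    by (simp add: M_seq_def fi_direct_sum_def)
  have rep: "fmor (M_rep R W a (U a)) m n f = tensor_map R (weyl_group W a) (X a m) (\<rho> a m) (U a)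
      (X a n) (\<rho> a n) (U a) (M_prin_map R W a m n f) (\<lambda>u. u)" for a
    by (simp add: M_rep_def M_rep_map_def M_prin_def)
  have lin: "linear_map R (T m a) (T n a) (fmor (M_rep R W a (U a)) m n f)" for a
    unfolding rep T_eq using tensor_map_lin_hom[OF TP_axioms TP_axioms M_prin_map_linear[OF f] linear_map_id]
    by (simp add: M_prin_map_equivariant[OF f] weyl_group_carrier lin_hom_iff)
  have tau: "fmor (M_rep R W a (U a)) m n f (TP.tau a m c u) = TP.tau a n (M_prin_map R W a m n f c) u"
    if "c \<in> carrier (X a m)" "u \<in> carrier (U a)" for a c u
    unfolding rep using tensor_map_tau[OF TP_axioms TP_axioms M_prin_map_linear[OF f] linear_map_id _ _ that]
    by (simp add: M_prin_map_equivariant[OF f] weyl_group_carrier)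
  show "fmor (M_seq R W U) m n f \<in> lin_hom R (M m) (M n)"
    unfolding eq M_eq by (rule direct_sum_map_lin_hom[OF T_family T_family lin])
  assume s: "s \<in> H a m" and u: "u \<in> carrier (U a)"
  have t: "TP.tau a m (basis_elt R s) u \<in> carrier (T m a)"
    unfolding T_eq using s u by (intro TP.tau_closed K.basis_elt_closed)
  have "fmor (M_seq R W U) m n f (gen m a s u) =
      summand_inj (T n) a (TP.tau a n (M_prin_map R W a m n f (basis_elt R s)) u)"
    unfolding eq gen_def using direct_sum_map_summand_inj[OF T_family T_family lin t]
    by (simp add: tau K.basis_elt_closed s u)
  also have "\<dots> = (if 0 \<notin> f ` s ` signed a then gen n a (compose (signed a) f s) u else \<zero>\<^bsub>M n\<^esub>)"
    using linear_map_zero[OF TF.linear_summand_inj[where n = n and a = a] TF.mM TF.module_direct_sum]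
    by (simp add: M_prin_map_basis[OF f s] gen_def tau_zero u M_eq del: free_module_sel direct_sum_sel)
  finally show "fmor (M_seq R W U) m n f (gen m a s u) =
      (if 0 \<notin> f ` s ` signed a then gen n a (compose (signed a) f s) u else \<zero>\<^bsub>M n\<^esub>)" .
qed

lemma M_fmor_linear: "f \<in> sharp_hom W m n \<Longrightarrow> linear_map R (M m) (M n) (fmor (M_seq R W U) m n f)"
  using M_fmor_lin_hom by (simp add: lin_hom_iff)

lemma sharp_module_M: "sharp_module R W (M_seq R W U)"
  unfolding sharp_module_def is_functor_def sharp_cat_sel kmod_sel
proof (intro conjI ballI)
  fix m :: nat
  show "M m \<in> {M. module R M}" using module_M by simp
  show "fmor (M_seq R W U) m n f \<in> lin_hom R (M m) (M n)" if "f \<in> sharp_hom W m n" for n f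
    by (rule M_fmor_lin_hom[OF that])
  show "fmor (M_seq R W U) m m (\<lambda>a\<in>signed0 m. a) = (\<lambda>x\<in>carrier (M m). x)"
  proof (rule lin_hom_eqI[OF M_fmor_lin_hom[OF sharp_hom_id] linear_map_restrict[OF module_M linear_map_id]])
    fix x assume x: "x \<in> carrier (M m)"
    have "fmor (M_seq R W U) m m (\<lambda>a\<in>signed0 m. a) x = x"
    proof (rule gen_eqI[OF module_M M_fmor_linear[OF sharp_hom_id] linear_map_id _ x])
      fix a s u assume s: "s \<in> H a m" and u: "u \<in> carrier (U a)"
      have "compose (signed a) (\<lambda>a\<in>signed0 m. a) s = s"
        using fi_homD(1,3)[OF s] by (auto simp: compose_def fun_eq_iff mem_signed extensional_def)
      moreover have "0 \<notin> (\<lambda>a\<in>signed0 m. a) ` s ` signed a"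
        using fi_homD(2,3)[OF s] by (auto simp: mem_signed)
      ultimately show "fmor (M_seq R W U) m m (\<lambda>a\<in>signed0 m. a) (gen m a s u) = gen m a s u"
        by (simp add: M_fmor_gen[OF sharp_hom_id s u])
    qed
    then show "fmor (M_seq R W U) m m (\<lambda>a\<in>signed0 m. a) x = (\<lambda>x\<in>carrier (M m). x) x"
      using x by simp
  qed
  fix l n f g assume f: "f \<in> sharp_hom W l m" and g: "g \<in> sharp_hom W m n"
  have gf: "compose (signed0 l) g f \<in> sharp_hom W l n" by (rule sharp_hom_compose[OF f g])
  show "fmor (M_seq R W U) l n (compose (signed0 l) g f) =
      compose (carrier (M l)) (fmor (M_seq R W U) m n g) (fmor (M_seq R W U) l m f)"
  proof (rule lin_hom_eqI[OF M_fmor_lin_hom[OF gf]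
        lin_hom_compose[OF module_M M_fmor_lin_hom[OF f] M_fmor_lin_hom[OF g]]])
    fix x assume x: "x \<in> carrier (M l)"
    have "fmor (M_seq R W U) l n (compose (signed0 l) g f) x =
        fmor (M_seq R W U) m n g (fmor (M_seq R W U) l m f x)"
    proof (rule gen_eqI[OF module_M M_fmor_linear[OF gf]
          linear_map_comp[OF M_fmor_linear[OF f] M_fmor_linear[OF g]] _ x])
      fix a s u assume s: "s \<in> H a l" and u: "u \<in> carrier (U a)"
      have sl: "s x \<in> signed0 l" if "x \<in> signed a" for x
        using fi_homD(3)[OF s] that by (auto simp: mem_signed)
      have im: "compose (signed0 l) g f ` s ` signed a = g ` f ` s ` signed a"
        using sl by (force simp: compose_def image_image)
      have g0: "0 \<in> f ` s ` signed a \<Longrightarrow> 0 \<in> g ` f ` s ` signed a"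
        using sharp_homD(6)[OF g] by (metis image_eqI)
      have "compose (signed a) (compose (signed0 l) g f) s = compose (signed a) g (compose (signed a) f s)"
        using sl by (auto simp: compose_def fun_eq_iff)
      moreover have "compose (signed a) f s ` signed a = f ` s ` signed a"
        by (force simp: compose_def image_image)
      ultimately show "fmor (M_seq R W U) l n (compose (signed0 l) g f) (gen l a s u) =
          fmor (M_seq R W U) m n g (fmor (M_seq R W U) l m f (gen l a s u))"
        using g0 linear_map_zero[OF M_fmor_linear[OF g] module_M module_M]
          sharp_fi_compose[OF f s]
        by (simp add: M_fmor_gen f g gf s u im)
    qed
    then show "fmor (M_seq R W U) l n (compose (signed0 l) g f) x =
        compose (carrier (M l)) (fmor (M_seq R W U) m n g) (fmor (M_seq R W U) l m f) x"
      using x by (simp add: compose_eq)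
  qed
qed

sublocale MS: sharp_mod R W "M_seq R W U"
  by (rule sharp_mod.intro[OF sharp_module_M])

end

lemma
  assumes "fb_mod R W U" "fb_mod R W U'" and \<phi>: "\<And>a. \<phi> a \<in> rep_hom R (weyl_group W a) (U a) (U' a)"
  shows M_seq_map_lin_hom:
      "M_seq_map R W U U' \<phi> n \<in> lin_hom R (fobj (M_seq R W U) n) (fobj (M_seq R W U') n)"
    and M_seq_map_gen: "s \<in> fi_hom W a n \<Longrightarrow> u \<in> carrier (U a) \<Longrightarrow>
      M_seq_map R W U U' \<phi> n (fb_mod.gen R W U n a s u) = fb_mod.gen R W U' n a s (\<phi> a u)"
proof -
  interpret A: fb_mod R W U by fact
  interpret B: fb_mod R W U' by fact
  have \<phi>l: "linear_map R (U a) (U' a) (\<phi> a)" for a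
    using \<phi>[of a] by (simp add: rep_hom_def lin_hom_iff)
  have rep: "M_rep_map R W a (U a) (U' a) n n (\<lambda>c. c) (\<phi> a) =
      tensor_map R (weyl_group W a) (A.X a n) (A.\<rho> a n) (U a) (A.X a n) (A.\<rho> a n) (U' a) (\<lambda>c. c) (\<phi> a)" for a
    by (simp add: M_rep_map_def M_prin_def)
  have e: "\<phi> a (act (U a) w u) = act (U' a) w (\<phi> a u)"
    if "w \<in> carrier (weyl_group W a)" "u \<in> carrier (U a)" for a w u
    using \<phi>[of a] that by (simp add: rep_hom_def)
  have lin: "linear_map R (A.T n a) (B.T n a) (M_rep_map R W a (U a) (U' a) n n (\<lambda>c. c) (\<phi> a))" for a
    unfolding rep A.T_eq B.T_eq using tensor_map_lin_hom[OF A.TP_axioms B.TP_axioms linear_map_id \<phi>l]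
    by (simp add: e lin_hom_iff)
  have eq: "M_seq_map R W U U' \<phi> n = direct_sum_map (A.T n) (\<lambda>a. M_rep_map R W a (U a) (U' a) n n (\<lambda>c. c) (\<phi> a))"
    by (simp add: M_seq_map_def)
  show "M_seq_map R W U U' \<phi> n \<in> lin_hom R (A.M n) (B.M n)"
    unfolding eq A.M_eq B.M_eq by (rule direct_sum_map_lin_hom[OF A.T_family B.T_family lin])
  assume s: "s \<in> A.H a n" and u: "u \<in> carrier (U a)"
  have t: "A.TP.tau a n (basis_elt R s) u \<in> carrier (A.T n a)"
    unfolding A.T_eq using s u by (intro A.TP.tau_closed A.K.basis_elt_closed)
  show "M_seq_map R W U U' \<phi> n (A.gen n a s u) = B.gen n a s (\<phi> a u)"
    unfolding eq A.gen_def B.gen_def direct_sum_map_summand_inj[OF A.T_family B.T_family lin t]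
    unfolding rep using tensor_map_tau[OF A.TP_axioms B.TP_axioms linear_map_id \<phi>l, where x = "basis_elt R s" and u = u]
    by (simp add: e A.K.basis_elt_closed s u)
qed

section \<open>Primitive elements of induced modules\<close>

context fb_mod
begin

abbreviation "idn n \<equiv> (\<lambda>x\<in>signed n. x) :: int \<Rightarrow> int"

text \<open>The linear map \<open>M(U)\<^sub>n \<rightarrow> U\<^sub>n\<close> that sends \<open>e\<^sub>s \<otimes> u\<close> to \<open>s u\<close> for \<open>s \<in> W\<^sub>n\<close> and kills the
  summands \<open>M(U\<^sub>a)\<close> with \<open>a < n\<close>.  It exists by the universal property.\<close>

definition top_part :: "nat \<Rightarrow> (nat \<Rightarrow> ('k, 'u) induced) \<Rightarrow> 'u" where
  "top_part n = (SOME h. linear_map R (M n) (U n) h \<and> (\<forall>a. \<forall>s\<in>H a n. \<forall>u\<in>carrier (U a).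
     h (gen n a s u) = (if a = n then act (U n) s u else \<zero>\<^bsub>U n\<^esub>)))"

lemma top_part_linear: "linear_map R (M n) (U n) (top_part n)"
  and top_part_gen: "s \<in> H a n \<Longrightarrow> u \<in> carrier (U a) \<Longrightarrow>
    top_part n (gen n a s u) = (if a = n then act (U n) s u else \<zero>\<^bsub>U n\<^esub>)"
proof -
  have "\<exists>h. linear_map R (M n) (U n) h \<and> (\<forall>a. \<forall>s\<in>H a n. \<forall>u\<in>carrier (U a).
     h (gen n a s u) = (if a = n then act (U n) s u else \<zero>\<^bsub>U n\<^esub>))"
  proof (rule gen_lift[OF mU])
    fix a s assume "s \<in> H a n"
    then show "linear_map R (U a) (U n) (\<lambda>u. if a = n then act (U n) s u else \<zero>\<^bsub>U n\<^esub>)"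
      using act_linear linear_map_const_zero[OF mU mU] by (cases "a = n") simp_all
  qed (auto simp: act_compose)
  from someI_ex[OF this, folded top_part_def] show "linear_map R (M n) (U n) (top_part n)"
    "s \<in> H a n \<Longrightarrow> u \<in> carrier (U a) \<Longrightarrow>
    top_part n (gen n a s u) = (if a = n then act (U n) s u else \<zero>\<^bsub>U n\<^esub>)" by blast+
qed

lemma gen_eq_induced:
  assumes s: "s \<in> H a n" and u: "u \<in> carrier (U a)"
  shows "gen n a s u = fmor (M_seq R W U) a n (extend0 a s) (gen a a (idn a) u)"
proof -
  have "0 \<notin> extend0 a s ` idn a ` signed a"
    using fi_homD(2)[OF s] by (auto simp: extend0_def mem_signed)
  moreover have "compose (signed a) (extend0 a s) (idn a) = s"
    using fi_homD(1)[OF s] by (auto simp: compose_def extend0_def mem_signed fun_eq_iff extensional_def)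
  ultimately show ?thesis by (simp add: M_fmor_gen[OF extend0_sharp[OF s] fi_hom_id u])
qed

lemma gen_top:
  assumes s: "s \<in> H n n" and u: "u \<in> carrier (U n)"
  shows "gen n n s u = gen n n (idn n) (act (U n) s u)"
proof -
  have "compose (signed n) (idn n) s = s"
    using fi_homD(1)[OF s] fi_homD(8)[OF s] by (auto simp: compose_def fun_eq_iff extensional_def)
  then show ?thesis using gen_balanced[OF fi_hom_id s u] by simp
qed

text \<open>Killing \<open>\<plusminus>i\<close> after the identity of \<open>n\<close> produces a \<open>0\<close>, so \<open>e\<^sub>i\<^sub>d \<otimes> u\<close> is sent to \<open>0\<close>.\<close>

lemma gen_prim: "u \<in> carrier (U n) \<Longrightarrow> gen n n (idn n) u \<in> MS.prim n"
proof -
  assume u: "u \<in> carrier (U n)"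
  have "MS.e n i (gen n n (idn n) u) = \<zero>\<^bsub>M n\<^esub>" if "i \<in> {1..n}" for i
  proof -
    have "int i \<in> signed n" "kill n i (int i) = 0" using that by (auto simp: mem_signed kill_def)
    then have "0 \<in> kill n i ` idn n ` signed n" by force
    then show ?thesis unfolding MS.e_def by (simp add: M_fmor_gen[OF kill_sharp fi_hom_id u])
  qed
  then show ?thesis using gen_closed[OF fi_hom_id u] by (simp add: MS.prim_def)
qed

lemma top_part_gen_id: "u \<in> carrier (U n) \<Longrightarrow> top_part n (gen n n (idn n) u) = u"
  by (simp add: top_part_gen fi_hom_id act_id)

text \<open>Both sides are linear, so it is enough to compare them on generators.  For \<open>a < n\<close> the generator is
  induced from below and both sides vanish; for \<open>a = n\<close> it is already primitive.\<close>

lemma p_eq_top_part: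
  assumes "y \<in> carrier (M n)" shows "MS.p n y = gen n n (idn n) (top_part n y)"
proof (rule gen_eqI[OF module_M MS.q_linear linear_map_comp[OF top_part_linear gen_linear[OF fi_hom_id]] _ assms])
  fix a s u assume s: "s \<in> H a n" and u: "u \<in> carrier (U a)"
  show "MS.p n (gen n a s u) = gen n n (idn n) (top_part n (gen n a s u))"
  proof (cases "a = n")
    case True
    then have su: "act (U n) s u \<in> carrier (U n)" using linear_mapD(1)[OF act_linear] s u by simp
    show ?thesis
      using True s u gen_top[of s n u] MS.p_prim[OF gen_prim[OF su]] top_part_gen_id[OF su] by simp
  next
    case False
    then have "a < n" using fi_hom_le[OF s] by simp
    then have "MS.p n (gen n a s u) = \<zero>\<^bsub>M n\<^esub>"
      using MS.p_induced_zero[OF s _ gen_closed[OF fi_hom_id u]] gen_eq_induced[OF s u] by simp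
    moreover have "top_part n (gen n a s u) = \<zero>\<^bsub>U n\<^esub>" using False by (simp add: top_part_gen[OF s u])
    ultimately show ?thesis using linear_map_zero[OF gen_linear[OF fi_hom_id] mU module_M, of n] by simp
  qed
qed

lemma bij_gen_prim: "bij_betw (gen n n (idn n)) (carrier (U n)) (MS.prim n)"
proof (rule bij_betwI[of _ _ _ "top_part n"])
  show "gen n n (idn n) \<in> carrier (U n) \<rightarrow> MS.prim n" by (auto intro: gen_prim)
  show "top_part n \<in> MS.prim n \<rightarrow> carrier (U n)"
    by (auto intro: linear_mapD(1)[OF top_part_linear] MS.prim_closed)
  show "gen n n (idn n) (top_part n y) = y" if "y \<in> MS.prim n" for y
    using MS.p_prim[OF that] p_eq_top_part[OF MS.prim_closed[OF that]] by simp
qed (rule top_part_gen_id)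

end

text \<open>A generator \<open>e\<^sub>s \<otimes> u\<close> goes to \<open>s\<^sub>* (\<phi> u)\<close>.  Primitivity of \<open>\<phi> u\<close> is what makes this
  compatible with the non-injective morphisms, which kill generators of \<open>M(U)\<close>.\<close>

lemma morphism_from_induced:
  assumes "fb_mod R W U" "sharp_mod R W V"
    and lin: "\<And>a. linear_map R (U a) (fobj V a) (\<phi> a)"
    and eqv: "\<And>a w u. w \<in> fi_hom W a a \<Longrightarrow> u \<in> carrier (U a) \<Longrightarrow>
      \<phi> a (act (U a) w u) = fmor V a a (extend0 a w) (\<phi> a u)"
    and prim: "\<And>a u. u \<in> carrier (U a) \<Longrightarrow> \<phi> a u \<in> sharp_mod.prim V a"
  shows "\<exists>\<theta>. sharp_morphism R W (M_seq R W U) V \<theta> \<and>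
    (\<forall>n a. \<forall>s\<in>fi_hom W a n. \<forall>u\<in>carrier (U a).
      \<theta> n (fb_mod.gen R W U n a s u) = fmor V a n (extend0 a s) (\<phi> a u))"
proof -
  interpret U: fb_mod R W U by fact
  interpret V: sharp_mod R W V by fact
  note \<phi>c = linear_mapD(1)[OF lin]
  have "\<exists>h. linear_map R (U.M n) (fobj V n) h \<and> (\<forall>a. \<forall>s\<in>fi_hom W a n. \<forall>u\<in>carrier (U a).
      h (U.gen n a s u) = fmor V a n (extend0 a s) (\<phi> a u))" for n
  proof (rule U.gen_lift[OF V.mV])
    fix a s assume s: "s \<in> fi_hom W a n"
    show "linear_map R (U a) (fobj V n) (\<lambda>u. fmor V a n (extend0 a s) (\<phi> a u))"
      by (rule linear_map_comp[OF lin V.fmor_linear[OF extend0_sharp[OF s]]])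
    fix w u assume w: "w \<in> fi_hom W a a" and u: "u \<in> carrier (U a)"
    show "fmor V a n (extend0 a (compose (signed a) s w)) (\<phi> a u) =
        fmor V a n (extend0 a s) (\<phi> a (act (U a) w u))"
      by (simp add: extend0_compose[OF w] eqv[OF w u]
          V.fmor_compose[OF extend0_sharp[OF w] extend0_sharp[OF s] \<phi>c[OF u]])
  qed
  then obtain \<theta> where \<theta>: "\<And>n. linear_map R (U.M n) (fobj V n) (\<theta> n)"
    "\<And>n a s u. s \<in> fi_hom W a n \<Longrightarrow> u \<in> carrier (U a) \<Longrightarrow>
      \<theta> n (U.gen n a s u) = fmor V a n (extend0 a s) (\<phi> a u)" by metis
  \<comment> \<open>Naturality is checked on generators, according to whether \<open>f\<close> kills the generator or not.\<close>
  have "\<theta> n (fmor (M_seq R W U) m n f x) = fmor V m n f (\<theta> m x)"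
    if f: "f \<in> sharp_hom W m n" and x: "x \<in> U.MS.C m" for m n f x
  proof (rule U.gen_eqI[OF V.mV linear_map_comp[OF U.M_fmor_linear[OF f] \<theta>(1)]
        linear_map_comp[OF \<theta>(1) V.fmor_linear[OF f]] _ x])
    fix a s u assume s: "s \<in> fi_hom W a m" and u: "u \<in> carrier (U a)"
    let ?g = "compose (signed0 a) f (extend0 a s)"
    have g: "?g \<in> sharp_hom W a n" by (rule sharp_hom_compose[OF extend0_sharp[OF s] f])
    have eq: "fmor V m n f (\<theta> m (U.gen m a s u)) = fmor V a n ?g (\<phi> a u)"
      by (simp add: \<theta>(2)[OF s u] V.fmor_compose[OF extend0_sharp[OF s] f \<phi>c[OF u]])
    show "\<theta> n (fmor (M_seq R W U) m n f (U.gen m a s u)) = fmor V m n f (\<theta> m (U.gen m a s u))"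
    proof (cases "0 \<in> f ` s ` signed a")
      case False
      have "extend0 a (compose (signed a) f s) = ?g"
        using sharp_homD(6)[OF f] by (auto simp: extend0_def compose_def fun_eq_iff mem_signed)
      then show ?thesis
        using False eq by (simp add: U.M_fmor_gen[OF f s u] \<theta>(2)[OF sharp_fi_compose[OF f s] u])
    next
      case True
      then obtain x where x: "x \<in> signed a" "f (s x) = 0" by auto
      from g have "fmor V a n ?g (\<phi> a u) = \<zero>\<^bsub>fobj V n\<^esub>"
      proof (cases rule: sharp_hom_cases)
        case (kill i)
        then show ?thesis by (rule V.prim_killed[OF prim[OF u] g])
      next
        case (inj g')
        have "?g x = 0" using x by (auto simp: compose_def extend0_def mem_signed)
        then show ?thesis using inj(3) x(1) by (metis image_eqI)
      qed
      then show ?thesis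
        using True eq linear_map_zero[OF \<theta>(1) U.module_M V.mV] by (simp add: U.M_fmor_gen[OF f s u])
    qed
  qed
  with \<theta> show ?thesis unfolding sharp_morphism_def by blast
qed

lemma morphism_from_induced_bij:
  assumes "fb_mod R W U" "sharp_mod R W V" "sharp_morphism R W (M_seq R W U) V \<theta>"
    and \<theta>: "\<And>n u. u \<in> carrier (U n) \<Longrightarrow>
      \<theta> n (fb_mod.gen R W U n n (\<lambda>x\<in>signed n. x) u) = \<phi> n u"
    and bij: "\<And>n. bij_betw (\<phi> n) (carrier (U n)) (sharp_mod.prim V n)"
  shows "bij_betw (\<theta> n) (carrier (fobj (M_seq R W U) n)) (carrier (fobj V n))"
proof -
  interpret U: fb_mod R W U by fact
  interpret V: sharp_mod R W V by fact
  interpret \<theta>: sharp_mor R W "M_seq R W U" V \<theta>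
    by (rule sharp_mor.intro) (use assms U.MS.sharp_mod_axioms in \<open>simp_all add: sharp_mor_axioms_def\<close>)
  show ?thesis
  proof (rule \<theta>.bij_betw_if_bij_on_prim)
    fix n
    have "bij_betw (\<theta> n \<circ> U.gen n n (U.idn n)) (carrier (U n)) (V.prim n)"
      by (rule iffD2[OF bij_betw_cong bij]) (simp add: \<theta>)
    then show "bij_betw (\<theta> n) (U.MS.prim n) (V.prim n)"
      using bij_betw_comp_iff[OF U.bij_gen_prim] by blast
  qed
qed

section \<open>Every FI-sharp-module is induced from its primitive elements\<close>

lemma rep_extend_sel [simp]:
  "carrier (module.extend M (rep.fields f)) = carrier M"
  "zero (module.extend M (rep.fields f)) = zero M"
  "add (module.extend M (rep.fields f)) = add M"
  "smult (module.extend M (rep.fields f)) = smult M"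
  "act (module.extend M (rep.fields f)) = f"
  by (simp_all add: module.defs rep.defs)

lemma module_extend:
  fixes M :: "('k, 'u) module" and f :: "'g \<Rightarrow> 'u \<Rightarrow> 'u"
  shows "module R M \<Longrightarrow> module R (module.extend M (rep.fields f))"
  by (rule module_surj_image[of R M "\<lambda>x. x"]) simp_all

context sharp_mod
begin

lemma submodule_prim: "submodule (prim n) R (fobj V n)"
  by (rule V.submoduleI)
    (auto simp: prim_def linear_mapD[OF e_linear] linear_map_minus[OF e_linear mV mV])

definition prim_rep :: "nat \<Rightarrow> ('k, 'u, int \<Rightarrow> int) rep" where
  "prim_rep n = module.extend ((fobj V n)\<lparr>carrier := prim n\<rparr>)
     (rep.fields (\<lambda>w. restrict (fmor V n n (extend0 n w)) (prim n)))"

lemma prim_rep_sel [simp]: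
  "carrier (prim_rep n) = prim n" "zero (prim_rep n) = zero (fobj V n)"
  "add (prim_rep n) = add (fobj V n)" "smult (prim_rep n) = smult (fobj V n)"
  "act (prim_rep n) w = restrict (fmor V n n (extend0 n w)) (prim n)"
  by (simp_all add: prim_rep_def)

lemma representation_prim: "representation R (weyl_group W n) (prim_rep n)"
  unfolding representation_def weyl_group_carrier
proof (intro conjI ballI)
  show m: "module R (prim_rep n)"
    unfolding prim_rep_def by (rule module_extend[OF submodule.submodule_is_module[OF submodule_prim mV]])
  fix w assume w: "w \<in> fi_hom W n n"
  note L = linear_mapD[OF fmor_linear[OF extend0_sharp[OF w]]]
  have "linear_map R (prim_rep n) (prim_rep n) (fmor V n n (extend0 n w))"
    by rule (simp_all add: fmor_prim[OF _ w] L prim_closed)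
  from linear_map_restrict[OF m this] show "act (prim_rep n) w \<in> lin_hom R (prim_rep n) (prim_rep n)"
    by simp
  fix v x assume v: "v \<in> fi_hom W n n" and x: "x \<in> carrier (prim_rep n)"
  then show "act (prim_rep n) (w \<otimes>\<^bsub>weyl_group W n\<^esub> v) x = act (prim_rep n) w (act (prim_rep n) v x)"
    by (simp add: fmor_prim extend0_compose[OF v] fmor_compose[OF extend0_sharp[OF v] extend0_sharp[OF w]]
        prim_closed)
next
  fix x assume "x \<in> carrier (prim_rep n)"
  then show "act (prim_rep n) \<one>\<^bsub>weyl_group W n\<^esub> x = x"
    by (simp add: extend0_id fmor_id prim_closed)
qed

text \<open>Apply the detection principle to the morphism from \<open>M(U)\<close> to \<open>V\<close> that extends the inclusions of
  the primitive parts \<open>U\<^sub>a\<close> of \<open>V\<^sub>a\<close>, and invert it.\<close>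

lemma isomorphic_induced_prim: "sharp_isomorphic R W V (M_seq R W prim_rep)"
proof -
  interpret U: fb_mod R W prim_rep
    by (rule fb_mod.intro) (use V.R.is_cring representation_prim in \<open>simp_all add: fb_module_def\<close>)
  have "\<exists>\<theta>. sharp_morphism R W (M_seq R W prim_rep) V \<theta> \<and>
    (\<forall>n a. \<forall>s\<in>fi_hom W a n. \<forall>u\<in>carrier (prim_rep a).
      \<theta> n (U.gen n a s u) = fmor V a n (extend0 a s) ((\<lambda>_ u. u) a u))"
    by (rule morphism_from_induced[OF U.fb_mod_axioms sharp_mod_axioms])
      (auto simp: linear_map_def prim_closed)
  then obtain \<theta> where \<theta>: "sharp_morphism R W (M_seq R W prim_rep) V \<theta>"
    "\<And>n a s u. s \<in> fi_hom W a n \<Longrightarrow> u \<in> prim a \<Longrightarrow>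
      \<theta> n (U.gen n a s u) = fmor V a n (extend0 a s) u" by auto
  have bij: "bij_betw (\<theta> n) (U.MS.C n) (C n)" for n
    by (rule morphism_from_induced_bij[OF U.fb_mod_axioms sharp_mod_axioms \<theta>(1), where \<phi> = "\<lambda>_ u. u"])
      (simp_all add: \<theta>(2) fi_hom_id extend0_id fmor_id prim_closed bij_betw_def)
  \<comment> \<open>The isomorphism is required in the direction from \<open>V\<close>, so \<open>\<theta>\<close> is inverted degreewise.\<close>
  define \<eta> where "\<eta> n = restrict (inv_into (U.MS.C n) (\<theta> n)) (C n)" for n
  have lin: "linear_map R (U.M n) (fobj V n) (\<theta> n)" for n using \<theta>(1) by (simp add: sharp_morphism_def)
  have "\<eta> n \<in> lin_hom R (fobj V n) (U.M n)" for n
    unfolding \<eta>_def by (rule linear_map_restrict[OF mV linear_map_inv_into[OF U.module_M mV lin bij]])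
  moreover have \<eta>bij: "bij_betw (\<eta> n) (C n) (U.MS.C n)" for n
    by (rule iffD2[OF bij_betw_cong bij_betw_inv_into[OF bij]]) (simp add: \<eta>_def)
  moreover have "\<eta> n (fmor V m n f x) = fmor (M_seq R W prim_rep) m n f (\<eta> m x)"
    if f: "f \<in> sharp_hom W m n" and x: "x \<in> C m" for m n f x
  proof -
    have y: "\<eta> m x \<in> U.MS.C m" using \<eta>bij[of m] x by (auto simp: bij_betw_def)
    have "\<theta> m (\<eta> m x) = x" using bij[of m] x by (simp add: \<eta>_def bij_betw_inv_into_right)
    then have "fmor V m n f x = \<theta> n (fmor (M_seq R W prim_rep) m n f (\<eta> m x))"
      using \<theta>(1) f y by (simp add: sharp_morphism_def)
    then show ?thesis
      using bij[of n] U.MS.fmor_closed[OF f y] fmor_closed[OF f x]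
      by (simp add: \<eta>_def bij_betw_inv_into_left)
  qed
  ultimately show ?thesis unfolding sharp_isomorphic_def by blast
qed

section \<open>The FB-module H0\<close>

abbreviation "K n \<equiv> H0_kernel R W (restrict_to_fi V) n"
abbreviation "H0V \<equiv> H0 R W (restrict_to_fi V)"

lemma restrict_sel [simp]:
  "fobj (restrict_to_fi V) = fobj V" "fmor (restrict_to_fi V) m n f = fmor V m n (extend0 m f)"
  by (simp_all add: restrict_to_fi_def)

lemma H0_generators_closed:
  "(\<Union>m\<in>{..<n}. \<Union>f\<in>fi_hom W m n. fmor V m n (extend0 m f) ` C m) \<subseteq> C n"
  using fmor_closed[OF extend0_sharp] by auto

lemma K_span: "K n = Defs.span R (fobj V n) (\<Union>m\<in>{..<n}. \<Union>f\<in>fi_hom W m n. fmor V m n (extend0 m f) ` C m)"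
  by (simp add: H0_kernel_def)

lemma submodule_K: "submodule (K n) R (fobj V n)"
  unfolding K_span using span_submodule[OF mV H0_generators_closed] .

lemma generator_in_K: "m < n \<Longrightarrow> f \<in> fi_hom W m n \<Longrightarrow> x \<in> C m \<Longrightarrow> fmor V m n (extend0 m f) x \<in> K n"
  unfolding K_span by (rule subsetD[OF span_superset]) auto

text \<open>The projector kills all generators of the left-hand side.  Conversely, if \<open>p v = 0\<close>, then
  \<open>v = v - p v\<close> is a sum of elements \<open>e n i y\<close>, which are induced from degree \<open>n - 1\<close>.\<close>

lemma K_eq: "K n = {v \<in> C n. p n v = \<zero>\<^bsub>fobj V n\<^esub>}"
proof
  show "K n \<subseteq> {v \<in> C n. p n v = \<zero>\<^bsub>fobj V n\<^esub>}"
    unfolding K_span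
    by (rule span_least) (use submodule_kernel[OF mV mV q_linear] p_induced_zero
        fmor_closed[OF extend0_sharp] in auto)
  show "{v \<in> C n. p n v = \<zero>\<^bsub>fobj V n\<^esub>} \<subseteq> K n"
  proof clarify
    fix v assume v: "v \<in> C n" "p n v = \<zero>\<^bsub>fobj V n\<^esub>"
    have "v \<ominus>\<^bsub>fobj V n\<^esub> p n v \<in> K n"
    proof (rule decompose[OF submodule_K v(1)])
      fix i y assume i: "i \<in> {1..n}" and y: "y \<in> C n"
      from e_factor[OF i y] obtain m where m: "n = Suc m"
        "e n i y = fmor V m n (extend0 m (skip m i)) (fmor V n m (unskip m i) y)" .
      have "fmor V n m (unskip m i) y \<in> C m"
        using i m y by (auto intro!: fmor_closed[OF unskip_sharp])
      then show "e n i y \<in> K n" using m generator_in_K[of m n "skip m i"] skip_fi[of m i W] by simp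
    qed
    then show "v \<in> K n" using v by (simp add: V.M.diff_zero)
  qed
qed

sublocale Q: quotient R "fobj V n" "K n" for n
  by (rule quotient.intro[OF mV quotient_axioms.intro[OF submodule_K]])

abbreviation "cl n v \<equiv> K n +>\<^bsub>fobj V n\<^esub> v"

lemma H0_sel [simp]:
  "carrier (H0V n) = carrier (quot_module (fobj V n) (K n))"
  "zero (H0V n) = zero (quot_module (fobj V n) (K n))"
  "add (H0V n) = add (quot_module (fobj V n) (K n))"
  "smult (H0V n) = smult (quot_module (fobj V n) (K n))"
  "act (H0V n) w = quot_map (fobj V n) (K n) (fobj V n) (K n) (fmor V n n (extend0 n w))"
  by (simp_all add: H0_def)

lemma module_H0: "module R (H0V n)"
  unfolding H0_def by (rule module_extend) (simp add: Q.module_quot)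

lemma K_stable:
  assumes "w \<in> fi_hom W n n" "v \<in> K n" shows "fmor V n n (extend0 n w) v \<in> K n"
proof -
  have w: "extend0 n w \<in> sharp_hom W n n" by (rule extend0_sharp[OF assms(1)])
  have ker: "submodule {v \<in> C n. cl n (fmor V n n (extend0 n w) v) = \<zero>\<^bsub>quot_module (fobj V n) (K n)\<^esub>} R (fobj V n)"
    by (rule submodule_kernel[OF mV Q.module_quot linear_map_comp[OF fmor_linear[OF w] Q.linear_map_cls]])
  \<comment> \<open>The preimage of \<open>K n\<close> under \<open>w\<close> is a submodule, hence it contains \<open>K n\<close> once it contains its generators.\<close>
  define T where "T = {v \<in> C n. cl n (fmor V n n (extend0 n w) v) = \<zero>\<^bsub>quot_module (fobj V n) (K n)\<^esub>}"
  have "K n \<subseteq> T"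
    unfolding K_span
  proof (rule span_least[OF ker[folded T_def]])
    show "(\<Union>m\<in>{..<n}. \<Union>f\<in>fi_hom W m n. fmor V m n (extend0 m f) ` C m) \<subseteq> T"
    proof
      fix y assume "y \<in> (\<Union>m\<in>{..<n}. \<Union>f\<in>fi_hom W m n. fmor V m n (extend0 m f) ` C m)"
      then obtain m f x where m: "m < n" and f: "f \<in> fi_hom W m n" and x: "x \<in> C m"
        and y: "y = fmor V m n (extend0 m f) x" by auto
      have f': "extend0 m f \<in> sharp_hom W m n" by (rule extend0_sharp[OF f])
      have "fmor V n n (extend0 n w) y = fmor V m n (extend0 m (compose (signed m) w f)) x"
        by (simp add: y fmor_compose[OF f' w x] extend0_compose[OF f])
      also have "\<dots> \<in> K n" by (rule generator_in_K[OF m fi_hom_compose[OF f assms(1)] x])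
      finally show "y \<in> T"
        using fmor_closed[OF f' x] fmor_closed[OF w] by (simp add: Q.cls_eq_zero_iff y T_def)
    qed
  qed
  then have "v \<in> T" using assms(2) by blast
  then have "v \<in> C n" "cl n (fmor V n n (extend0 n w) v) = \<zero>\<^bsub>quot_module (fobj V n) (K n)\<^esub>"
    by (simp_all only: T_def mem_Collect_eq)
  then show ?thesis using Q.cls_eq_zero_iff[OF fmor_closed[OF w]] by blast
qed

text \<open>As \<open>v - p v\<close> lies in the stable submodule \<open>K n\<close>, the elements \<open>w v\<close> and \<open>w (p v)\<close> have the same
  projection, and \<open>w (p v)\<close> is already primitive.\<close>

lemma p_equivariant:
  assumes w: "w \<in> fi_hom W n n" and v: "v \<in> C n"
  shows "p n (fmor V n n (extend0 n w) v) = fmor V n n (extend0 n w) (p n v)"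
proof -
  note L = fmor_linear[OF extend0_sharp[OF w]]
  have c: "fmor V n n (extend0 n w) v \<in> C n" "fmor V n n (extend0 n w) (p n v) \<in> C n" "p n v \<in> C n"
    using v by (simp_all add: linear_mapD(1)[OF L])
  have "p n (v \<ominus>\<^bsub>fobj V n\<^esub> p n v) = p n v \<ominus>\<^bsub>fobj V n\<^esub> p n (p n v)"
    by (rule linear_map_diff[OF q_linear mV mV v c(3)])
  also have "\<dots> = \<zero>\<^bsub>fobj V n\<^esub>"
    unfolding p_prim[OF p_in_prim[OF v]] using c(3) by (simp add: V.M.diff_eq_zero_iff)
  finally have "v \<ominus>\<^bsub>fobj V n\<^esub> p n v \<in> K n"
    unfolding K_eq mem_Collect_eq using v c(3) by (intro conjI V.M.minus_closed)
  from K_stable[OF w this] have "p n (fmor V n n (extend0 n w) (v \<ominus>\<^bsub>fobj V n\<^esub> p n v)) = \<zero>\<^bsub>fobj V n\<^esub>"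
    unfolding K_eq by blast
  then have "p n (fmor V n n (extend0 n w) v) = p n (fmor V n n (extend0 n w) (p n v))"
    using v c by (simp only: linear_map_diff[OF L mV mV] linear_map_diff[OF q_linear mV mV]
        V.M.diff_eq_zero_iff q_closed)
  also have "\<dots> = fmor V n n (extend0 n w) (p n v)" by (rule p_prim[OF fmor_prim[OF p_in_prim[OF v] w]])
  finally show ?thesis .
qed

lemma act_cl: "w \<in> fi_hom W n n \<Longrightarrow> v \<in> C n \<Longrightarrow> act (H0V n) w (cl n v) = cl n (fmor V n n (extend0 n w) v)"
  using quot_map_cls[OF Q.quotient_axioms Q.quotient_axioms fmor_linear[OF extend0_sharp] K_stable] by simp

lemma representation_H0: "representation R (weyl_group W n) (H0V n)"
  unfolding representation_def weyl_group_carrier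
proof (intro conjI ballI)
  show "module R (H0V n)" by (rule module_H0)
  fix w assume w: "w \<in> fi_hom W n n"
  show "act (H0V n) w \<in> lin_hom R (H0V n) (H0V n)"
    using quot_map_lin_hom[OF Q.quotient_axioms Q.quotient_axioms fmor_linear[OF extend0_sharp[OF w]]
        K_stable[OF w]]
    by (simp add: lin_hom_iff linear_map_def)
  fix v x assume v: "v \<in> fi_hom W n n" and x: "x \<in> carrier (H0V n)"
  then obtain y where y: "y \<in> C n" "x = cl n y" by (auto simp: Q.carrier_quot)
  show "act (H0V n) (w \<otimes>\<^bsub>weyl_group W n\<^esub> v) x = act (H0V n) w (act (H0V n) v x)"
    using y fmor_closed[OF extend0_sharp[OF v]] fi_hom_compose[OF v w]
    by (simp add: act_cl v w fmor_compose[OF extend0_sharp[OF v] extend0_sharp[OF w]]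
        extend0_compose[OF v] del: H0_sel)
next
  fix x assume "x \<in> carrier (H0V n)"
  then obtain y where y: "y \<in> C n" "x = cl n y" by (auto simp: Q.carrier_quot)
  then show "act (H0V n) \<one>\<^bsub>weyl_group W n\<^esub> x = x"
    by (simp add: act_cl[OF fi_hom_id] extend0_id fmor_id del: H0_sel)
qed

text \<open>The isomorphism from \<open>H\<^sub>0(V)\<^sub>n\<close> onto the primitive part of \<open>V\<^sub>n\<close> induced by the projector \<open>p n\<close>.\<close>

definition H0_to_prim :: "nat \<Rightarrow> 'u set \<Rightarrow> 'u" where
  "H0_to_prim n = (SOME h. linear_map R (H0V n) (fobj V n) h \<and> (\<forall>v\<in>C n. h (cl n v) = p n v))"

lemma H0_to_prim_linear: "linear_map R (H0V n) (fobj V n) (H0_to_prim n)"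
  and H0_to_prim_cl: "v \<in> C n \<Longrightarrow> H0_to_prim n (cl n v) = p n v"
proof -
  have "\<exists>h. linear_map R (quot_module (fobj V n) (K n)) (fobj V n) h \<and> (\<forall>v\<in>C n. h (cl n v) = p n v)"
    by (rule Q.quot_lift[OF mV q_linear]) (unfold K_eq, blast)
  then have "\<exists>h. linear_map R (H0V n) (fobj V n) h \<and> (\<forall>v\<in>C n. h (cl n v) = p n v)"
    by (simp add: linear_map_def)
  from someI_ex[OF this, folded H0_to_prim_def] show "linear_map R (H0V n) (fobj V n) (H0_to_prim n)"
    "v \<in> C n \<Longrightarrow> H0_to_prim n (cl n v) = p n v" by blast+
qed

lemma bij_H0_to_prim: "bij_betw (H0_to_prim n) (carrier (H0V n)) (prim n)"
  unfolding bij_betw_def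
proof
  show "inj_on (H0_to_prim n) (carrier (H0V n))"
  proof (rule inj_onI)
    fix x y assume "x \<in> carrier (H0V n)" "y \<in> carrier (H0V n)" and eq: "H0_to_prim n x = H0_to_prim n y"
    then obtain v w where v: "v \<in> C n" "w \<in> C n" "x = cl n v" "y = cl n w" by (auto simp: Q.carrier_quot)
    then have "p n (v \<ominus>\<^bsub>fobj V n\<^esub> w) = \<zero>\<^bsub>fobj V n\<^esub>"
      using eq by (simp add: H0_to_prim_cl linear_map_diff[OF q_linear mV mV] V.M.diff_eq_zero_iff)
    then have "v \<ominus>\<^bsub>fobj V n\<^esub> w \<in> K n"
      unfolding K_eq mem_Collect_eq using v by (intro conjI V.M.minus_closed)
    then show "x = y" using v by (simp add: Q.cls_eq_iff)
  qed
  show "H0_to_prim n ` carrier (H0V n) = prim n"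
  proof
    show "H0_to_prim n ` carrier (H0V n) \<subseteq> prim n"
      by (auto simp: Q.carrier_quot H0_to_prim_cl p_in_prim)
    show "prim n \<subseteq> H0_to_prim n ` carrier (H0V n)"
    proof
      fix v assume v: "v \<in> prim n"
      then have "v = H0_to_prim n (cl n v)" by (simp add: H0_to_prim_cl prim_closed p_prim)
      then show "v \<in> H0_to_prim n ` carrier (H0V n)"
        using prim_closed[OF v] by (simp add: Q.carrier_quot)
    qed
  qed
qed

lemma H0_to_prim_equivariant:
  assumes w: "w \<in> fi_hom W n n" and x: "x \<in> carrier (H0V n)"
  shows "H0_to_prim n (act (H0V n) w x) = fmor V n n (extend0 n w) (H0_to_prim n x)"
proof -
  obtain y where y: "y \<in> C n" "x = cl n y" using x by (auto simp: Q.carrier_quot)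
  then show ?thesis using fmor_closed[OF extend0_sharp[OF w]]
    by (simp add: act_cl[OF w] H0_to_prim_cl p_equivariant[OF w] del: H0_sel)
qed

end

context sharp_mor
begin

lemma mor_K: "v \<in> A.K n \<Longrightarrow> \<eta> n v \<in> B.K n"
  unfolding A.K_eq B.K_eq using closed mor_q[of v n n] zero[of n] by auto

lemma H0_map_cl: "v \<in> A.C n \<Longrightarrow>
    H0_map R W (restrict_to_fi V) (restrict_to_fi V') \<eta> n (A.cl n v) = B.cl n (\<eta> n v)"
  unfolding H0_map_def
  using quot_map_cls[OF A.Q.quotient_axioms B.Q.quotient_axioms linear mor_K] by simp

lemma H0_map_rep_hom: "H0_map R W (restrict_to_fi V) (restrict_to_fi V') \<eta> n
    \<in> rep_hom R (weyl_group W n) (A.H0V n) (B.H0V n)"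
  unfolding rep_hom_def weyl_group_carrier
proof (intro CollectI conjI ballI)
  show "H0_map R W (restrict_to_fi V) (restrict_to_fi V') \<eta> n \<in> lin_hom R (A.H0V n) (B.H0V n)"
    using quot_map_lin_hom[OF A.Q.quotient_axioms B.Q.quotient_axioms linear mor_K]
    by (simp add: lin_hom_iff linear_map_def H0_map_def)
  fix w x assume w: "w \<in> fi_hom W n n" and "x \<in> carrier (A.H0V n)"
  then obtain y where y: "y \<in> A.C n" "x = A.cl n y" by (auto simp: A.Q.carrier_quot)
  then show "H0_map R W (restrict_to_fi V) (restrict_to_fi V') \<eta> n (act (A.H0V n) w x) =
      act (B.H0V n) w (H0_map R W (restrict_to_fi V) (restrict_to_fi V') \<eta> n x)"
    using A.fmor_closed[OF extend0_sharp[OF w]] closed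
    by (simp add: A.act_cl[OF w] B.act_cl[OF w] H0_map_cl natural[OF extend0_sharp[OF w]]
        del: A.H0_sel B.H0_sel)
qed

lemma H0_to_prim_natural:
  assumes "x \<in> carrier (A.H0V n)"
  shows "B.H0_to_prim n (H0_map R W (restrict_to_fi V) (restrict_to_fi V') \<eta> n x) = \<eta> n (A.H0_to_prim n x)"
proof -
  obtain y where y: "y \<in> A.C n" "x = A.cl n y" using assms by (auto simp: A.Q.carrier_quot)
  then show ?thesis by (simp add: H0_map_cl A.H0_to_prim_cl B.H0_to_prim_cl closed mor_q)
qed

end

section \<open>Categories of modules, of functors and of FB-modules\<close>

lemma category_kmod:
  fixes R :: "('k, 'r) ring_scheme"
  shows "category (kmod R :: (('k, 'u) module, 'u \<Rightarrow> 'u) cat)"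
proof
  fix L M N P :: "('k, 'u) module" and f g h :: "'u \<Rightarrow> 'u"
  assume "f \<in> mor (kmod R) L M" "g \<in> mor (kmod R) M N" "h \<in> mor (kmod R) N P"
  then show "cmp (kmod R) L N P h (cmp (kmod R) L M N g f) = cmp (kmod R) L M P (cmp (kmod R) M N P h g) f"
    by (auto simp: compose_def fun_eq_iff lin_hom_iff linear_map_def)
next
  fix M :: "('k, 'u) module" assume "M \<in> ob (kmod R)"
  then show "idm (kmod R) M \<in> mor (kmod R) M M"
    using linear_map_restrict[OF _ linear_map_id] by simp
next
  fix L M N :: "('k, 'u) module" and f g :: "'u \<Rightarrow> 'u"
  assume "L \<in> ob (kmod R)" "f \<in> mor (kmod R) L M" "g \<in> mor (kmod R) M N"
  then show "cmp (kmod R) L M N g f \<in> mor (kmod R) L N" by (simp add: lin_hom_compose)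
next
  fix M N :: "('k, 'u) module" and f :: "'u \<Rightarrow> 'u"
  assume "f \<in> mor (kmod R) M N"
  then show "cmp (kmod R) M M N f (idm (kmod R) M) = f" "cmp (kmod R) M N N (idm (kmod R) N) f = f"
    by (auto simp: compose_def fun_eq_iff lin_hom_iff linear_map_def extensional_def)
qed

lemma functor_cat_sel [simp]:
  "ob (functor_cat C D) = {F. is_functor C D F}"
  "mor (functor_cat C D) F G = {\<eta> \<in> extensional (ob C). is_nat_trans C D F G \<eta>}"
  "idm (functor_cat C D) F = (\<lambda>X\<in>ob C. idm D (fobj F X))"
  "cmp (functor_cat C D) F G H \<beta> \<alpha> =
     (\<lambda>X\<in>ob C. cmp D (fobj F X) (fobj G X) (fobj H X) (\<beta> X) (\<alpha> X))"
  by (simp_all add: functor_cat_def)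

lemma category_functor_cat:
  assumes "category D" shows "category (functor_cat C D)"
proof -
  interpret D: category D by fact
  have ob: "fobj F X \<in> ob D" if "is_functor C D F" "X \<in> ob C" for F X
    using that by (simp add: is_functor_def)
  have mor: "fmor F X Y f \<in> mor D (fobj F X) (fobj F Y)"
    if "is_functor C D F" "X \<in> ob C" "Y \<in> ob C" "f \<in> mor C X Y" for F X Y f
    using that by (simp add: is_functor_def)
  have comp: "\<eta> X \<in> mor D (fobj F X) (fobj G X)" if "is_nat_trans C D F G \<eta>" "X \<in> ob C" for F G \<eta> X
    using that by (simp add: is_nat_trans_def)
  have nat: "cmp D (fobj F X) (fobj F Y) (fobj G Y) (\<eta> Y) (fmor F X Y f) =
      cmp D (fobj F X) (fobj G X) (fobj G Y) (fmor G X Y f) (\<eta> X)"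
    if "is_nat_trans C D F G \<eta>" "X \<in> ob C" "Y \<in> ob C" "f \<in> mor C X Y" for F G \<eta> X Y f
    using that by (simp add: is_nat_trans_def)
  note [simp] = ob mor comp D.idm_closed D.cmp_closed D.cmp_idm_left D.cmp_idm_right
  show ?thesis
  proof
    fix F assume "F \<in> ob (functor_cat C D)"
    then show "idm (functor_cat C D) F \<in> mor (functor_cat C D) F F"
      by (simp add: is_nat_trans_def)
  next
    fix F G H \<alpha> \<beta>
    assume F: "F \<in> ob (functor_cat C D)" "G \<in> ob (functor_cat C D)" "H \<in> ob (functor_cat C D)"
      and ab: "\<alpha> \<in> mor (functor_cat C D) F G" "\<beta> \<in> mor (functor_cat C D) G H"
    have "is_nat_trans C D F H (cmp (functor_cat C D) F G H \<beta> \<alpha>)"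
      unfolding is_nat_trans_def
    proof (intro conjI ballI)
      fix X Y f assume XY: "X \<in> ob C" "Y \<in> ob C" "f \<in> mor C X Y"
      let ?F = "fobj F" and ?G = "fobj G" and ?H = "fobj H"
      have "cmp D (?F X) (?F Y) (?H Y) (cmp D (?F Y) (?G Y) (?H Y) (\<beta> Y) (\<alpha> Y)) (fmor F X Y f) =
          cmp D (?F X) (?G Y) (?H Y) (\<beta> Y) (cmp D (?F X) (?F Y) (?G Y) (\<alpha> Y) (fmor F X Y f))"
        using F ab XY by (intro D.cmp_assoc[symmetric]) auto
      also have "\<dots> = cmp D (?F X) (?G Y) (?H Y) (\<beta> Y) (cmp D (?F X) (?G X) (?G Y) (fmor G X Y f) (\<alpha> X))"
        using nat[of F G \<alpha> X Y f] ab XY by simp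
      also have "\<dots> = cmp D (?F X) (?G X) (?H Y) (cmp D (?G X) (?G Y) (?H Y) (\<beta> Y) (fmor G X Y f)) (\<alpha> X)"
        using F ab XY by (intro D.cmp_assoc) auto
      also have "\<dots> = cmp D (?F X) (?G X) (?H Y) (cmp D (?G X) (?H X) (?H Y) (fmor H X Y f) (\<beta> X)) (\<alpha> X)"
        using nat[of G H \<beta> X Y f] ab XY by simp
      also have "\<dots> = cmp D (?F X) (?H X) (?H Y) (fmor H X Y f) (cmp D (?F X) (?G X) (?H X) (\<beta> X) (\<alpha> X))"
        using F ab XY by (intro D.cmp_assoc[symmetric]) auto
      finally show "cmp D (?F X) (?F Y) (?H Y) (cmp (functor_cat C D) F G H \<beta> \<alpha> Y) (fmor F X Y f) =
          cmp D (?F X) (?H X) (?H Y) (fmor H X Y f) (cmp (functor_cat C D) F G H \<beta> \<alpha> X)"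
        using XY by simp
    qed (use F ab in \<open>auto intro: D.cmp_closed\<close>)
    then show "cmp (functor_cat C D) F G H \<beta> \<alpha> \<in> mor (functor_cat C D) F H" by simp
  next
    fix F G \<alpha> assume F: "F \<in> ob (functor_cat C D)" "G \<in> ob (functor_cat C D)"
      and a: "\<alpha> \<in> mor (functor_cat C D) F G"
    show "cmp (functor_cat C D) F F G \<alpha> (idm (functor_cat C D) F) = \<alpha>"
      "cmp (functor_cat C D) F G G (idm (functor_cat C D) G) \<alpha> = \<alpha>"
      by (rule extensionalityI[of _ "ob C"]; use F a in auto)+
  next
    fix F G H I \<alpha> \<beta> \<gamma>
    assume F: "F \<in> ob (functor_cat C D)" "G \<in> ob (functor_cat C D)" "H \<in> ob (functor_cat C D)"
        "I \<in> ob (functor_cat C D)"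
      and a: "\<alpha> \<in> mor (functor_cat C D) F G" "\<beta> \<in> mor (functor_cat C D) G H" "\<gamma> \<in> mor (functor_cat C D) H I"
    show "cmp (functor_cat C D) F H I \<gamma> (cmp (functor_cat C D) F G H \<beta> \<alpha>) =
        cmp (functor_cat C D) F G I (cmp (functor_cat C D) G H I \<gamma> \<beta>) \<alpha>"
      by (rule extensionalityI[of _ "ob C"]; use F a in \<open>auto intro: D.cmp_assoc\<close>)
  qed
qed

lemma FB_Mod_sel [simp]:
  "ob (FB_Mod R W) = {U. fb_module R W U}"
  "mor (FB_Mod R W) U U' = {\<phi>. \<forall>m. \<phi> m \<in> rep_hom R (weyl_group W m) (U m) (U' m)}"
  "idm (FB_Mod R W) U = (\<lambda>m. \<lambda>x\<in>carrier (U m). x)"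
  "cmp (FB_Mod R W) U U' U'' \<psi> \<phi> = (\<lambda>m. compose (carrier (U m)) (\<psi> m) (\<phi> m))"
  by (simp_all add: FB_Mod_def)

lemma representation_act_closed:
  "representation R G U \<Longrightarrow> g \<in> carrier G \<Longrightarrow> u \<in> carrier U \<Longrightarrow> act U g u \<in> carrier U"
  by (auto simp: representation_def lin_hom_iff linear_map_def)

lemma rep_homD:
  assumes "h \<in> rep_hom R G U U'"
  shows "linear_map R U U' h" "h \<in> extensional (carrier U)" "x \<in> carrier U \<Longrightarrow> h x \<in> carrier U'"
    "g \<in> carrier G \<Longrightarrow> x \<in> carrier U \<Longrightarrow> h (act U g x) = act U' g (h x)"
  using assms by (simp_all add: rep_hom_def lin_hom_iff linear_map_def)

lemma rep_homI:
  assumes "representation R G U" "linear_map R U U' h"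
    "\<And>g x. g \<in> carrier G \<Longrightarrow> x \<in> carrier U \<Longrightarrow> h (act U g x) = act U' g (h x)"
  shows "restrict h (carrier U) \<in> rep_hom R G U U'"
  using assms linear_map_restrict[of R U U' h] representation_act_closed[OF assms(1)]
  by (simp add: rep_hom_def representation_def)

lemma category_FB_Mod:
  fixes R :: "('k, 'r) ring_scheme"
  shows "category (FB_Mod R W :: (('k, 'u) fb_module, nat \<Rightarrow> 'u \<Rightarrow> 'u) cat)"
proof
  fix U assume U: "U \<in> ob (FB_Mod R W)"
  then show "idm (FB_Mod R W) U \<in> mor (FB_Mod R W) U U"
    by (auto simp: fb_module_def intro: rep_homI[OF _ linear_map_id])
next
  fix U U' U'' \<phi> \<psi>
  assume U: "U \<in> ob (FB_Mod R W)"
    and m: "\<phi> \<in> mor (FB_Mod R W) U U'" "\<psi> \<in> mor (FB_Mod R W) U' U''"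
  have "compose (carrier (U m)) (\<psi> m) (\<phi> m) \<in> rep_hom R (weyl_group W m) (U m) (U'' m)" for m
  proof -
    have \<phi>: "\<phi> m \<in> rep_hom R (weyl_group W m) (U m) (U' m)"
      and \<psi>: "\<psi> m \<in> rep_hom R (weyl_group W m) (U' m) (U'' m)" using m by auto
    show ?thesis unfolding compose_def
      by (rule rep_homI[OF _ linear_map_comp[OF rep_homD(1)[OF \<phi>] rep_homD(1)[OF \<psi>]]])
        (use U in \<open>simp_all add: fb_module_def rep_homD(3,4)[OF \<phi>] rep_homD(4)[OF \<psi>]\<close>)
  qed
  then show "cmp (FB_Mod R W) U U' U'' \<psi> \<phi> \<in> mor (FB_Mod R W) U U''" by simp
next
  fix U U' \<phi> assume U: "U \<in> ob (FB_Mod R W)" "U' \<in> ob (FB_Mod R W)" and m: "\<phi> \<in> mor (FB_Mod R W) U U'"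
  have \<phi>: "\<phi> m \<in> rep_hom R (weyl_group W m) (U m) (U' m)" for m using m by simp
  have "compose (carrier (U m)) (\<phi> m) (\<lambda>x\<in>carrier (U m). x) = \<phi> m"
    "compose (carrier (U m)) (\<lambda>x\<in>carrier (U' m). x) (\<phi> m) = \<phi> m" for m
    using rep_homD(2,3)[OF \<phi>[of m]] by (auto simp: compose_def fun_eq_iff extensional_def)
  then show "cmp (FB_Mod R W) U U U' \<phi> (idm (FB_Mod R W) U) = \<phi>"
    "cmp (FB_Mod R W) U U' U' (idm (FB_Mod R W) U') \<phi> = \<phi>" by simp_all
next
  fix U U' U'' U''' :: "('k, 'u) fb_module" and \<phi> \<psi> \<chi> :: "nat \<Rightarrow> 'u \<Rightarrow> 'u"
  assume m: "\<phi> \<in> mor (FB_Mod R W) U U'"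
  have \<phi>: "\<phi> m \<in> rep_hom R (weyl_group W m) (U m) (U' m)" for m using m by simp
  have "compose (carrier (U m)) (\<chi> m) (compose (carrier (U m)) (\<psi> m) (\<phi> m)) =
      compose (carrier (U m)) (compose (carrier (U' m)) (\<chi> m) (\<psi> m)) (\<phi> m)" for m
    using rep_homD(3)[OF \<phi>[of m]] by (auto simp: compose_def fun_eq_iff)
  then show "cmp (FB_Mod R W) U U'' U''' \<chi> (cmp (FB_Mod R W) U U' U'' \<psi> \<phi>) =
      cmp (FB_Mod R W) U U' U''' (cmp (FB_Mod R W) U' U'' U''' \<chi> \<psi>) \<phi>" by simp
qed

lemma rep_hom_inv_into:
  assumes U: "representation R G U" and U': "representation R G U'"
    and h: "h \<in> rep_hom R G U U'" and bij: "bij_betw h (carrier U) (carrier U')"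
  shows "restrict (inv_into (carrier U) h) (carrier U') \<in> rep_hom R G U' U"
proof (rule rep_homI[OF U' linear_map_inv_into[OF _ _ rep_homD(1)[OF h] bij]])
  show "module R U" "module R U'" using U U' by (simp_all add: representation_def)
  fix g x assume g: "g \<in> carrier G" and x: "x \<in> carrier U'"
  let ?y = "inv_into (carrier U) h x"
  have y: "?y \<in> carrier U" "h ?y = x"
    using bij x by (auto simp: bij_betw_def intro: inv_into_into f_inv_into_f)
  have "h (act U g ?y) = act U' g x" using rep_homD(4)[OF h g y(1)] y(2) by simp
  then show "inv_into (carrier U) h (act U' g x) = act U g ?y"
    using bij_betw_inv_into_left[OF bij representation_act_closed[OF U g y(1)]] by simp
qed

lemma compose_inv_into:
  assumes "bij_betw h A B"
  shows "compose A (restrict (inv_into A h) B) h = (\<lambda>x\<in>A. x)"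
    "compose B h (restrict (inv_into A h) B) = (\<lambda>x\<in>B. x)"
  using assms by (auto simp: compose_def fun_eq_iff bij_betw_def intro: f_inv_into_f)

lemma is_iso_FB_Mod:
  assumes "fb_module R W U" "fb_module R W U'" and \<phi>: "\<phi> \<in> mor (FB_Mod R W) U U'"
    and bij: "\<And>n. bij_betw (\<phi> n) (carrier (U n)) (carrier (U' n))"
  shows "is_iso (FB_Mod R W) U U' \<phi>"
  unfolding is_iso_def
proof (intro conjI bexI)
  let ?g = "\<lambda>n. restrict (inv_into (carrier (U n)) (\<phi> n)) (carrier (U' n))"
  show "?g \<in> mor (FB_Mod R W) U' U"
    using assms by (auto simp: fb_module_def intro: rep_hom_inv_into[OF _ _ _ bij])
  show "cmp (FB_Mod R W) U U' U ?g \<phi> = idm (FB_Mod R W) U"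
    "cmp (FB_Mod R W) U' U U' \<phi> ?g = idm (FB_Mod R W) U'"
    by (simp_all add: compose_inv_into[OF bij])
qed fact

lemma sharp_Mod_sel [simp]:
  "ob (sharp_Mod R W) = {V. sharp_module R W V}"
  "idm (sharp_Mod R W) V = (\<lambda>n. \<lambda>x\<in>carrier (fobj V n). x)"
  "cmp (sharp_Mod R W) V V' V'' \<beta> \<alpha> = (\<lambda>n. compose (carrier (fobj V n)) (\<beta> n) (\<alpha> n))"
  by (simp_all add: sharp_Mod_def sharp_module_def fun_eq_iff)

lemma sharp_Mod_mor:
  assumes "sharp_module R W V" "sharp_module R W V'"
  shows "\<eta> \<in> mor (sharp_Mod R W) V V' \<longleftrightarrow>
    (\<forall>n. \<eta> n \<in> extensional (carrier (fobj V n))) \<and> sharp_morphism R W V V' \<eta>"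
proof -
  interpret A: sharp_mod R W V by (rule sharp_mod.intro) fact
  interpret B: sharp_mod R W V' by (rule sharp_mod.intro) fact
  have "compose (A.C m) (\<eta> n) (fmor V m n f) = compose (A.C m) (fmor V' m n f) (\<eta> m) \<longleftrightarrow>
      (\<forall>x\<in>A.C m. \<eta> n (fmor V m n f x) = fmor V' m n f (\<eta> m x))" for m n f
    unfolding compose_def restrict_def fun_eq_iff by auto
  then show ?thesis
    unfolding sharp_morphism_def by (auto simp: sharp_Mod_def is_nat_trans_def lin_hom_iff)
qed

lemma is_iso_sharp_Mod:
  assumes V: "sharp_module R W V" "sharp_module R W V'" and \<eta>: "\<eta> \<in> mor (sharp_Mod R W) V V'"
    and bij: "\<And>n. bij_betw (\<eta> n) (carrier (fobj V n)) (carrier (fobj V' n))"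
  shows "is_iso (sharp_Mod R W) V V' \<eta>"
  unfolding is_iso_def
proof (intro conjI bexI)
  interpret A: sharp_mod R W V by (rule sharp_mod.intro) fact
  interpret B: sharp_mod R W V' by (rule sharp_mod.intro) fact
  let ?g = "\<lambda>n. restrict (inv_into (A.C n) (\<eta> n)) (B.C n)"
  have m: "sharp_morphism R W V V' \<eta>" using \<eta> sharp_Mod_mor[OF V] by blast
  have lin: "linear_map R (fobj V n) (fobj V' n) (\<eta> n)" for n using m by (simp add: sharp_morphism_def)
  have "linear_map R (fobj V' n) (fobj V n) (?g n)" for n
    using linear_map_restrict[OF B.mV linear_map_inv_into[OF A.mV B.mV lin bij]] by (simp add: lin_hom_iff)
  moreover have "?g n (fmor V' m n f x) = fmor V m n f (?g m x)"
    if f: "f \<in> sharp_hom W m n" and x: "x \<in> B.C m" for m n f x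
  proof -
    have y: "?g m x \<in> A.C m" "\<eta> m (?g m x) = x"
      using bij[of m] x by (auto simp: bij_betw_def intro: inv_into_into f_inv_into_f)
    have "\<eta> n (fmor V m n f (?g m x)) = fmor V' m n f x"
      using m f y by (simp add: sharp_morphism_def)
    then show ?thesis
      using bij_betw_inv_into_left[OF bij A.fmor_closed[OF f y(1)]] B.fmor_closed[OF f x] by simp
  qed
  ultimately show "?g \<in> mor (sharp_Mod R W) V' V"
    unfolding sharp_Mod_mor[OF V(2,1)] sharp_morphism_def by auto
  show "cmp (sharp_Mod R W) V V' V ?g \<eta> = idm (sharp_Mod R W) V"
    "cmp (sharp_Mod R W) V' V V' \<eta> ?g = idm (sharp_Mod R W) V'"
    by (simp_all add: compose_inv_into[OF bij])
qed fact

lemma sharp_morphism_comp: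
  "sharp_morphism R W V V' \<eta> \<Longrightarrow> sharp_morphism R W V' V'' \<zeta> \<Longrightarrow>
    sharp_morphism R W V V'' (\<lambda>n x. \<zeta> n (\<eta> n x))"
  unfolding sharp_morphism_def linear_map_def by simp

section \<open>Relabelling carriers\<close>

lemma inj_label:
  assumes "\<exists>f :: 'b \<Rightarrow> 'u. inj_on f A" shows "inj_on (label A :: 'b \<Rightarrow> 'u) A"
  unfolding label_def by (rule someI_ex[OF assms])

lemma unlabel_label:
  assumes "\<exists>f :: 'b \<Rightarrow> 'u. inj_on f A" "x \<in> A" shows "unlabel A (label A x :: 'u) = x"
  unfolding unlabel_def using inj_label[OF assms(1)] assms(2) by (rule inv_into_f_f)

lemma relabel_map_label:
  assumes "\<exists>f :: 'b \<Rightarrow> 'u. inj_on f A" "x \<in> A"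
  shows "relabel_map A B h (label A x :: 'u) = label B (h x)"
  using assms by (simp add: relabel_map_def unlabel_label)

lemma relabel_module_sel [simp]:
  "carrier (relabel_module M) = label (carrier M) ` carrier M"
  "zero (relabel_module M) = label (carrier M) \<zero>\<^bsub>M\<^esub>"
  "add (relabel_module M) = (\<lambda>x y. label (carrier M) (unlabel (carrier M) x \<oplus>\<^bsub>M\<^esub> unlabel (carrier M) y))"
  "smult (relabel_module M) = (\<lambda>c x. label (carrier M) (c \<odot>\<^bsub>M\<^esub> unlabel (carrier M) x))"
  by (simp_all add: relabel_module_def Let_def)

lemma
  fixes M :: "('k, 'b, 'x) module_scheme"
  assumes m: "module R M" and ex: "\<exists>f :: 'b \<Rightarrow> 'u. inj_on f (carrier M)"
  shows module_relabel: "module R (relabel_module M :: ('k, 'u) module)"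
    and label_linear: "linear_map R M (relabel_module M :: ('k, 'u) module) (label (carrier M))"
    and unlabel_linear: "linear_map R (relabel_module M :: ('k, 'u) module) M (unlabel (carrier M))"
proof -
  interpret M: module R M by fact
  show l: "linear_map R M (relabel_module M :: ('k, 'u) module) (label (carrier M))"
    by rule (simp_all add: unlabel_label[OF ex])
  show "module R (relabel_module M :: ('k, 'u) module)"
    by (rule module_surj_image[OF m, of "label (carrier M)"]) (simp_all add: unlabel_label[OF ex])
  show "linear_map R (relabel_module M :: ('k, 'u) module) M (unlabel (carrier M))"
    by rule (auto simp: unlabel_label[OF ex])
qed

lemma bij_unlabel:
  assumes "\<exists>f :: 'b \<Rightarrow> 'u. inj_on f A"
  shows "bij_betw (unlabel A :: 'u \<Rightarrow> 'b) (label A ` A) A"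
  unfolding unlabel_def using inj_label[OF assms] by (intro bij_betw_inv_into) (simp add: bij_betw_def)

lemma relabel_map_eq: "relabel_map A B h = (\<lambda>y\<in>label A ` A. label B (h (unlabel A y)))"
  by (simp add: relabel_map_def)

lemma relabel_map_linear:
  fixes M :: "('k, 'b, 'x) module_scheme" and N :: "('k, 'c, 'y) module_scheme"
  assumes "module R M" "module R N" "\<exists>f :: 'b \<Rightarrow> 'u. inj_on f (carrier M)"
    "\<exists>f :: 'c \<Rightarrow> 'u. inj_on f (carrier N)" "linear_map R M N h"
  shows "relabel_map (carrier M) (carrier N) h \<in>
    lin_hom R (relabel_module M :: ('k, 'u) module) (relabel_module N :: ('k, 'u) module)"
  using linear_map_restrict[OF module_relabel[OF assms(1,3)]
      linear_map_comp[OF linear_map_comp[OF unlabel_linear[OF assms(1,3)] assms(5)] label_linear[OF assms(2,4)]]]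
  by (simp add: relabel_map_eq)

lemma relabel_fi_sel [simp]:
  "fobj (relabel_fi V) n = relabel_module (fobj V n)"
  "fmor (relabel_fi V) m n f = relabel_map (carrier (fobj V m)) (carrier (fobj V n)) (fmor V m n f)"
  by (simp_all add: relabel_fi_def)

lemma
  fixes V :: "('k, 'b) fi_functor"
  assumes "sharp_mod R W V" and ex: "\<And>n. \<exists>f :: 'b \<Rightarrow> 'u. inj_on f (carrier (fobj V n))"
  shows sharp_module_relabel: "sharp_module R W (relabel_fi V :: ('k, 'u) fi_functor)"
    and sharp_morphism_label: "sharp_morphism R W V (relabel_fi V :: ('k, 'u) fi_functor)
      (\<lambda>n. label (carrier (fobj V n)))"
    and sharp_morphism_unlabel: "sharp_morphism R W (relabel_fi V :: ('k, 'u) fi_functor) V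
      (\<lambda>n. unlabel (carrier (fobj V n)))"
proof -
  interpret V: sharp_mod R W V by fact
  show "sharp_module R W (relabel_fi V :: ('k, 'u) fi_functor)"
    unfolding sharp_module_def is_functor_def sharp_cat_sel kmod_sel
  proof (intro conjI ballI)
    fix n
    show "fobj (relabel_fi V :: ('k, 'u) fi_functor) n \<in> {M. module R M}"
      using module_relabel[OF V.mV ex] by simp
    show "fmor (relabel_fi V :: ('k, 'u) fi_functor) n n (\<lambda>a\<in>signed0 n. a) =
        (\<lambda>x\<in>carrier (fobj (relabel_fi V :: ('k, 'u) fi_functor) n). x)"
      by (auto simp: relabel_map_eq fun_eq_iff unlabel_label[OF ex] V.fmor_id)
  next
    fix m n f assume "f \<in> sharp_hom W m n"
    then show "fmor (relabel_fi V :: ('k, 'u) fi_functor) m n f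
      \<in> lin_hom R (fobj (relabel_fi V) m) (fobj (relabel_fi V) n)"
      using relabel_map_linear[OF V.mV V.mV ex ex V.fmor_linear] by simp
  next
    fix l m n f g assume f: "f \<in> sharp_hom W l m" and g: "g \<in> sharp_hom W m n"
    show "fmor (relabel_fi V :: ('k, 'u) fi_functor) l n (compose (signed0 l) g f) =
        compose (carrier (fobj (relabel_fi V :: ('k, 'u) fi_functor) l))
          (fmor (relabel_fi V) m n g) (fmor (relabel_fi V) l m f)"
    proof
      fix y :: 'u
      show "fmor (relabel_fi V) l n (compose (signed0 l) g f) y =
        compose (carrier (fobj (relabel_fi V :: ('k, 'u) fi_functor) l))
          (fmor (relabel_fi V) m n g) (fmor (relabel_fi V) l m f) y"
      proof (cases "y \<in> label (V.C l) ` V.C l")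
        case True
        then obtain x where "x \<in> V.C l" "y = label (V.C l) x" by blast
        then show ?thesis
          by (simp add: compose_eq relabel_map_label[OF ex] V.fmor_closed[OF f] V.fmor_compose[OF f g])
      next
        case False
        then show ?thesis by (simp add: relabel_map_eq compose_def)
      qed
    qed
  qed
  show "sharp_morphism R W V (relabel_fi V :: ('k, 'u) fi_functor) (\<lambda>n. label (carrier (fobj V n)))"
    using label_linear[OF V.mV ex] by (simp add: sharp_morphism_def relabel_map_label[OF ex])
  show "sharp_morphism R W (relabel_fi V :: ('k, 'u) fi_functor) V (\<lambda>n. unlabel (carrier (fobj V n)))"
    using unlabel_linear[OF V.mV ex] V.fmor_closed
    by (auto simp: sharp_morphism_def relabel_map_label[OF ex] unlabel_label[OF ex])
qed

lemma relabel_rep_sel [simp]: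
  "carrier (relabel_rep U) = label (carrier U) ` carrier U"
  "zero (relabel_rep U) = label (carrier U) \<zero>\<^bsub>U\<^esub>"
  "add (relabel_rep U) = (\<lambda>x y. label (carrier U) (unlabel (carrier U) x \<oplus>\<^bsub>U\<^esub> unlabel (carrier U) y))"
  "smult (relabel_rep U) = (\<lambda>c x. label (carrier U) (c \<odot>\<^bsub>U\<^esub> unlabel (carrier U) x))"
  "act (relabel_rep U) g = relabel_map (carrier U) (carrier U) (act U g)"
  by (simp_all add: relabel_rep_def)

lemma linear_map_relabel_rep:
  "linear_map R (relabel_rep U) N h \<longleftrightarrow> linear_map R (relabel_module U) N h"
  "linear_map R N (relabel_rep U) h' \<longleftrightarrow> linear_map R N (relabel_module U) h'"
  by (simp_all add: linear_map_def)

lemma representation_relabel: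
  fixes U :: "('k, 'b, 'g) rep"
  assumes U: "representation R G U" and ex: "\<exists>f :: 'b \<Rightarrow> 'u. inj_on f (carrier U)"
  shows "representation R G (relabel_rep U :: ('k, 'u, 'g) rep)"
  unfolding representation_def
proof (intro conjI ballI)
  have m: "module R U" using U by (simp add: representation_def)
  note ac = representation_act_closed[OF U]
  show "module R (relabel_rep U :: ('k, 'u, 'g) rep)"
    unfolding relabel_rep_def by (rule module_extend[OF module_relabel[OF m ex]])
  fix g assume g: "g \<in> carrier G"
  have "linear_map R U U (act U g)" using U g by (simp add: representation_def lin_hom_iff)
  from relabel_map_linear[OF m m ex ex this]
  show "act (relabel_rep U) g \<in> lin_hom R (relabel_rep U) (relabel_rep U :: ('k, 'u, 'g) rep)"
    by (simp add: lin_hom_iff linear_map_def)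
  fix h x assume h: "h \<in> carrier G" and "x \<in> carrier (relabel_rep U :: ('k, 'u, 'g) rep)"
  then obtain y where "y \<in> carrier U" "x = label (carrier U) y" by auto
  then show "act (relabel_rep U) (g \<otimes>\<^bsub>G\<^esub> h) x = act (relabel_rep U) g (act (relabel_rep U) h x)"
    using U g h ac by (simp add: relabel_map_label[OF ex] representation_def)
next
  fix x assume "x \<in> carrier (relabel_rep U :: ('k, 'u, 'g) rep)"
  then obtain y where "y \<in> carrier U" "x = label (carrier U) y" by auto
  then show "act (relabel_rep U) \<one>\<^bsub>G\<^esub> x = x"
    using U by (simp add: relabel_map_label[OF ex] representation_def)
qed

section \<open>Cardinality of the induced modules\<close>

text \<open>An infinite type is equinumerous with its square, so elements of a list can be merged one by one.\<close>

lemma inj_lists_of_length: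
  assumes "infinite (UNIV :: 'u set)"
  shows "\<exists>f :: 'u list \<Rightarrow> 'u. inj_on f {xs. length xs = k}"
proof -
  obtain pr :: "'u \<times> 'u \<Rightarrow> 'u" where pr: "inj pr"
    using iffD2[OF card_of_ordIso card_of_Times_same_infinite[OF assms]] by (auto simp: bij_betw_def)
  show ?thesis
  proof (induction k)
    case 0
    show ?case by (auto simp: inj_on_def)
  next
    case (Suc k)
    then obtain f :: "'u list \<Rightarrow> 'u" where f: "inj_on f {xs. length xs = k}" by blast
    have "inj_on (\<lambda>xs. pr (hd xs, f (tl xs))) {xs. length xs = Suc k}"
    proof (rule inj_onI)
      fix xs ys :: "'u list"
      assume "xs \<in> {xs. length xs = Suc k}" "ys \<in> {xs. length xs = Suc k}"
        and eq: "pr (hd xs, f (tl xs)) = pr (hd ys, f (tl ys))"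
      then obtain x xs' y ys' where xy: "xs = x # xs'" "ys = y # ys'" "length xs' = k" "length ys' = k"
        by (auto simp: length_Suc_conv)
      have "(hd xs, f (tl xs)) = (hd ys, f (tl ys))" using pr eq by (simp add: inj_eq)
      then show "xs = ys" using xy inj_onD[OF f, of xs' ys'] by simp
    qed
    then show ?case by blast
  qed
qed

text \<open>By \<open>zero_if_projections_zero\<close>, an element \<open>y\<close> of \<open>M(U)\<^sub>n\<close> is determined by the primitive elements
  \<open>p (f\<^sub>* y)\<close> for \<open>f\<close> from \<open>n\<close> to \<open>m \<le> n\<close>, that is by finitely many elements
  of modules \<open>U\<^sub>m\<close>, whose carriers lie in the given type.\<close>

lemma (in fb_mod) inj_on_M:
  assumes "infinite (UNIV :: 'u set)"
  shows "\<exists>f :: (nat \<Rightarrow> ('k, 'u) induced) \<Rightarrow> 'u. inj_on f (carrier (M n))"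
proof -
  let ?I = "SIGMA m:{..n}. sharp_hom W n m"
  have "finite ?I" using finite_sharp_hom by blast
  then obtain zs where zs: "set zs = ?I" using finite_list by blast
  obtain c :: "'u list \<Rightarrow> 'u" where c: "inj_on c {xs. length xs = length zs}"
    using inj_lists_of_length[OF assms] by blast
  \<comment> \<open>List the coordinates of \<open>y\<close> along an enumeration of the finite set of all such pairs \<open>(m, f)\<close>.\<close>
  define F where "F y = map (\<lambda>(m, f). top_part m (fmor (M_seq R W U) n m f y)) zs" for y
  have "inj_on (\<lambda>y. c (F y)) (carrier (M n))"
  proof (rule inj_onI)
    fix x y assume x: "x \<in> carrier (M n)" and y: "y \<in> carrier (M n)" and "c (F x) = c (F y)"
    then have "F x = F y" using inj_onD[OF c, of "F x" "F y"] by (simp add: F_def)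
    then have eq: "top_part m (fmor (M_seq R W U) n m f x) = top_part m (fmor (M_seq R W U) n m f y)"
      if "m \<le> n" "f \<in> sharp_hom W n m" for m f
      using that zs by (auto simp: F_def)
    have "x \<ominus>\<^bsub>M n\<^esub> y = \<zero>\<^bsub>M n\<^esub>"
    proof (rule MS.zero_if_projections_zero)
      show xy: "x \<ominus>\<^bsub>M n\<^esub> y \<in> carrier (M n)" using x y by (rule MS.V.M.minus_closed)
      fix m f assume mf: "m \<le> n" "f \<in> sharp_hom W n m"
      note L = M_fmor_linear[OF mf(2)]
      have c: "fmor (M_seq R W U) n m f x \<in> carrier (M m)" "fmor (M_seq R W U) n m f y \<in> carrier (M m)"
        using linear_mapD(1)[OF L] x y by simp_all
      have "top_part m (fmor (M_seq R W U) n m f (x \<ominus>\<^bsub>M n\<^esub> y)) = \<zero>\<^bsub>U m\<^esub>"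
        using eq[OF mf] linear_mapD(1)[OF top_part_linear c(2)]
        by (simp add: linear_map_diff[OF L module_M module_M x y]
            linear_map_diff[OF top_part_linear module_M mU c] abelian_group.diff_eq_zero_iff[OF module.axioms(2)[OF mU]])
      then show "MS.p m (fmor (M_seq R W U) n m f (x \<ominus>\<^bsub>M n\<^esub> y)) = \<zero>\<^bsub>M m\<^esub>"
        using p_eq_top_part[OF linear_mapD(1)[OF L xy]] linear_map_zero[OF gen_linear[OF fi_hom_id] mU module_M]
        by simp
    qed
    then show "x = y" using x y by (simp add: MS.V.M.diff_eq_zero_iff)
  qed
  then show ?thesis by blast
qed

section \<open>The functors M and H0\<close>

lemma fb_modI: "cring R \<Longrightarrow> U \<in> ob (FB_Mod R W) \<Longrightarrow> fb_mod R W U"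
  by (simp add: fb_mod_def)

lemma sharp_modI: "V \<in> ob (sharp_Mod R W) \<Longrightarrow> sharp_mod R W V"
  by (simp add: sharp_mod_def)

lemma relabel_map_id:
  assumes "\<exists>f :: 'b \<Rightarrow> 'u. inj_on f A" "\<And>x. x \<in> A \<Longrightarrow> h x = x"
  shows "relabel_map A A h = (\<lambda>y\<in>label A ` A. y :: 'u)"
  using assms(2) by (auto simp: relabel_map_eq fun_eq_iff unlabel_label[OF assms(1)])

lemma relabel_map_compose:
  assumes exA: "\<exists>f :: 'a \<Rightarrow> 'u. inj_on f A" and exB: "\<exists>f :: 'b \<Rightarrow> 'u. inj_on f B"
    and h: "\<And>x. x \<in> A \<Longrightarrow> h x \<in> B" and l: "\<And>x. x \<in> A \<Longrightarrow> l x = k (h x)"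
  shows "relabel_map A C l =
    compose (label A ` A) (relabel_map B C k) (relabel_map A B h :: 'u \<Rightarrow> 'u)"
proof
  fix y :: 'u
  show "relabel_map A C l y = compose (label A ` A) (relabel_map B C k) (relabel_map A B h) y"
  proof (cases "y \<in> label A ` A")
    case True
    then obtain x where "x \<in> A" "y = label A x" by blast
    then show ?thesis by (simp add: compose_eq relabel_map_label[OF exA] relabel_map_label[OF exB] h l)
  qed (simp add: relabel_map_eq compose_def)
qed

lemma sharp_morphism_relabel:
  fixes V :: "('k, 'b) fi_functor" and V' :: "('k, 'c) fi_functor"
  assumes "sharp_mod R W V" "sharp_mod R W V'" "sharp_morphism R W V V' \<eta>"
    and ex: "\<And>n. \<exists>f :: 'b \<Rightarrow> 'u. inj_on f (carrier (fobj V n))"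
    and ex': "\<And>n. \<exists>f :: 'c \<Rightarrow> 'u. inj_on f (carrier (fobj V' n))"
  shows "(\<lambda>n. relabel_map (carrier (fobj V n)) (carrier (fobj V' n)) (\<eta> n))
    \<in> mor (sharp_Mod R W) (relabel_fi V :: ('k, 'u) fi_functor) (relabel_fi V')"
proof -
  interpret A: sharp_mod R W V by fact
  interpret B: sharp_mod R W V' by fact
  interpret \<eta>: sharp_mor R W V V' \<eta>
    by (rule sharp_mor.intro) (use assms in \<open>simp_all add: sharp_mor_axioms_def\<close>)
  let ?V = "relabel_fi V :: ('k, 'u) fi_functor" and ?V' = "relabel_fi V' :: ('k, 'u) fi_functor"
  have s: "sharp_module R W ?V" "sharp_module R W ?V'"
    using sharp_module_relabel assms by blast+
  show ?thesis
    unfolding sharp_Mod_mor[OF s] sharp_morphism_def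
  proof (intro conjI allI ballI)
    fix n
    show "relabel_map (A.C n) (B.C n) (\<eta> n) \<in> extensional (carrier (fobj ?V n))"
      by (simp add: relabel_map_eq)
    show "linear_map R (fobj ?V n) (fobj ?V' n) (relabel_map (A.C n) (B.C n) (\<eta> n))"
      using relabel_map_linear[OF A.mV B.mV ex ex' \<eta>.linear] by (simp add: lin_hom_iff)
  next
    fix m n f x assume f: "f \<in> sharp_hom W m n" and "x \<in> carrier (fobj ?V m)"
    then obtain y where y: "y \<in> A.C m" "x = label (A.C m) y" by auto
    then show "relabel_map (A.C n) (B.C n) (\<eta> n) (fmor ?V m n f x) =
        fmor ?V' m n f (relabel_map (A.C m) (B.C m) (\<eta> m) x)"
      by (simp add: relabel_map_label[OF ex] relabel_map_label[OF ex'] A.fmor_closed[OF f] \<eta>.closed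
          \<eta>.natural[OF f])
  qed
qed

lemma M_seq_map_sharp_morphism:
  assumes "fb_mod R W U" "fb_mod R W U'" and \<phi>: "\<And>a. \<phi> a \<in> rep_hom R (weyl_group W a) (U a) (U' a)"
  shows "sharp_morphism R W (M_seq R W U) (M_seq R W U') (M_seq_map R W U U' \<phi>)"
proof -
  interpret A: fb_mod R W U by fact
  interpret B: fb_mod R W U' by fact
  have lin: "linear_map R (A.M n) (B.M n) (M_seq_map R W U U' \<phi> n)" for n
    using M_seq_map_lin_hom[OF assms] by (simp add: lin_hom_iff)
  note \<phi>D = rep_homD[OF \<phi>]
  have "M_seq_map R W U U' \<phi> n (fmor (M_seq R W U) m n f x) =
      fmor (M_seq R W U') m n f (M_seq_map R W U U' \<phi> m x)"
    if f: "f \<in> sharp_hom W m n" and x: "x \<in> carrier (A.M m)" for m n f x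
  proof (rule A.gen_eqI[OF B.module_M linear_map_comp[OF A.M_fmor_linear[OF f] lin]
        linear_map_comp[OF lin B.M_fmor_linear[OF f]] _ x])
    fix a s u assume s: "s \<in> A.H a m" and u: "u \<in> carrier (U a)"
    show "M_seq_map R W U U' \<phi> n (fmor (M_seq R W U) m n f (A.gen m a s u)) =
        fmor (M_seq R W U') m n f (M_seq_map R W U U' \<phi> m (A.gen m a s u))"
      using linear_map_zero[OF lin A.module_M B.module_M, of n]
      by (simp add: A.M_fmor_gen[OF f s u] B.M_fmor_gen[OF f s \<phi>D(3)[OF u]]
          M_seq_map_gen[OF assms s u] M_seq_map_gen[OF assms sharp_fi_compose[OF f s] u])
  qed
  with lin show ?thesis by (simp add: sharp_morphism_def)
qed

lemma M_functor_sel [simp]: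
  "fobj (M_functor R W) U = relabel_fi (M_seq R W U)"
  "fmor (M_functor R W) U U' \<phi> = (\<lambda>n. relabel_map (carrier (fobj (M_seq R W U) n))
     (carrier (fobj (M_seq R W U') n)) (M_seq_map R W U U' \<phi> n))"
  by (simp_all add: M_functor_def)

lemma H0_functor_sel [simp]:
  "fobj (H0_functor R W) V = (\<lambda>n. relabel_rep (H0 R W (restrict_to_fi V) n))"
  "fmor (H0_functor R W) V V' \<eta> = (\<lambda>n. relabel_map (carrier (H0 R W (restrict_to_fi V) n))
     (carrier (H0 R W (restrict_to_fi V') n)) (H0_map R W (restrict_to_fi V) (restrict_to_fi V') \<eta> n))"
  by (simp_all add: H0_functor_def)

lemma is_functor_M:
  fixes R :: "('k, 'r) ring_scheme"
  assumes R: "cring R" and inf: "infinite (UNIV :: 'u set)"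
  shows "is_functor (FB_Mod R W :: (('k, 'u) fb_module, nat \<Rightarrow> 'u \<Rightarrow> 'u) cat) (sharp_Mod R W) (M_functor R W)"
  unfolding is_functor_def
proof (intro conjI ballI)
  fix U :: "('k, 'u) fb_module" assume U: "U \<in> ob (FB_Mod R W)"
  interpret U: fb_mod R W U by (rule fb_modI[OF R U])
  note ex = U.inj_on_M[OF inf]
  show "fobj (M_functor R W) U \<in> ob (sharp_Mod R W)"
    using sharp_module_relabel[OF U.MS.sharp_mod_axioms ex] by simp
  have id: "(\<lambda>x\<in>carrier (U a). x) \<in> rep_hom R (weyl_group W a) (U a) (U a)" for a
    by (rule rep_homI[OF U.repU linear_map_id]) simp
  have "M_seq_map R W U U (\<lambda>a. \<lambda>x\<in>carrier (U a). x) n x = x" if x: "x \<in> carrier (U.M n)" for n x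
  proof (rule U.gen_eqI[OF U.module_M _ linear_map_id _ x])
    show "linear_map R (U.M n) (U.M n) (M_seq_map R W U U (\<lambda>a. \<lambda>x\<in>carrier (U a). x) n)"
      using M_seq_map_lin_hom[OF U.fb_mod_axioms U.fb_mod_axioms id] by (simp add: lin_hom_iff)
    fix a s u assume s: "s \<in> U.H a n" and u: "u \<in> carrier (U a)"
    show "M_seq_map R W U U (\<lambda>a. \<lambda>x\<in>carrier (U a). x) n (U.gen n a s u) = U.gen n a s u"
      using M_seq_map_gen[OF U.fb_mod_axioms U.fb_mod_axioms id s u] u by (simp only: restrict_apply')
  qed
  then show "fmor (M_functor R W) U U (idm (FB_Mod R W) U) = idm (sharp_Mod R W) (fobj (M_functor R W) U)"
    by (simp add: relabel_map_id[OF ex])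
  fix U' :: "('k, 'u) fb_module" assume U': "U' \<in> ob (FB_Mod R W)"
  interpret U': fb_mod R W U' by (rule fb_modI[OF R U'])
  note ex' = U'.inj_on_M[OF inf]
  fix \<phi> assume \<phi>: "\<phi> \<in> mor (FB_Mod R W) U U'"
  then have \<phi>: "\<phi> a \<in> rep_hom R (weyl_group W a) (U a) (U' a)" for a by simp
  show "fmor (M_functor R W) U U' \<phi> \<in> mor (sharp_Mod R W) (fobj (M_functor R W) U) (fobj (M_functor R W) U')"
    using sharp_morphism_relabel[OF U.MS.sharp_mod_axioms U'.MS.sharp_mod_axioms
        M_seq_map_sharp_morphism[OF U.fb_mod_axioms U'.fb_mod_axioms \<phi>] ex ex'] by simp
  fix U'' :: "('k, 'u) fb_module" assume U'': "U'' \<in> ob (FB_Mod R W)"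
  interpret U'': fb_mod R W U'' by (rule fb_modI[OF R U''])
  fix \<psi> assume "\<psi> \<in> mor (FB_Mod R W) U' U''"
  then have \<psi>: "\<psi> a \<in> rep_hom R (weyl_group W a) (U' a) (U'' a)" for a by simp
  have \<psi>\<phi>: "compose (carrier (U a)) (\<psi> a) (\<phi> a) \<in> rep_hom R (weyl_group W a) (U a) (U'' a)" for a
    unfolding compose_def
    by (rule rep_homI[OF U.repU linear_map_comp[OF rep_homD(1)[OF \<phi>] rep_homD(1)[OF \<psi>]]])
      (simp add: rep_homD(3,4)[OF \<phi>] rep_homD(4)[OF \<psi>])
  note m = M_seq_map_gen[OF U.fb_mod_axioms U'.fb_mod_axioms \<phi>]
    M_seq_map_gen[OF U'.fb_mod_axioms U''.fb_mod_axioms \<psi>]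
    M_seq_map_gen[OF U.fb_mod_axioms U''.fb_mod_axioms \<psi>\<phi>]
  have l: "linear_map R (U.M n) (U'.M n) (M_seq_map R W U U' \<phi> n)"
    "linear_map R (U'.M n) (U''.M n) (M_seq_map R W U' U'' \<psi> n)"
    "linear_map R (U.M n) (U''.M n) (M_seq_map R W U U'' (\<lambda>a. compose (carrier (U a)) (\<psi> a) (\<phi> a)) n)" for n
    using M_seq_map_lin_hom[OF U.fb_mod_axioms U'.fb_mod_axioms \<phi>]
      M_seq_map_lin_hom[OF U'.fb_mod_axioms U''.fb_mod_axioms \<psi>]
      M_seq_map_lin_hom[OF U.fb_mod_axioms U''.fb_mod_axioms \<psi>\<phi>] by (simp_all add: lin_hom_iff)
  have comp: "M_seq_map R W U U'' (\<lambda>a. compose (carrier (U a)) (\<psi> a) (\<phi> a)) n x =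
      M_seq_map R W U' U'' \<psi> n (M_seq_map R W U U' \<phi> n x)" if "x \<in> carrier (U.M n)" for n x
    by (rule U.gen_eqI[OF U''.module_M l(3) linear_map_comp[OF l(1,2)] _ that])
      (simp add: m rep_homD(3)[OF \<phi>] compose_eq)
  have "relabel_map (carrier (U.M n)) (carrier (U''.M n))
        (M_seq_map R W U U'' (\<lambda>a. compose (carrier (U a)) (\<psi> a) (\<phi> a)) n) =
      compose (label (carrier (U.M n)) ` carrier (U.M n))
        (relabel_map (carrier (U'.M n)) (carrier (U''.M n)) (M_seq_map R W U' U'' \<psi> n))
        (relabel_map (carrier (U.M n)) (carrier (U'.M n)) (M_seq_map R W U U' \<phi> n) :: 'u \<Rightarrow> 'u)" for n
    by (rule relabel_map_compose[OF ex ex']) (rule linear_mapD(1)[OF l(1)], assumption, rule comp)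
  then show "fmor (M_functor R W) U U'' (cmp (FB_Mod R W) U U' U'' \<psi> \<phi>) =
      cmp (sharp_Mod R W) (fobj (M_functor R W) U) (fobj (M_functor R W) U') (fobj (M_functor R W) U'')
        (fmor (M_functor R W) U' U'' \<psi>) (fmor (M_functor R W) U U' \<phi>)"
    by simp
qed

lemma (in sharp_mod) inj_on_H0: "\<exists>f :: 'u set \<Rightarrow> 'u. inj_on f (carrier (H0V n))"
  using bij_H0_to_prim[of n] by (auto simp: bij_betw_def)

lemma relabel_map_rep_hom:
  fixes U :: "('k, 'b, 'g) rep" and U' :: "('k, 'c, 'g) rep"
  assumes U: "representation R G U" and U': "representation R G U'" and h: "h \<in> rep_hom R G U U'"
    and ex: "\<exists>f :: 'b \<Rightarrow> 'u. inj_on f (carrier U)" and ex': "\<exists>f :: 'c \<Rightarrow> 'u. inj_on f (carrier U')"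
  shows "relabel_map (carrier U) (carrier U') h \<in> rep_hom R G (relabel_rep U :: ('k, 'u, 'g) rep) (relabel_rep U')"
  unfolding rep_hom_def
proof (intro CollectI conjI ballI)
  have m: "module R U" "module R U'" using U U' by (simp_all add: representation_def)
  show "relabel_map (carrier U) (carrier U') h \<in> lin_hom R (relabel_rep U :: ('k, 'u, 'g) rep) (relabel_rep U')"
    using relabel_map_linear[OF m ex ex' rep_homD(1)[OF h]] by (simp add: lin_hom_iff linear_map_def)
  fix g x assume g: "g \<in> carrier G" and "x \<in> carrier (relabel_rep U :: ('k, 'u, 'g) rep)"
  then obtain y where "y \<in> carrier U" "x = label (carrier U) y" by auto
  then show "relabel_map (carrier U) (carrier U') h (act (relabel_rep U) g x) =
      act (relabel_rep U') g (relabel_map (carrier U) (carrier U') h x)"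
    using g by (simp add: relabel_map_label[OF ex] relabel_map_label[OF ex'] rep_homD(3,4)[OF h]
        representation_act_closed[OF U])
qed

lemma sharp_morI:
  assumes "V \<in> ob (sharp_Mod R W)" "V' \<in> ob (sharp_Mod R W)" "\<eta> \<in> mor (sharp_Mod R W) V V'"
  shows "sharp_mor R W V V' \<eta>"
  using assms sharp_Mod_mor[of R W V V' \<eta>]
  by (auto simp: sharp_mor_def sharp_mor_axioms_def sharp_mod_def)

lemma is_functor_H0:
  fixes R :: "('k, 'r) ring_scheme"
  assumes R: "cring R"
  shows "is_functor (sharp_Mod R W :: (('k, 'u) fi_functor, nat \<Rightarrow> 'u \<Rightarrow> 'u) cat) (FB_Mod R W) (H0_functor R W)"
  unfolding is_functor_def
proof (intro conjI ballI)
  fix V :: "('k, 'u) fi_functor" assume V: "V \<in> ob (sharp_Mod R W)"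
  interpret V: sharp_mod R W V by (rule sharp_modI[OF V])
  note ex = V.inj_on_H0
  show "fobj (H0_functor R W) V \<in> ob (FB_Mod R W)"
    using representation_relabel[OF V.representation_H0 ex] by (simp add: fb_module_def)
  have "(\<lambda>n. \<lambda>x\<in>V.C n. x) \<in> mor (sharp_Mod R W) V V"
    unfolding sharp_Mod_mor[OF V.sharp V.sharp] sharp_morphism_def
    using V.fmor_closed linear_map_restrict[OF V.mV linear_map_id] by (simp add: lin_hom_iff)
  then interpret id: sharp_mor R W V V "\<lambda>n. \<lambda>x\<in>V.C n. x" by (rule sharp_morI[OF V V])
  have "H0_map R W (restrict_to_fi V) (restrict_to_fi V) (\<lambda>n. \<lambda>x\<in>V.C n. x) n x = x"
    if x: "x \<in> carrier (V.H0V n)" for n x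
  proof -
    obtain y where "y \<in> V.C n" "x = V.cl n y" using x by (auto simp: V.Q.carrier_quot)
    then show ?thesis by (simp add: id.H0_map_cl)
  qed
  then show "fmor (H0_functor R W) V V (idm (sharp_Mod R W) V) = idm (FB_Mod R W) (fobj (H0_functor R W) V)"
    by (simp add: relabel_map_id[OF ex] del: V.H0_sel)
  fix V' :: "('k, 'u) fi_functor" assume V': "V' \<in> ob (sharp_Mod R W)"
  interpret V': sharp_mod R W V' by (rule sharp_modI[OF V'])
  note ex' = V'.inj_on_H0
  fix \<eta> assume \<eta>: "\<eta> \<in> mor (sharp_Mod R W) V V'"
  interpret \<eta>: sharp_mor R W V V' \<eta> by (rule sharp_morI[OF V V' \<eta>])
  show "fmor (H0_functor R W) V V' \<eta> \<in> mor (FB_Mod R W) (fobj (H0_functor R W) V) (fobj (H0_functor R W) V')"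
    using relabel_map_rep_hom[OF V.representation_H0 V'.representation_H0 \<eta>.H0_map_rep_hom ex ex']
    by (simp del: V.H0_sel V'.H0_sel)
  fix V'' :: "('k, 'u) fi_functor" assume V'': "V'' \<in> ob (sharp_Mod R W)"
  interpret V'': sharp_mod R W V'' by (rule sharp_modI[OF V''])
  fix \<zeta> assume \<zeta>: "\<zeta> \<in> mor (sharp_Mod R W) V' V''"
  interpret \<zeta>: sharp_mor R W V' V'' \<zeta> by (rule sharp_morI[OF V' V'' \<zeta>])
  have "cmp (sharp_Mod R W) V V' V'' \<zeta> \<eta> \<in> mor (sharp_Mod R W) V V''"
    using category.cmp_closed[OF category_functor_cat[OF category_kmod], of V "sharp_cat W" R V' V'' \<eta> \<zeta>]
      V V' V'' \<eta> \<zeta> unfolding sharp_Mod_def by blast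
  then interpret c: sharp_mor R W V V'' "\<lambda>n. compose (V.C n) (\<zeta> n) (\<eta> n)"
    using sharp_morI[OF V V''] by simp
  let ?H = "\<lambda>V V' \<eta> n. H0_map R W (restrict_to_fi V) (restrict_to_fi V') \<eta> n"
  have comp: "?H V V'' (\<lambda>n. compose (V.C n) (\<zeta> n) (\<eta> n)) n x = ?H V' V'' \<zeta> n (?H V V' \<eta> n x)"
    if x: "x \<in> carrier (V.H0V n)" for n x
  proof -
    obtain y where "y \<in> V.C n" "x = V.cl n y" using x by (auto simp: V.Q.carrier_quot)
    then show ?thesis by (simp add: c.H0_map_cl \<eta>.H0_map_cl \<zeta>.H0_map_cl \<eta>.closed compose_eq)
  qed
  have "relabel_map (carrier (V.H0V n)) (carrier (V''.H0V n)) (?H V V'' (\<lambda>n. compose (V.C n) (\<zeta> n) (\<eta> n)) n) =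
      compose (label (carrier (V.H0V n)) ` carrier (V.H0V n))
        (relabel_map (carrier (V'.H0V n)) (carrier (V''.H0V n)) (?H V' V'' \<zeta> n))
        (relabel_map (carrier (V.H0V n)) (carrier (V'.H0V n)) (?H V V' \<eta> n) :: 'u \<Rightarrow> 'u)" for n
    by (rule relabel_map_compose[OF ex ex']) (rule rep_homD(3)[OF \<eta>.H0_map_rep_hom], assumption, rule comp)
  then show "fmor (H0_functor R W) V V'' (cmp (sharp_Mod R W) V V' V'' \<zeta> \<eta>) =
      cmp (FB_Mod R W) (fobj (H0_functor R W) V) (fobj (H0_functor R W) V') (fobj (H0_functor R W) V'')
        (fmor (H0_functor R W) V' V'' \<zeta>) (fmor (H0_functor R W) V V' \<eta>)"
    by (simp del: V.H0_sel V'.H0_sel V''.H0_sel)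
qed

section \<open>The composites are naturally isomorphic to the identity\<close>

lemma (in fb_mod) top_part_equivariant:
  assumes w: "w \<in> H n n" and y: "y \<in> carrier (M n)"
  shows "top_part n (fmor (M_seq R W U) n n (extend0 n w) y) = act (U n) w (top_part n y)"
proof (rule gen_eqI[OF mU linear_map_comp[OF M_fmor_linear[OF extend0_sharp[OF w]] top_part_linear]
      linear_map_comp[OF top_part_linear act_linear[OF w]] _ y])
  fix a s u assume s: "s \<in> H a n" and u: "u \<in> carrier (U a)"
  have c: "compose (signed a) (extend0 n w) s = compose (signed a) w s"
    using fi_homD(2,3)[OF s] by (auto simp: compose_def extend0_def fun_eq_iff mem_signed)
  have "0 \<notin> extend0 n w ` s ` signed a"
    using fi_homD(2,3)[OF s] fi_homD(2)[OF w] by (auto simp: extend0_def mem_signed)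
  then have "fmor (M_seq R W U) n n (extend0 n w) (gen n a s u) = gen n a (compose (signed a) w s) u"
    by (simp add: M_fmor_gen[OF extend0_sharp[OF w] s u] c)
  then show "top_part n (fmor (M_seq R W U) n n (extend0 n w) (gen n a s u)) = act (U n) w (top_part n (gen n a s u))"
    using linear_map_zero[OF act_linear[OF w] mU mU] s u
    by (auto simp: top_part_gen[OF fi_hom_compose[OF s w] u] top_part_gen[OF s u] act_compose[OF w])
qed

lemma top_part_natural:
  assumes "fb_mod R W U" "fb_mod R W U'" and \<phi>: "\<And>a. \<phi> a \<in> rep_hom R (weyl_group W a) (U a) (U' a)"
    and y: "y \<in> carrier (fobj (M_seq R W U) n)"
  shows "fb_mod.top_part R W U' n (M_seq_map R W U U' \<phi> n y) = \<phi> n (fb_mod.top_part R W U n y)"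
proof -
  interpret A: fb_mod R W U by fact
  interpret B: fb_mod R W U' by fact
  have lin: "linear_map R (A.M n) (B.M n) (M_seq_map R W U U' \<phi> n)"
    using M_seq_map_lin_hom[OF assms(1-3)] by (simp add: lin_hom_iff)
  note \<phi>D = rep_homD[OF \<phi>]
  show ?thesis
  proof (rule A.gen_eqI[OF B.mU linear_map_comp[OF lin B.top_part_linear] linear_map_comp[OF A.top_part_linear \<phi>D(1)] _ y])
    fix a s u assume s: "s \<in> A.H a n" and u: "u \<in> carrier (U a)"
    show "B.top_part n (M_seq_map R W U U' \<phi> n (A.gen n a s u)) = \<phi> n (A.top_part n (A.gen n a s u))"
      unfolding M_seq_map_gen[OF assms(1-3) s u] A.top_part_gen[OF s u] B.top_part_gen[OF s \<phi>D(3)[OF u]]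
      using linear_map_zero[OF \<phi>D(1) A.mU B.mU, of n] s u \<phi>D(4)[of s n u]
      by (cases "a = n") (simp_all add: weyl_group_carrier)
  qed
qed

lemma (in sharp_mor) prim_image: "u \<in> A.prim n \<Longrightarrow> \<eta> n u \<in> B.prim n"
proof -
  assume u: "u \<in> A.prim n"
  have "B.e n i (\<eta> n u) = \<zero>\<^bsub>fobj V' n\<^esub>" if "i \<in> {1..n}" for i
    using u that mor_e[OF A.prim_closed[OF u], of i] zero[of n] by (simp add: A.prim_def)
  then show "\<eta> n u \<in> B.prim n" using closed[OF A.prim_closed[OF u]] by (simp add: B.prim_def)
qed

text \<open>The isomorphism is the composite of \<open>H\<^sub>0(M(U))\<^sub>n \<rightarrow> prim (M(U))\<^sub>n\<close>, induced by the projector, with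
  \<open>top_part\<close>, which maps the primitive part of \<open>M(U)\<^sub>n\<close> back to \<open>U\<^sub>n\<close>; the remaining maps in its
  definition undo the relabelling.\<close>

lemma H0_M_iso_id:
  fixes R :: "('k, 'r) ring_scheme"
  assumes R: "cring R" and inf: "infinite (UNIV :: 'u set)"
  shows "naturally_isomorphic (FB_Mod R W :: (('k, 'u) fb_module, nat \<Rightarrow> 'u \<Rightarrow> 'u) cat) (FB_Mod R W)
    (comp_fctr (H0_functor R W) (M_functor R W)) id_fctr"
proof -
  let ?V = "\<lambda>U :: ('k, 'u) fb_module. relabel_fi (M_seq R W U) :: ('k, 'u) fi_functor"
  let ?H = "\<lambda>U n. H0 R W (restrict_to_fi (?V U)) n"
  let ?G = "\<lambda>U n. relabel_rep (?H U n) :: ('k, 'u, int \<Rightarrow> int) rep"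
  let ?e = "\<lambda>U n y. fb_mod.top_part R W U n (unlabel (carrier (fobj (M_seq R W U) n))
      (sharp_mod.H0_to_prim R W (?V U) n (unlabel (carrier (?H U n)) y)))"
  define \<epsilon> where "\<epsilon> U n = restrict (?e U n) (carrier (?G U n))" for U n
  have mor: "\<epsilon> U \<in> mor (FB_Mod R W) (?G U) U"
    and bij: "bij_betw (\<epsilon> U n) (carrier (?G U n)) (carrier (U n))"
    and G: "fb_module R W (?G U)"
    if U: "U \<in> ob (FB_Mod R W)" for U n
  proof -
    interpret U: fb_mod R W U by (rule fb_modI[OF R U])
    note ex = U.inj_on_M[OF inf]
    interpret V: sharp_mod R W "?V U"
      by (rule sharp_mod.intro[OF sharp_module_relabel[OF U.MS.sharp_mod_axioms ex]])
    note exH = V.inj_on_H0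
    note rep = representation_relabel[OF V.representation_H0 exH]
    then show "fb_module R W (?G U)" by (simp add: fb_module_def)
    interpret un: sharp_mor R W "?V U" "M_seq R W U" "\<lambda>n. unlabel (U.MS.C n)"
      by (rule sharp_mor.intro[OF V.sharp_mod_axioms U.MS.sharp_mod_axioms])
        (simp add: sharp_mor_axioms_def sharp_morphism_unlabel[OF U.MS.sharp_mod_axioms ex])
    interpret la: sharp_mor R W "M_seq R W U" "?V U" "\<lambda>n. label (U.MS.C n)"
      by (rule sharp_mor.intro[OF U.MS.sharp_mod_axioms V.sharp_mod_axioms])
        (simp add: sharp_mor_axioms_def sharp_morphism_label[OF U.MS.sharp_mod_axioms ex])
    have l1: "linear_map R (?G U n) (V.H0V n) (unlabel (carrier (?H U n)))" for n
      unfolding linear_map_relabel_rep by (rule unlabel_linear[OF V.module_H0 exH])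
    have l: "linear_map R (?G U n) (U n) (?e U n)" for n
      by (rule linear_map_comp[OF linear_map_comp[OF linear_map_comp[OF l1 V.H0_to_prim_linear] un.linear] U.top_part_linear])
    have eqv: "?e U n (act (?G U n) w y) = act (U n) w (?e U n y)"
      if w: "w \<in> fi_hom W n n" and y: "y \<in> carrier (?G U n)" for n w y
    proof -
      obtain x where x: "x \<in> carrier (V.H0V n)" "y = label (carrier (V.H0V n)) x" using y by auto
      have wx: "act (V.H0V n) w x \<in> carrier (V.H0V n)"
        by (rule representation_act_closed[OF V.representation_H0 _ x(1)]) (simp add: w weyl_group_carrier)
      have h: "V.H0_to_prim n x \<in> V.C n" by (rule linear_mapD(1)[OF V.H0_to_prim_linear x(1)])
      have "?e U n (act (?G U n) w y) =
          U.top_part n (unlabel (U.MS.C n) (fmor (?V U) n n (extend0 n w) (V.H0_to_prim n x)))"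
        using x wx V.H0_to_prim_equivariant[OF w x(1)]
        by (simp add: relabel_map_label[OF exH] unlabel_label[OF exH] del: V.H0_sel relabel_fi_sel)
      also have "\<dots> = act (U n) w (U.top_part n (unlabel (U.MS.C n) (V.H0_to_prim n x)))"
        by (simp only: un.natural[OF extend0_sharp[OF w] h] U.top_part_equivariant[OF w un.closed[OF h]])
      finally show ?thesis using x by (simp add: unlabel_label[OF exH] del: V.H0_sel relabel_fi_sel)
    qed
    have "\<epsilon> U n \<in> rep_hom R (weyl_group W n) (?G U n) (U n)" for n
      unfolding \<epsilon>_def by (rule rep_homI[OF rep l eqv]) (simp_all only: weyl_group_carrier)
    then show "\<epsilon> U \<in> mor (FB_Mod R W) (?G U) U" by simp
    have b1: "bij_betw (unlabel (carrier (?H U n))) (carrier (?G U n)) (carrier (?H U n))"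
      unfolding relabel_rep_sel by (rule bij_unlabel[OF exH])
    have b2: "bij_betw (unlabel (U.MS.C n)) (V.prim n) (U.MS.prim n)"
    proof (rule bij_betwI[of _ _ _ "label (U.MS.C n)"])
      show "label (U.MS.C n) (unlabel (U.MS.C n) x) = x" if "x \<in> V.prim n" for x
        using V.prim_closed[OF that] by (auto simp: unlabel_label[OF ex])
      show "unlabel (U.MS.C n) (label (U.MS.C n) x :: 'u) = x" if "x \<in> U.MS.prim n" for x
        using U.MS.prim_closed[OF that] by (simp add: unlabel_label[OF ex])
    qed (use un.prim_image la.prim_image in auto)
    have b3: "bij_betw (U.top_part n) (U.MS.prim n) (carrier (U n))"
    proof (rule bij_betwI[of _ _ _ "U.gen n n (U.idn n)"])
      show "U.gen n n (U.idn n) (U.top_part n x) = x" if "x \<in> U.MS.prim n" for x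
        using U.p_eq_top_part[OF U.MS.prim_closed[OF that]] U.MS.p_prim[OF that] by simp
    qed (use U.gen_prim U.top_part_gen_id linear_mapD(1)[OF U.top_part_linear] U.MS.prim_closed in auto)
    have "bij_betw (?e U n) (carrier (?G U n)) (carrier (U n))"
      using bij_betw_trans[OF bij_betw_trans[OF bij_betw_trans[OF b1 V.bij_H0_to_prim] b2] b3]
      by (simp add: comp_def)
    then show "bij_betw (\<epsilon> U n) (carrier (?G U n)) (carrier (U n))"
      by (rule iffD1[OF bij_betw_cong, rotated]) (simp add: \<epsilon>_def)
  qed
  have nat: "compose (carrier (?G U n)) (\<epsilon> U' n)
      (fmor (H0_functor R W) (?V U) (?V U') (fmor (M_functor R W) U U' \<phi>) n)
      = compose (carrier (?G U n)) (\<phi> n) (\<epsilon> U n)"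
    if U: "U \<in> ob (FB_Mod R W)" and U': "U' \<in> ob (FB_Mod R W)" and \<phi>: "\<phi> \<in> mor (FB_Mod R W) U U'"
    for U U' \<phi> n
  proof -
    interpret U: fb_mod R W U by (rule fb_modI[OF R U])
    interpret U': fb_mod R W U' by (rule fb_modI[OF R U'])
    note ex = U.inj_on_M[OF inf] and ex' = U'.inj_on_M[OF inf]
    have \<phi>': "\<phi> a \<in> rep_hom R (weyl_group W a) (U a) (U' a)" for a using \<phi> by simp
    let ?m = "fmor (M_functor R W) U U' \<phi> :: nat \<Rightarrow> 'u \<Rightarrow> 'u"
    note F = is_functor_M[OF R inf, of W, unfolded is_functor_def]
    have V: "?V U \<in> ob (sharp_Mod R W)" "?V U' \<in> ob (sharp_Mod R W)" "?m \<in> mor (sharp_Mod R W) (?V U) (?V U')"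
      using F U U' \<phi> unfolding M_functor_sel(1) by blast+
    interpret m: sharp_mor R W "?V U" "?V U'" ?m by (rule sharp_morI[OF V])
    note exH = m.A.inj_on_H0 and exH' = m.B.inj_on_H0
    show ?thesis
    proof (rule restrict_ext[of _ "\<lambda>y. \<epsilon> U' n (fmor (H0_functor R W) (?V U) (?V U') ?m n y)"
          "\<lambda>y. \<phi> n (\<epsilon> U n y)", folded compose_def])
      fix y assume y: "y \<in> carrier (?G U n)"
      then obtain x where x: "x \<in> carrier (m.A.H0V n)" "y = label (carrier (m.A.H0V n)) x" by auto
      let ?x' = "H0_map R W (restrict_to_fi (?V U)) (restrict_to_fi (?V U')) ?m n x"
      have x': "?x' \<in> carrier (m.B.H0V n)" by (rule rep_homD(3)[OF m.H0_map_rep_hom x(1)])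
      have "m.A.H0_to_prim n x \<in> m.A.C n" by (rule linear_mapD(1)[OF m.A.H0_to_prim_linear x(1)])
      then obtain z where z: "z \<in> carrier (U.M n)" "m.A.H0_to_prim n x = label (carrier (U.M n)) z" by auto
      have z': "M_seq_map R W U U' \<phi> n z \<in> carrier (U'.M n)"
        using M_seq_map_lin_hom[OF U.fb_mod_axioms U'.fb_mod_axioms \<phi>', of n] z
        by (simp add: lin_hom_iff linear_map_def)
      have "\<epsilon> U' n (fmor (H0_functor R W) (?V U) (?V U') ?m n y) = \<epsilon> U' n (label (carrier (m.B.H0V n)) ?x')"
        using x by (simp only: H0_functor_sel relabel_map_label[OF exH])
      also have "\<dots> = U'.top_part n (unlabel (carrier (U'.M n)) (m.B.H0_to_prim n ?x'))"
        unfolding \<epsilon>_def using x' by (simp add: unlabel_label[OF exH'] del: m.B.H0_sel relabel_fi_sel M_functor_sel)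
      also have "m.B.H0_to_prim n ?x' = label (carrier (U'.M n)) (M_seq_map R W U U' \<phi> n z)"
        unfolding m.H0_to_prim_natural[OF x(1)] unfolding M_functor_sel z(2)
        by (rule relabel_map_label[OF ex z(1)])
      also have "U'.top_part n (unlabel (carrier (U'.M n)) (label (carrier (U'.M n)) (M_seq_map R W U U' \<phi> n z) :: 'u))
          = \<phi> n (U.top_part n z)"
        by (simp only: unlabel_label[OF ex' z'] top_part_natural[OF U.fb_mod_axioms U'.fb_mod_axioms \<phi>' z(1)])
      also have "U.top_part n z = \<epsilon> U n y"
        unfolding \<epsilon>_def using x z
        by (simp add: unlabel_label[OF exH] unlabel_label[OF ex] del: m.A.H0_sel relabel_fi_sel M_functor_sel)
      finally show "\<epsilon> U' n (fmor (H0_functor R W) (?V U) (?V U') ?m n y) = \<phi> n (\<epsilon> U n y)" .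
    qed
  qed
  show ?thesis
    unfolding naturally_isomorphic_def is_nat_trans_def comp_fctr_def id_fctr_def fctr.simps
  proof (intro exI[of _ \<epsilon>] conjI ballI)
    fix U :: "('k, 'u) fb_module" assume U: "U \<in> ob (FB_Mod R W)"
    show "\<epsilon> U \<in> mor (FB_Mod R W) (fobj (H0_functor R W) (fobj (M_functor R W) U)) U"
      using mor[OF U] by simp
    show "is_iso (FB_Mod R W) (fobj (H0_functor R W) (fobj (M_functor R W) U)) U (\<epsilon> U)"
      using is_iso_FB_Mod[OF G[OF U] _ mor[OF U] bij[OF U]] U by simp
    fix U' :: "('k, 'u) fb_module" and \<phi>
    assume "U' \<in> ob (FB_Mod R W)" "\<phi> \<in> mor (FB_Mod R W) U U'"
    from nat[OF U this] show "cmp (FB_Mod R W) (fobj (H0_functor R W) (fobj (M_functor R W) U))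
        (fobj (H0_functor R W) (fobj (M_functor R W) U')) U' (\<epsilon> U')
        (fmor (H0_functor R W) (fobj (M_functor R W) U) (fobj (M_functor R W) U') (fmor (M_functor R W) U U' \<phi>)) =
       cmp (FB_Mod R W) (fobj (H0_functor R W) (fobj (M_functor R W) U)) U U' \<phi> (\<epsilon> U)"
      unfolding FB_Mod_sel M_functor_sel(1) H0_functor_sel(1) by (rule ext)
  qed
qed

text \<open>The isomorphism \<open>M(H\<^sub>0(V)) \<rightarrow> V\<close> extends the identification \<open>\<phi>\<close> of \<open>H\<^sub>0(V)\<^sub>a\<close> with the primitive
  part of \<open>V\<^sub>a\<close>.  Naturality in \<open>V\<close> is an equation between linear maps on \<open>M(H\<^sub>0(V))\<^sub>n\<close> and
  holds on generators because \<open>\<phi>\<close> is natural.\<close>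

lemma M_H0_iso_id:
  fixes R :: "('k, 'r) ring_scheme"
  assumes R: "cring R" and inf: "infinite (UNIV :: 'u set)"
  shows "naturally_isomorphic (sharp_Mod R W :: (('k, 'u) fi_functor, nat \<Rightarrow> 'u \<Rightarrow> 'u) cat) (sharp_Mod R W)
    (comp_fctr (M_functor R W) (H0_functor R W)) id_fctr"
proof -
  let ?U = "\<lambda>V :: ('k, 'u) fi_functor. fobj (H0_functor R W) V :: ('k, 'u) fb_module"
  let ?M = "\<lambda>V. M_seq R W (?U V)"
  let ?c = "\<lambda>V n. carrier (fobj (?M V) n)"
  let ?\<phi> = "\<lambda>V n u. sharp_mod.H0_to_prim R W V n (unlabel (carrier (H0 R W (restrict_to_fi V) n)) u)"
  have fb: "fb_mod R W (?U V)" if "V \<in> ob (sharp_Mod R W)" for V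
    using is_functor_H0[OF R, of W] that unfolding is_functor_def by (intro fb_modI[OF R]) blast
  have "\<exists>\<theta>. sharp_morphism R W (?M V) V \<theta> \<and> (\<forall>n a. \<forall>s\<in>fi_hom W a n. \<forall>u\<in>carrier (?U V a).
      \<theta> n (fb_mod.gen R W (?U V) n a s u) = fmor V a n (extend0 a s) (?\<phi> V a u)) \<and>
      (\<forall>n. bij_betw (\<theta> n) (?c V n) (carrier (fobj V n)))"
    if V: "V \<in> ob (sharp_Mod R W)" for V
  proof -
    interpret V: sharp_mod R W V by (rule sharp_modI[OF V])
    interpret U: fb_mod R W "?U V" by (rule fb[OF V])
    note exH = V.inj_on_H0
    have l1: "linear_map R (?U V a) (V.H0V a) (unlabel (carrier (V.H0V a)))" for a
      unfolding H0_functor_sel linear_map_relabel_rep by (rule unlabel_linear[OF V.module_H0 exH])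
    have lin: "linear_map R (?U V a) (fobj V a) (?\<phi> V a)" for a
      by (rule linear_map_comp[OF l1 V.H0_to_prim_linear])
    have b1: "bij_betw (unlabel (carrier (V.H0V n))) (carrier (?U V n)) (carrier (V.H0V n))" for n
      unfolding H0_functor_sel relabel_rep_sel by (rule bij_unlabel[OF exH])
    have b: "bij_betw (?\<phi> V n) (carrier (?U V n)) (V.prim n)" for n
      using bij_betw_trans[OF b1 V.bij_H0_to_prim, of n] by (simp add: comp_def)
    have eqv: "?\<phi> V a (act (?U V a) w u) = fmor V a a (extend0 a w) (?\<phi> V a u)"
      if w: "w \<in> fi_hom W a a" and u: "u \<in> carrier (?U V a)" for a w u
    proof -
      obtain x where x: "x \<in> carrier (V.H0V a)" "u = label (carrier (V.H0V a)) x" using u by auto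
      have wx: "act (V.H0V a) w x \<in> carrier (V.H0V a)"
        by (rule representation_act_closed[OF V.representation_H0 _ x(1)]) (simp add: w weyl_group_carrier)
      show ?thesis using x wx V.H0_to_prim_equivariant[OF w x(1)]
        by (simp add: relabel_map_label[OF exH] unlabel_label[OF exH] del: V.H0_sel)
    qed
    have "\<exists>\<theta>. sharp_morphism R W (?M V) V \<theta> \<and> (\<forall>n a. \<forall>s\<in>fi_hom W a n. \<forall>u\<in>carrier (?U V a).
      \<theta> n (U.gen n a s u) = fmor V a n (extend0 a s) (?\<phi> V a u))"
      by (rule morphism_from_induced[OF U.fb_mod_axioms V.sharp_mod_axioms lin eqv])
        (use b in \<open>auto simp: bij_betw_def simp del: H0_functor_sel V.H0_sel\<close>)
    then obtain \<theta> where \<theta>: "sharp_morphism R W (?M V) V \<theta>"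
      "\<forall>n a. \<forall>s\<in>fi_hom W a n. \<forall>u\<in>carrier (?U V a).
      \<theta> n (U.gen n a s u) = fmor V a n (extend0 a s) (?\<phi> V a u)" by blast
    have "\<theta> n (U.gen n n (U.idn n) u) = ?\<phi> V n u" if u: "u \<in> carrier (?U V n)" for n u
      using \<theta>(2)[rule_format, OF fi_hom_id u] linear_mapD(1)[OF lin u]
      by (simp only: extend0_id V.fmor_id)
    then have "bij_betw (\<theta> n) (?c V n) (V.C n)" for n
      by (rule morphism_from_induced_bij[OF U.fb_mod_axioms V.sharp_mod_axioms \<theta>(1) _ b])
    with \<theta> show ?thesis by blast
  qed
  then obtain \<theta> where \<theta>: "\<And>V. V \<in> ob (sharp_Mod R W) \<Longrightarrow> sharp_morphism R W (?M V) V (\<theta> V)"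
    "\<And>V n a s u. V \<in> ob (sharp_Mod R W) \<Longrightarrow> s \<in> fi_hom W a n \<Longrightarrow> u \<in> carrier (?U V a) \<Longrightarrow>
      \<theta> V n (fb_mod.gen R W (?U V) n a s u) = fmor V a n (extend0 a s) (?\<phi> V a u)"
    "\<And>V n. V \<in> ob (sharp_Mod R W) \<Longrightarrow> bij_betw (\<theta> V n) (?c V n) (carrier (fobj V n))"
    by metis
  let ?N = "\<lambda>V. relabel_fi (?M V) :: ('k, 'u) fi_functor"
  define \<tau> where "\<tau> V n = restrict (\<lambda>y. \<theta> V n (unlabel (?c V n) y)) (carrier (fobj (?N V) n))" for V n
  have N: "sharp_module R W (?N V)"
    and mor: "\<tau> V \<in> mor (sharp_Mod R W) (?N V) V"
    and bij: "bij_betw (\<tau> V n) (carrier (fobj (?N V) n)) (carrier (fobj V n))"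
    if V: "V \<in> ob (sharp_Mod R W)" for V n
  proof -
    interpret V: sharp_mod R W V by (rule sharp_modI[OF V])
    interpret U: fb_mod R W "?U V" by (rule fb[OF V])
    note ex = U.inj_on_M[OF inf]
    show N: "sharp_module R W (?N V)" by (rule sharp_module_relabel[OF U.MS.sharp_mod_axioms ex])
    interpret N: sharp_mod R W "?N V" by (rule sharp_mod.intro[OF N])
    have m: "sharp_morphism R W (?N V) V (\<lambda>n y. \<theta> V n (unlabel (?c V n) y))"
      by (rule sharp_morphism_comp[OF sharp_morphism_unlabel[OF U.MS.sharp_mod_axioms ex] \<theta>(1)[OF V]])
    show "\<tau> V \<in> mor (sharp_Mod R W) (?N V) V"
      unfolding sharp_Mod_mor[OF N V.sharp] sharp_morphism_def
    proof (intro conjI allI ballI)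
      fix n
      show "\<tau> V n \<in> extensional (N.C n)" by (simp add: \<tau>_def)
      have "linear_map R (fobj (?N V) n) (fobj V n) (\<lambda>y. \<theta> V n (unlabel (?c V n) y))"
        using m unfolding sharp_morphism_def by blast
      from linear_map_restrict[OF N.mV this] show "linear_map R (fobj (?N V) n) (fobj V n) (\<tau> V n)"
        unfolding \<tau>_def by (simp only: lin_hom_iff)
    next
      fix m n f x assume f: "f \<in> sharp_hom W m n" and x: "x \<in> N.C m"
      show "\<tau> V n (fmor (?N V) m n f x) = fmor V m n f (\<tau> V m x)"
        unfolding \<tau>_def using N.fmor_closed[OF f x] x f m
        by (simp add: sharp_morphism_def del: relabel_fi_sel H0_functor_sel)
    qed
    have "bij_betw (\<lambda>y. \<theta> V n (unlabel (?c V n) y)) (N.C n) (V.C n)"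
      using bij_betw_trans[OF bij_unlabel[OF ex] \<theta>(3)[OF V], of n] by (simp add: comp_def)
    then show "bij_betw (\<tau> V n) (N.C n) (V.C n)"
      by (rule iffD1[OF bij_betw_cong, rotated]) (simp add: \<tau>_def)
  qed
  have nat: "compose (carrier (fobj (?N V) n)) (\<tau> V' n)
      (fmor (M_functor R W) (?U V) (?U V') (fmor (H0_functor R W) V V' \<eta>) n)
      = compose (carrier (fobj (?N V) n)) (\<eta> n) (\<tau> V n)"
    if V: "V \<in> ob (sharp_Mod R W)" and V': "V' \<in> ob (sharp_Mod R W)" and \<eta>: "\<eta> \<in> mor (sharp_Mod R W) V V'"
    for V V' \<eta> n
  proof -
    interpret \<eta>: sharp_mor R W V V' \<eta> by (rule sharp_morI[OF V V' \<eta>])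
    interpret U: fb_mod R W "?U V" by (rule fb[OF V])
    interpret U': fb_mod R W "?U V'" by (rule fb[OF V'])
    note ex = U.inj_on_M[OF inf] and ex' = U'.inj_on_M[OF inf]
    note exH = \<eta>.A.inj_on_H0 and exH' = \<eta>.B.inj_on_H0
    let ?h = "fmor (H0_functor R W) V V' \<eta> :: nat \<Rightarrow> 'u \<Rightarrow> 'u"
    have h: "?h a \<in> rep_hom R (weyl_group W a) (?U V a) (?U V' a)" for a
      unfolding H0_functor_sel
      by (rule relabel_map_rep_hom[OF \<eta>.A.representation_H0 \<eta>.B.representation_H0 \<eta>.H0_map_rep_hom exH exH'])
    note mm = U.fb_mod_axioms U'.fb_mod_axioms h
    have lm: "linear_map R (U.M n) (U'.M n) (M_seq_map R W (?U V) (?U V') ?h n)"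
      using M_seq_map_lin_hom[OF mm] by (simp add: lin_hom_iff)
    have lt: "linear_map R (U.M n) (fobj V n) (\<theta> V n)" "linear_map R (U'.M n) (fobj V' n) (\<theta> V' n)"
      using \<theta>(1)[OF V] \<theta>(1)[OF V'] by (simp_all only: sharp_morphism_def)
    have key: "\<theta> V' n (M_seq_map R W (?U V) (?U V') ?h n z) = \<eta> n (\<theta> V n z)"
      if z: "z \<in> carrier (U.M n)" for z
    proof (rule U.gen_eqI[OF \<eta>.B.mV linear_map_comp[OF lm lt(2)] linear_map_comp[OF lt(1) \<eta>.linear] _ z])
      fix a s u assume s: "s \<in> fi_hom W a n" and u: "u \<in> carrier (?U V a)"
      obtain x where x: "x \<in> carrier (\<eta>.A.H0V a)" "u = label (carrier (\<eta>.A.H0V a)) x" using u by auto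
      let ?x' = "H0_map R W (restrict_to_fi V) (restrict_to_fi V') \<eta> a x"
      have x': "?x' \<in> carrier (\<eta>.B.H0V a)" by (rule rep_homD(3)[OF \<eta>.H0_map_rep_hom x(1)])
      have "?h a u = label (carrier (\<eta>.B.H0V a)) ?x'"
        unfolding H0_functor_sel x(2) by (rule relabel_map_label[OF exH x(1)])
      then have "?\<phi> V' a (?h a u) = \<eta>.B.H0_to_prim a ?x'"
        by (simp only: unlabel_label[OF exH' x'])
      also have "\<dots> = \<eta> a (?\<phi> V a u)"
        unfolding x(2) unlabel_label[OF exH x(1)] by (rule \<eta>.H0_to_prim_natural[OF x(1)])
      finally have e: "?\<phi> V' a (?h a u) = \<eta> a (?\<phi> V a u)" .
      have c: "?\<phi> V a u \<in> \<eta>.A.C a"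
        unfolding x(2) unlabel_label[OF exH x(1)] by (rule linear_mapD(1)[OF \<eta>.A.H0_to_prim_linear x(1)])
      have "\<theta> V' n (M_seq_map R W (?U V) (?U V') ?h n (U.gen n a s u)) =
          fmor V' a n (extend0 a s) (?\<phi> V' a (?h a u))"
        unfolding M_seq_map_gen[OF mm s u] by (rule \<theta>(2)[OF V' s rep_homD(3)[OF h u]])
      also have "\<dots> = \<eta> n (\<theta> V n (U.gen n a s u))"
        unfolding e \<theta>(2)[OF V s u] by (rule \<eta>.natural[OF extend0_sharp[OF s] c, symmetric])
      finally show "\<theta> V' n (M_seq_map R W (?U V) (?U V') ?h n (U.gen n a s u)) = \<eta> n (\<theta> V n (U.gen n a s u))" .
    qed
    show ?thesis
    proof (rule restrict_ext[of _ "\<lambda>y. \<tau> V' n (fmor (M_functor R W) (?U V) (?U V') ?h n y)"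
          "\<lambda>y. \<eta> n (\<tau> V n y)", folded compose_def])
      fix y assume y: "y \<in> carrier (fobj (?N V) n)"
      then obtain z where z: "z \<in> carrier (U.M n)" "y = label (carrier (U.M n)) z"
        unfolding relabel_fi_sel relabel_module_sel by blast
      let ?z' = "M_seq_map R W (?U V) (?U V') ?h n z"
      have z': "?z' \<in> carrier (U'.M n)" by (rule linear_mapD(1)[OF lm z(1)])
      have "\<tau> V' n (fmor (M_functor R W) (?U V) (?U V') ?h n y) = \<tau> V' n (label (carrier (U'.M n)) ?z')"
        unfolding M_functor_sel z(2) relabel_map_label[OF ex z(1)] by (rule refl)
      also have "\<dots> = \<theta> V' n ?z'"
        unfolding \<tau>_def relabel_fi_sel relabel_module_sel using z'
        by (simp only: restrict_apply' imageI unlabel_label[OF ex'])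
      also have "\<dots> = \<eta> n (\<tau> V n y)"
        unfolding \<tau>_def relabel_fi_sel relabel_module_sel z(2) using z(1)
        by (simp only: restrict_apply' imageI unlabel_label[OF ex] key)
      finally show "\<tau> V' n (fmor (M_functor R W) (?U V) (?U V') ?h n y) = \<eta> n (\<tau> V n y)" .
    qed
  qed
  show ?thesis
    unfolding naturally_isomorphic_def is_nat_trans_def comp_fctr_def id_fctr_def fctr.simps
  proof (intro exI[of _ \<tau>] conjI ballI)
    fix V :: "('k, 'u) fi_functor" assume V: "V \<in> ob (sharp_Mod R W)"
    show "\<tau> V \<in> mor (sharp_Mod R W) (fobj (M_functor R W) (fobj (H0_functor R W) V)) V"
      unfolding M_functor_sel(1) by (rule mor[OF V])
    show "is_iso (sharp_Mod R W) (fobj (M_functor R W) (fobj (H0_functor R W) V)) V (\<tau> V)"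
      unfolding M_functor_sel(1) using V by (intro is_iso_sharp_Mod[OF N[OF V] _ mor[OF V] bij[OF V]]) simp
    fix V' :: "('k, 'u) fi_functor" and \<eta>
    assume "V' \<in> ob (sharp_Mod R W)" "\<eta> \<in> mor (sharp_Mod R W) V V'"
    from nat[OF V this] show "cmp (sharp_Mod R W) (fobj (M_functor R W) (fobj (H0_functor R W) V))
        (fobj (M_functor R W) (fobj (H0_functor R W) V')) V' (\<tau> V')
        (fmor (M_functor R W) (fobj (H0_functor R W) V) (fobj (H0_functor R W) V') (fmor (H0_functor R W) V V' \<eta>)) =
       cmp (sharp_Mod R W) (fobj (M_functor R W) (fobj (H0_functor R W) V)) V V' \<eta> (\<tau> V)"
      unfolding sharp_Mod_sel M_functor_sel(1) by (rule ext)
  qed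
qed

section \<open>The equivalence of categories\<close>

theorem theorem3p7:
  fixes R :: "('k, 'r) ring_scheme" and W :: weyl_type
  assumes "cring R"
  shows "(\<forall>V :: ('k, 'v) fi_functor. sharp_module R W V \<longrightarrow>
            (\<exists>U :: nat \<Rightarrow> ('k, 'v, int \<Rightarrow> int) rep.
               (\<forall>a. representation R (weyl_group W a) (U a)) \<and>
               sharp_isomorphic R W V (fi_direct_sum (\<lambda>a. M_rep R W a (U a))))) \<and>
         (infinite (UNIV :: 'u set) \<longrightarrow>
            equivalence_of_categories
              (FB_Mod R W :: (('k, 'u) fb_module, nat \<Rightarrow> 'u \<Rightarrow> 'u) cat)
              (sharp_Mod R W :: (('k, 'u) fi_functor, nat \<Rightarrow> 'u \<Rightarrow> 'u) cat)
              (M_functor R W) (H0_functor R W))"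
proof (intro conjI allI impI)
  fix V :: "('k, 'v) fi_functor" assume "sharp_module R W V"
  then interpret V: sharp_mod R W V by (rule sharp_mod.intro)
  show "\<exists>U :: nat \<Rightarrow> ('k, 'v, int \<Rightarrow> int) rep. (\<forall>a. representation R (weyl_group W a) (U a)) \<and>
      sharp_isomorphic R W V (fi_direct_sum (\<lambda>a. M_rep R W a (U a)))"
    using V.representation_prim V.isomorphic_induced_prim unfolding M_seq_def by blast
next
  assume inf: "infinite (UNIV :: 'u set)"
  show "equivalence_of_categories
      (FB_Mod R W :: (('k, 'u) fb_module, nat \<Rightarrow> 'u \<Rightarrow> 'u) cat)
      (sharp_Mod R W :: (('k, 'u) fi_functor, nat \<Rightarrow> 'u \<Rightarrow> 'u) cat)
      (M_functor R W) (H0_functor R W)"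
    unfolding equivalence_of_categories_def
    using category_FB_Mod category_functor_cat[OF category_kmod] is_functor_M[OF assms inf]
      is_functor_H0[OF assms] H0_M_iso_id[OF assms inf] M_H0_iso_id[OF assms inf]
    by (auto simp: sharp_Mod_def)
qed

end
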